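(* For every constant $0<\varepsilon<1$ there are constants (implicit in the $\Omega(\cdot)$ and $\Theta(\cdot)$ below, depending only on $\varepsilon$) such that for every integer $k\ge 2$ and every sufficiently large $n$, there is an instance of \textsc{Basic $(2k-1)$-Spanner} on $n$ vertices for which, with $r=n^{\Omega(\varepsilon)}$, the integrality gap of $\text{SDP}^r_{Spanner}$ (the $r$-th level Lasserre SDP defined in the context) is at least $\frac{1}{k}\cdot\left(\frac{n}{k}\right)^{\min\left\{\frac{1}{18},\frac{5}{32k-6}\right\}-\Theta(\varepsilon)}=n^{\Theta(\frac{1}{k}-\varepsilon)}$.
   Context: \textsc{Basic $t$-Spanner}: given an undirected graph $G=(V,E)$ (unit edge lengths), find a subgraph $H=(V,S)$, $S\subseteq E$, with $|S|$ minimum such that $d_H(u,v)\le t\cdot d_G(u,v)$ for all $u,v\in V$ (equivalently, for every $\{u,v\}\in E$, $H$ contains a $u$-$v$ path with at most $t$ edges). For $\{u,v\}\in E$ let $\mathcal P_{u,v}$ be the set of $u$-$v$ paths in $G$ with at most $t$ edges, and let $\mathcal Z^{u,v}=\{\mathbf z\in[0,1]^{E}:\sum_{e\in P}z_e\ge 1\ \forall P\in\mathcal P_{u,v}\}$. The base LP is $\min\sum_{e\in E}x_e$ subject to $\sum_{e\in E}z_e x_e\ge 1$ for all $\{u,v\}\in E$ and $\mathbf z\in\mathcal Z^{u,v}$, and $x_e\ge 0$. Its $r$-th level Lasserre SDP $\text{SDP}^r_{Spanner}$ has a variable $y_I\in[0,1]$ for every $I\subseteq E$, and is: minimize $\sum_{e\in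 E}y_{\{e\}}$ subject to $y_\varnothing=1$; the moment matrix $M_{r+1}(y)=(y_{I\cup J})_{|I|,|J|\le r+1}$ is positive semidefinite; and for every $\{u,v\}\in E$ and every $\mathbf z\in\mathcal Z^{u,v}$, the slack moment matrix $M^{\mathbf z}_r(y)=\left(\sum_{e\in E}z_e y_{I\cup J\cup\{e\}}-y_{I\cup J}\right)_{|I|,|J|\le r}$ is positive semidefinite. The integrality gap on an instance is the ratio of the minimum size of a $t$-spanner to the optimal value of the SDP; here $t=2k-1$. *)

theory Defs
  imports Complex_Main
begin

definition is_graph :: "nat \<Rightarrow> nat set set \<Rightarrow> bool" where
  "is_graph n E \<longleftrightarrow> (\<forall>e\<in>E. \<exists>a b. a < n \<and> b < n \<and> a \<noteq> b \<and> e = {a, b})"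

definition path_edges :: "nat list \<Rightarrow> nat set set" where
  "path_edges p = {{p ! i, p ! Suc i} | i. Suc i < length p}"

definition is_path :: "nat set set \<Rightarrow> nat \<Rightarrow> nat \<Rightarrow> nat list \<Rightarrow> bool" where
  "is_path S u v p \<longleftrightarrow> p \<noteq> [] \<and> hd p = u \<and> last p = v \<and> distinct p \<and> path_edges p \<subseteq> S"

definition short_paths :: "nat set set \<Rightarrow> nat \<Rightarrow> nat \<Rightarrow> nat \<Rightarrow> nat list set" where
  "short_paths S t u v = {p. is_path S u v p \<and> length p \<le> t + 1}"

definition is_spanner :: "nat set set \<Rightarrow> nat \<Rightarrow> nat set set \<Rightarrow> bool" where
  "is_spanner E t S \<longleftrightarrow> S \<subseteq> E \<and> (\<forall>u v. {u, v} \<in> E \<longrightarrow> short_paths S t u v \<noteq> {})"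

definition min_spanner_size :: "nat set set \<Rightarrow> nat \<Rightarrow> nat" where
  "min_spanner_size E t = Min (card ` {S. is_spanner E t S})"

definition Zset :: "nat set set \<Rightarrow> nat \<Rightarrow> nat \<Rightarrow> nat \<Rightarrow> (nat set \<Rightarrow> real) set" where
  "Zset E t u v = {z. (\<forall>e\<in>E. 0 \<le> z e \<and> z e \<le> 1) \<and>
                      (\<forall>p\<in>short_paths E t u v. (\<Sum>e\<in>path_edges p. z e) \<ge> 1)}"

definition psd_on :: "'b set \<Rightarrow> ('b \<Rightarrow> 'b \<Rightarrow> real) \<Rightarrow> bool" where
  "psd_on S M \<longleftrightarrow> (\<forall>x. (\<Sum>i\<in>S. \<Sum>j\<in>S. x i * x j * M i j) \<ge> 0)"

definition lasserre_index :: "nat set set \<Rightarrow> nat \<Rightarrow> nat set set set" where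
  "lasserre_index E r = {I. I \<subseteq> E \<and> card I \<le> r}"

definition sdp_feasible :: "nat set set \<Rightarrow> nat \<Rightarrow> nat \<Rightarrow> (nat set set \<Rightarrow> real) \<Rightarrow> bool" where
  "sdp_feasible E t r y \<longleftrightarrow>
     (\<forall>I. I \<subseteq> E \<longrightarrow> 0 \<le> y I \<and> y I \<le> 1) \<and>
     y {} = 1 \<and>
     psd_on (lasserre_index E (r + 1)) (\<lambda>I J. y (I \<union> J)) \<and>
     (\<forall>u v. {u, v} \<in> E \<longrightarrow> (\<forall>z\<in>Zset E t u v.
        psd_on (lasserre_index E r)
          (\<lambda>I J. (\<Sum>f\<in>E. z f * y (I \<union> J \<union> {f})) - y (I \<union> J))))"

definition sdp_value :: "nat set set \<Rightarrow> nat \<Rightarrow> nat \<Rightarrow> real" where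
  "sdp_value E t r = Inf {(\<Sum>e\<in>E. y {e}) | y. sdp_feasible E t r y}"

definition integrality_gap :: "nat set set \<Rightarrow> nat \<Rightarrow> nat \<Rightarrow> real" where
  "integrality_gap E t r = real (min_spanner_size E t) / sdp_value E t r"

end

theory Submission
  imports Defs "HOL-Library.FuncSet" "HOL-Library.Function_Algebras" "HOL-Library.Product_Plus" "HOL-Library.Z2"
    "HOL-Algebra.Algebraic_Closure_Type"
begin

text \<open>
  A random linear constraint system over \<open>GF(2^m)\<close> is encoded as a spanner instance. Clauses and variables
  become supernodes; a clause has labels \<open>(x, y)\<close>, a variable has labels \<open>w\<close>, and the \<open>i\<close>-th variable of
  clause \<open>a\<close> is required to carry \<open>x + \<theta>\<^sub>i y + c\<^sub>a\<^sub>i\<close>. Every supernode has many copies of a hub at the end of a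
  chain of length \<open>k - 2\<close>; the other end is joined to all labels of the supernode. For a clause and one of its variables,
  the outer edge between their hubs can be spanned within \<open>2k - 1\<close> steps only by choosing a pair of compatible labels,
  because the incidence graph restricted to the edges in use has no short cycle.

  A low-degree solution of the SDP is Grigoriev's pseudo-distribution: a character has pseudo-expectation
  \<open>\<plusminus>1\<close> if it is a combination of few constraints and \<open>0\<close> otherwise. Since any two coordinates of a clause are
  independent, a nonzero combination that cancels at a clause involves at least three of its variables; so if all small sets
  of \<open>s\<close> clauses see more than \<open>(K - 3/2 + \<delta>) s\<close> variables, then derivations with small boundary are short. Hence
  derivability is transitive on characters of small support, and the moment matrix is a sum of rank-one blocks.

  An integral solution must use many labels: for random shifts \<open>c\<close>, an exponential moment bound and a union bound
  over all choices of labels show that one clause label is compatible with few chosen variable labels.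
\<close>

section \<open>Local functions of a labelling\<close>

text \<open>The pseudo-distribution is kept as a signed measure on genuine labellings; only the
  squares of functions that read few labels are known to have nonnegative mean. All sizes are powers
  of one base \<open>B\<close>, and the gap is \<open>g / k\<close> with \<open>g = B ^ d\<close>.
  Soundness against about \<open>g\<close> labels per supernode asks that alphabet and clause width
  exceed \<open>g * g\<close> by a fixed power of \<open>B\<close>, so both are
  \<open>K = B ^ \<kappa>\<close> with \<open>\<kappa> = 2 * d + 4\<close>. There are
  \<open>K ^ 3\<close> hub copies, so that the hubs outweigh the inner edges, which the SDP buys in
  full. Each of the \<open>K\<close> blocks has about \<open>B ^ ((f + 1) * \<kappa>)\<close>
  variables: expansion needs \<open>f \<ge> 4\<close>, scarcity of short cycles needs
  \<open>f \<ge> 2 * k - 3\<close>. With about \<open>k * B ^ ((f + 5) * \<kappa>)\<close> vertices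
  the exponent tends to \<open>1 / (2 * (f + 5))\<close> as \<open>d\<close> grows, which is at
  least the one claimed.\<close>

inductive local_fun :: "'s set \<Rightarrow> ('s \<Rightarrow> 'l set) \<Rightarrow> nat \<Rightarrow> (('s \<Rightarrow> 'l) \<Rightarrow> real) \<Rightarrow> bool"
  for Sn :: "'s set" and Lb :: "'s \<Rightarrow> 'l set" where
  one: "local_fun Sn Lb R (\<lambda>_. 1)"
| ind: "local_fun Sn Lb R f \<Longrightarrow> s \<in> Sn \<Longrightarrow> l \<in> Lb s \<Longrightarrow>
    local_fun Sn Lb (Suc R) (\<lambda>\<omega>. of_bool (\<omega> s = l) * f \<omega>)"
| add: "local_fun Sn Lb R f \<Longrightarrow> local_fun Sn Lb R g \<Longrightarrow> local_fun Sn Lb R (\<lambda>\<omega>. f \<omega> + g \<omega>)"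
| scale: "local_fun Sn Lb R f \<Longrightarrow> local_fun Sn Lb R (\<lambda>\<omega>. a * f \<omega>)"

lemma local_fun_mono: "local_fun Sn Lb R f \<Longrightarrow> R \<le> R' \<Longrightarrow> local_fun Sn Lb R' f"
proof (induction arbitrary: R' rule: local_fun.induct)
  case (ind R f s l)
  then obtain R'' where "R' = Suc R''" "R \<le> R''" by (cases R') auto
  then show ?case using ind by (auto intro: local_fun.ind)
qed (auto intro: local_fun.intros)

lemma local_fun_const: "local_fun Sn Lb R (\<lambda>_. a)"
  using local_fun.scale[OF local_fun.one, of Sn Lb R a] by simp

lemma local_fun_mult:
  "local_fun Sn Lb R f \<Longrightarrow> local_fun Sn Lb R' g \<Longrightarrow> local_fun Sn Lb (R + R') (\<lambda>\<omega>. f \<omega> * g \<omega>)"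
proof (induction rule: local_fun.induct)
  case (one R)
  then show ?case using local_fun_mono[of Sn Lb R' g] by simp
next
  case (ind R f s l)
  then show ?case using local_fun.ind[of Sn Lb "R + R'" "\<lambda>\<omega>. f \<omega> * g \<omega>" s l] by (simp add: mult.assoc)
next
  case (add R f f')
  then show ?case using local_fun.add by (simp add: distrib_right) fastforce
next
  case (scale R f a)
  then show ?case using local_fun.scale[of Sn Lb "R + R'" "\<lambda>\<omega>. f \<omega> * g \<omega>" a] by (simp add: mult.assoc)
qed

lemma local_fun_sum:
  "(\<And>i. i \<in> I \<Longrightarrow> local_fun Sn Lb R (f i)) \<Longrightarrow> local_fun Sn Lb R (\<lambda>\<omega>. \<Sum>i\<in>I. f i \<omega>)"
proof (induction I rule: infinite_finite_induct)
  case (insert i I)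
  then show ?case using local_fun.add[of Sn Lb R "f i" "\<lambda>\<omega>. \<Sum>i\<in>I. f i \<omega>"] by simp
qed (auto simp: local_fun_const)

section \<open>The spanner instance of a label selection game\<close>

text \<open>
  \<open>Chain s i j\<close> is the vertex at position \<open>j\<close> on the chain of the \<open>i\<close>-th copy of supernode \<open>s\<close>: position \<open>0\<close> is
  joined to the labels, position \<open>k - 2\<close> carries the outer edges. \<open>Star s\<close> is joined to all labels of \<open>s\<close>, so that one
  chosen edge between a chain and a label spans the other ones within three steps.
\<close>

datatype ('s, 'l) vert = Chain 's nat nat | Lab 's 'l | Star 's

text \<open>\<open>SE_asym\<close> orients every superedge and excludes loops, so that each
  undirected edge of the graph comes from exactly one arc.\<close>

locale rep_game =
  fixes Sn :: "'s set" and Lb :: "'s \<Rightarrow> 'l set" and SE :: "('s \<times> 's) set"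
    and Rel :: "'s \<Rightarrow> 's \<Rightarrow> ('l \<times> 'l) set" and k c :: nat
  assumes finite_Sn: "finite Sn"
    and finite_Lb: "s \<in> Sn \<Longrightarrow> finite (Lb s)"
    and SE_sub: "SE \<subseteq> Sn \<times> Sn"
    and SE_asym: "(s, s') \<in> SE \<Longrightarrow> (s', s) \<notin> SE"
    and Rel_sub: "(s, s') \<in> SE \<Longrightarrow> Rel s s' \<subseteq> Lb s \<times> Lb s'"
    and k_ge_2: "k \<ge> 2"
begin

definition choice_arcs :: "(('s, 'l) vert \<times> ('s, 'l) vert) set" where
  "choice_arcs = (\<lambda>(s, i, l). (Chain s i 0, Lab s l)) ` (SIGMA s:Sn. {..<c} \<times> Lb s)"

definition chain_arcs :: "(('s, 'l) vert \<times> ('s, 'l) vert) set" where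
  "chain_arcs = (\<lambda>(s, i, j). (Chain s i j, Chain s i (Suc j))) ` (Sn \<times> {..<c} \<times> {..<k - 2})"

definition star_arcs :: "(('s, 'l) vert \<times> ('s, 'l) vert) set" where
  "star_arcs = (\<lambda>(s, l). (Star s, Lab s l)) ` (SIGMA s:Sn. Lb s)"

definition inner_arcs :: "(('s, 'l) vert \<times> ('s, 'l) vert) set" where
  "inner_arcs = (\<lambda>((s, s'), (l, l')). (Lab s l, Lab s' l')) ` (SIGMA e:SE. Rel (fst e) (snd e))"

definition outer_arcs :: "(('s, 'l) vert \<times> ('s, 'l) vert) set" where
  "outer_arcs = (\<lambda>((s, s'), i). (Chain s i (k - 2), Chain s' i (k - 2))) ` (SE \<times> {..<c})"

definition fixed_arcs :: "(('s, 'l) vert \<times> ('s, 'l) vert) set" where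
  "fixed_arcs = chain_arcs \<union> star_arcs \<union> inner_arcs"

definition arcs :: "(('s, 'l) vert \<times> ('s, 'l) vert) set" where
  "arcs = choice_arcs \<union> fixed_arcs \<union> outer_arcs"

definition verts :: "('s, 'l) vert set" where
  "verts = fst ` arcs \<union> snd ` arcs"

definition superadj :: "('s \<times> 's) set" where
  "superadj = SE \<union> SE\<inverse>"

lemmas arc_defs = arcs_def fixed_arcs_def choice_arcs_def chain_arcs_def star_arcs_def
  inner_arcs_def outer_arcs_def

lemma choice_arcI: "s \<in> Sn \<Longrightarrow> i < c \<Longrightarrow> l \<in> Lb s \<Longrightarrow> (Chain s i 0, Lab s l) \<in> choice_arcs"
  unfolding choice_arcs_def by (rule image_eqI[where x = "(s, i, l)"]) auto

lemma star_arcI: "s \<in> Sn \<Longrightarrow> l \<in> Lb s \<Longrightarrow> (Star s, Lab s l) \<in> star_arcs"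
  unfolding star_arcs_def by (rule image_eqI[where x = "(s, l)"]) auto

lemma chain_arcI: "s \<in> Sn \<Longrightarrow> i < c \<Longrightarrow> j < k - 2 \<Longrightarrow> (Chain s i j, Chain s i (Suc j)) \<in> chain_arcs"
  unfolding chain_arcs_def by (rule image_eqI[where x = "(s, i, j)"]) auto

lemma inner_arcI: "(s, s') \<in> SE \<Longrightarrow> (l, l') \<in> Rel s s' \<Longrightarrow> (Lab s l, Lab s' l') \<in> inner_arcs"
  unfolding inner_arcs_def by (rule image_eqI[where x = "((s, s'), (l, l'))"]) auto

lemma outer_arcI: "(s, s') \<in> SE \<Longrightarrow> i < c \<Longrightarrow> (Chain s i (k - 2), Chain s' i (k - 2)) \<in> outer_arcs"
  unfolding outer_arcs_def by (rule image_eqI[where x = "((s, s'), i)"]) auto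

lemma arcs_asym: "(u, v) \<in> arcs \<Longrightarrow> (v, u) \<notin> arcs"
  using SE_asym by (auto simp: arc_defs)

lemma finite_SE: "finite SE"
  using SE_sub finite_Sn by (meson finite_SigmaI finite_subset)

lemma finite_Rel: "e \<in> SE \<Longrightarrow> finite (Rel (fst e) (snd e))"
proof -
  assume e: "e \<in> SE"
  then have "Rel (fst e) (snd e) \<subseteq> Lb (fst e) \<times> Lb (snd e)" using Rel_sub by simp
  moreover have "finite (Lb (fst e) \<times> Lb (snd e))" using e SE_sub finite_Lb by auto
  ultimately show ?thesis by (rule finite_subset)
qed

lemma finite_fixed: "finite fixed_arcs" and finite_choice: "finite choice_arcs" and finite_outer: "finite outer_arcs"
  unfolding arc_defs using finite_Sn finite_Lb finite_SE finite_Rel by (auto intro!: finite_imageI finite_SigmaI)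

lemma finite_arcs: "finite arcs"
  unfolding arcs_def using finite_fixed finite_choice finite_outer by simp

text \<open>
  Before it reaches a label, a walk loses at most one unit of height per step, and an outer step costs a step without loss
  of height. The middle alternative uses that the outer edge between \<open>s\<close> and \<open>s'\<close> is not available.
\<close>

lemma chain_phase:
  assumes adj: "\<And>u v. adj u v \<Longrightarrow> (u, v) \<in> arcs \<or> (v, u) \<in> arcs"
    and noadj: "\<not> adj (Chain s \<iota> (k - 2)) (Chain s' \<iota> (k - 2))"
               "\<not> adj (Chain s' \<iota> (k - 2)) (Chain s \<iota> (k - 2))"
    and start: "w 0 = Chain s \<iota> (k - 2)"
    and steps: "\<And>i. Suc i < m \<Longrightarrow> adj (w i) (w (Suc i))"
    and chains: "\<And>i. i < m \<Longrightarrow> \<exists>\<sigma> b j. w i = Chain \<sigma> b j"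
    and i: "i < m" and ss': "s \<noteq> s'"
  shows "\<exists>\<sigma> j. w i = Chain \<sigma> \<iota> j \<and> k - 2 \<le> j + i \<and>
           (\<sigma> = s \<or> (\<sigma> \<noteq> s' \<and> k - 1 \<le> j + i) \<or> k \<le> j + i) \<and>
           (\<exists>h\<le>i. (s, \<sigma>) \<in> (superadj - {(s, s'), (s', s)}) ^^ h)"
  using i
proof (induction i)
  case 0
  then show ?case using start by auto
next
  case (Suc i)
  then obtain \<sigma> j h where IH: "w i = Chain \<sigma> \<iota> j" "k - 2 \<le> j + i"
      "\<sigma> = s \<or> (\<sigma> \<noteq> s' \<and> k - 1 \<le> j + i) \<or> k \<le> j + i" "h \<le> i"
      "(s, \<sigma>) \<in> (superadj - {(s, s'), (s', s)}) ^^ h"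
    by auto
  obtain \<sigma>' b j' where w': "w (Suc i) = Chain \<sigma>' b j'" using chains Suc.prems by blast
  have ad: "adj (Chain \<sigma> \<iota> j) (Chain \<sigma>' b j')" using steps[of i] Suc.prems IH(1) w' by auto
  from adj[OF ad] consider "\<sigma>' = \<sigma>" "b = \<iota>" "j \<le> Suc j'"
    | "(\<sigma>, \<sigma>') \<in> superadj" "b = \<iota>" "j = k - 2" "j' = k - 2"
    by (auto simp: arc_defs superadj_def)
  then show ?case
  proof cases
    case 1
    then have "k - 2 \<le> j' + Suc i" "\<sigma>' = s \<or> (\<sigma>' \<noteq> s' \<and> k - 1 \<le> j' + Suc i) \<or> k \<le> j' + Suc i"
      using IH(2,3) by auto
    moreover have "h \<le> Suc i" using IH(4) by simp
    ultimately show ?thesis using IH(5) w' 1 by blast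
  next
    case 2
    have ne: "\<not> (\<sigma> = s \<and> \<sigma>' = s')" "\<not> (\<sigma> = s' \<and> \<sigma>' = s)" using ad noadj 2 by auto
    then have "(\<sigma>, \<sigma>') \<in> superadj - {(s, s'), (s', s)}" using 2 by auto
    then have "(s, \<sigma>') \<in> (superadj - {(s, s'), (s', s)}) ^^ Suc h" using IH(5) by auto
    \<comment> \<open>Reaching \<open>s'\<close> takes at least two crossings, since the direct one
      is missing, and every crossing spends a step at full height. This surplus is what
      \<open>k - 1\<close> and \<open>k\<close> record.\<close>
    moreover have "\<sigma>' = s \<or> (\<sigma>' \<noteq> s' \<and> k - 1 \<le> j' + Suc i) \<or> k \<le> j' + Suc i"
      using IH(3) 2(3,4) ne k_ge_2 by linarith
    moreover have "Suc h \<le> Suc i" "k - 2 \<le> j' + Suc i" using IH(4) 2 by auto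
    ultimately show ?thesis using w' 2(2) by blast
  qed
qed

text \<open>A walk that stays on chains projects to a short walk of superedges avoiding the edge
  between \<open>s\<close> and \<open>s'\<close>, which \<open>noshort\<close> excludes. Any other
  walk is cut at its first and its last vertex off the chains. Each outer piece takes at least
  \<open>k - 1\<close> steps, so at most one step is left between the two cuts.\<close>

lemma short_walk_covers:
  assumes adj: "\<And>u v. adj u v \<Longrightarrow> (u, v) \<in> arcs \<or> (v, u) \<in> arcs"
    and sym: "\<And>u v. adj u v \<Longrightarrow> adj v u"
    and noadj: "\<not> adj (Chain s \<iota> (k - 2)) (Chain s' \<iota> (k - 2))"
    and SE: "(s, s') \<in> SE"
    and start: "w 0 = Chain s \<iota> (k - 2)" and fin: "w m = Chain s' \<iota> (k - 2)" and m: "m \<le> 2 * k - 1"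
    and steps: "\<And>i. i < m \<Longrightarrow> adj (w i) (w (Suc i))"
    and noshort: "\<And>h. h \<le> 2 * k - 1 \<Longrightarrow> (s, s') \<notin> (superadj - {(s, s'), (s', s)}) ^^ h"
  shows "\<exists>l l'. (l, l') \<in> Rel s s' \<and> adj (Chain s \<iota> 0) (Lab s l) \<and> adj (Chain s' \<iota> 0) (Lab s' l')"
proof -
  let ?ch = "\<lambda>i. \<exists>\<sigma> b j. w i = Chain \<sigma> b j"
  have noadj': "\<not> adj (Chain s' \<iota> (k - 2)) (Chain s \<iota> (k - 2))" using noadj sym by blast
  have ss': "s \<noteq> s'" using SE SE_asym by blast
  show ?thesis
  proof (cases "\<forall>i\<le>m. ?ch i")
    case True
    have "\<exists>\<sigma> j. w m = Chain \<sigma> \<iota> j \<and> k - 2 \<le> j + m \<and>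
           (\<sigma> = s \<or> (\<sigma> \<noteq> s' \<and> k - 1 \<le> j + m) \<or> k \<le> j + m) \<and>
           (\<exists>h\<le>m. (s, \<sigma>) \<in> (superadj - {(s, s'), (s', s)}) ^^ h)"
      using chain_phase[where adj = adj and w = w and m = "Suc m" and i = m, OF adj noadj noadj' start] True steps ss'
      by (metis Suc_less_eq le_simps(2) lessI)
    then show ?thesis using fin noshort m by (metis le_trans vert.inject(1))
  next
    case False
    then obtain i' where i': "i' \<le> m" "\<not> ?ch i'" by auto
    obtain i0 where i0: "\<not> ?ch i0" and i0i: "i0 \<le> i'" and i0l: "\<And>i. i < i0 \<Longrightarrow> ?ch i"
      using ex_least_nat_le[of "\<lambda>i. \<not> ?ch i" i'] i'(2) by blast
    have i0m: "i0 \<le> m" using i0i i' by simp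
    define v where "v = (\<lambda>i. w (m - i))"
    let ?cv = "\<lambda>i. \<exists>\<sigma> b j. v i = Chain \<sigma> b j"
    have exv: "\<not> ?cv (m - i0)" using i0 i0m unfolding v_def by simp
    obtain i1 where i1: "\<not> ?cv i1" and i1m: "i1 \<le> m - i0" and i1l: "\<And>i. i < i1 \<Longrightarrow> ?cv i"
      using ex_least_nat_le[of "\<lambda>i. \<not> ?cv i" "m - i0"] exv by blast
    have i0p: "i0 > 0" using i0 start by (cases i0) auto
    have i1p: "i1 > 0" using i1 fin by (cases i1) (auto simp: v_def)
    have vsteps: "adj (v i) (v (Suc i))" if "i < m" for i
    proof -
      have "adj (w (m - Suc i)) (w (Suc (m - Suc i)))" using steps that by simp
      then show ?thesis using that sym unfolding v_def by (metis Suc_diff_Suc)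
    qed
    have "\<exists>\<sigma> j. w (i0 - 1) = Chain \<sigma> \<iota> j \<and> k - 2 \<le> j + (i0 - 1) \<and>
           (\<sigma> = s \<or> (\<sigma> \<noteq> s' \<and> k - 1 \<le> j + (i0 - 1)) \<or> k \<le> j + (i0 - 1)) \<and>
           (\<exists>h\<le>i0 - 1. (s, \<sigma>) \<in> (superadj - {(s, s'), (s', s)}) ^^ h)"
      by (rule chain_phase[where adj = adj and m = i0]) (use adj noadj noadj' start steps i0l i0m i0p ss' in auto)
    then obtain \<sigma>0 j0 where a0: "w (i0 - 1) = Chain \<sigma>0 \<iota> j0" "k - 2 \<le> j0 + (i0 - 1)"
       "\<sigma>0 = s \<or> (\<sigma>0 \<noteq> s' \<and> k - 1 \<le> j0 + (i0 - 1)) \<or> k \<le> j0 + (i0 - 1)" by blast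
    have "\<exists>\<sigma> j. v (i1 - 1) = Chain \<sigma> \<iota> j \<and> k - 2 \<le> j + (i1 - 1) \<and>
           (\<sigma> = s' \<or> (\<sigma> \<noteq> s \<and> k - 1 \<le> j + (i1 - 1)) \<or> k \<le> j + (i1 - 1)) \<and>
           (\<exists>h\<le>i1 - 1. (s', \<sigma>) \<in> (superadj - {(s', s), (s, s')}) ^^ h)"
      by (rule chain_phase[where adj = adj and m = i1]) (use adj noadj noadj' fin vsteps i1l i1m i1p ss' v_def in auto)
    then obtain \<sigma>1 j1 where a1: "v (i1 - 1) = Chain \<sigma>1 \<iota> j1" "k - 2 \<le> j1 + (i1 - 1)"
       "\<sigma>1 = s' \<or> (\<sigma>1 \<noteq> s \<and> k - 1 \<le> j1 + (i1 - 1)) \<or> k \<le> j1 + (i1 - 1)" by blast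
    have ad0: "adj (Chain \<sigma>0 \<iota> j0) (w i0)" using steps[of "i0 - 1"] i0p i0m a0 by auto
    have ad1: "adj (Chain \<sigma>1 \<iota> j1) (v i1)" using vsteps[of "i1 - 1"] i1p i1m a1 by auto
    have l0: "\<exists>l. w i0 = Lab \<sigma>0 l \<and> j0 = 0" using adj[OF ad0] i0 by (auto simp: arc_defs)
    have l1: "\<exists>l. v i1 = Lab \<sigma>1 l \<and> j1 = 0" using adj[OF ad1] i1 by (auto simp: arc_defs)
    obtain l where l: "w i0 = Lab \<sigma>0 l" using l0 by blast
    obtain l' where l': "v i1 = Lab \<sigma>1 l'" using l1 by blast
    have j0: "j0 = 0" "j1 = 0" using l0 l1 by auto
    have b0: "k - 1 \<le> i0" "\<sigma>0 = s \<or> (\<sigma>0 \<noteq> s' \<and> k \<le> i0) \<or> k + 1 \<le> i0" using a0 j0 i0p k_ge_2 by auto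
    have b1: "k - 1 \<le> i1" "\<sigma>1 = s' \<or> (\<sigma>1 \<noteq> s \<and> k \<le> i1) \<or> k + 1 \<le> i1" using a1 j0 i1p k_ge_2 by auto
    have tot: "i0 + i1 \<le> m" using i1m i0m by simp
    show ?thesis
    proof (cases "i0 + i1 = m")
      case True
      \<comment> \<open>Both pieces end at the same label. Its supernode differs from
        \<open>s\<close> or from \<open>s'\<close>, and with the surplus steps the pieces add up to
        at least \<open>2 * k\<close>.\<close>
      then have "m - i1 = i0" by simp
      then have "\<sigma>0 = \<sigma>1" using l l' by (simp add: v_def)
      then show ?thesis using b0 b1 ss' True m k_ge_2 by auto
    next
      case False
      \<comment> \<open>Now both lower bounds are tight, which rules out every supernode but
        \<open>s\<close> on one side and \<open>s'\<close> on the other.\<close>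
      then have e: "i0 = k - 1" "i1 = k - 1" "m - i1 = Suc i0" "\<sigma>0 = s" "\<sigma>1 = s'"
        using tot m b0 b1 k_ge_2 by auto
      have "adj (w i0) (w (m - i1))" using e steps[of i0] tot False by simp
      then have "adj (Lab s l) (Lab s' l')" using l l' e by (simp add: v_def)
      then have "(l, l') \<in> Rel s s'" using adj[of "Lab s l" "Lab s' l'"] SE SE_asym by (auto simp: arc_defs)
      then show ?thesis using ad0 ad1 l l' e j0 by auto
    qed
  qed
qed

lemma card_verts: "finite verts" "card verts \<le> c * card Sn * (k - 1) + (\<Sum>s\<in>Sn. card (Lb s)) + card Sn"
proof -
  define A :: "('s, 'l) vert set" where "A = (\<lambda>(s, i, j). Chain s i j) ` (Sn \<times> {..<c} \<times> {..<k - 1})"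
  define B :: "('s, 'l) vert set" where "B = (\<lambda>(s, l). Lab s l) ` (SIGMA s:Sn. Lb s)"
  define C :: "('s, 'l) vert set" where "C = Star ` Sn"
  have A_I: "Chain s i j \<in> A" if "s \<in> Sn" "i < c" "j < k - 1" for s i j
    unfolding A_def using that by (intro image_eqI[of _ _ "(s, i, j)"]) auto
  have B_I: "Lab s l \<in> B" if "s \<in> Sn" "l \<in> Lb s" for s l
    unfolding B_def using that by (intro image_eqI[of _ _ "(s, l)"]) auto
  have C_I: "Star s \<in> C" if "s \<in> Sn" for s using that by (simp add: C_def)
  have k2: "k - 2 < k - 1" "0 < k - 1" using k_ge_2 by auto
  have sub: "verts \<subseteq> A \<union> B \<union> C"
  proof -
    have "fst e \<in> A \<union> B \<union> C \<and> snd e \<in> A \<union> B \<union> C" if "e \<in> arcs" for e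
    proof -
      from that consider "e \<in> choice_arcs" | "e \<in> chain_arcs" | "e \<in> star_arcs" | "e \<in> inner_arcs" | "e \<in> outer_arcs"
        by (auto simp: arcs_def fixed_arcs_def)
      then show ?thesis
      proof cases
        case 1
        then show ?thesis using A_I B_I k2 by (auto simp: choice_arcs_def)
      next
        case 2
        then obtain s i j where "s \<in> Sn" "i < c" "j < k - 2" "e = (Chain s i j, Chain s i (Suc j))" by (auto simp: chain_arcs_def)
        moreover from this have "j < k - 1" "Suc j < k - 1" by auto
        ultimately show ?thesis using A_I by simp
      next
        case 3
        then show ?thesis using B_I C_I by (auto simp: star_arcs_def)
      next
        case 4
        then obtain s s' l l' where *: "(s, s') \<in> SE" "(l, l') \<in> Rel s s'" "e = (Lab s l, Lab s' l')" by (auto simp: inner_arcs_def)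
        then have "s \<in> Sn" "s' \<in> Sn" "l \<in> Lb s" "l' \<in> Lb s'" using SE_sub Rel_sub[OF *(1)] by auto
        then show ?thesis using B_I *(3) by simp
      next
        case 5
        then obtain s s' i where *: "(s, s') \<in> SE" "i < c" "e = (Chain s i (k - 2), Chain s' i (k - 2))" by (auto simp: outer_arcs_def)
        then have "s \<in> Sn" "s' \<in> Sn" using SE_sub by auto
        then show ?thesis using A_I * k2 by simp
      qed
    qed
    then show ?thesis by (auto simp: verts_def)
  qed
  have fin: "finite A" "finite B" "finite C" using finite_Sn finite_Lb by (auto simp: A_def B_def C_def)
  then show "finite verts" using sub finite_subset by (metis finite_UnI)
  have "card verts \<le> card (A \<union> B \<union> C)" using sub fin by (intro card_mono) auto
  also have "\<dots> \<le> card A + card B + card C" by (meson add_le_mono1 card_Un_le order_trans)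
  also have "\<dots> \<le> c * card Sn * (k - 1) + (\<Sum>s\<in>Sn. card (Lb s)) + card Sn"
  proof (intro add_mono)
    have "card A \<le> card (Sn \<times> {..<c} \<times> {..<k - 1})" unfolding A_def using finite_Sn by (intro card_image_le) auto
    then show "card A \<le> c * card Sn * (k - 1)" by (simp add: card_cartesian_product mult_ac)
    have "card B \<le> card (SIGMA s:Sn. Lb s)" unfolding B_def using finite_Sn finite_Lb by (intro card_image_le) auto
    then show "card B \<le> (\<Sum>s\<in>Sn. card (Lb s))" using finite_Sn finite_Lb by simp
    show "card C \<le> card Sn" unfolding C_def using finite_Sn by (rule card_image_le)
  qed
  finally show "card verts \<le> c * card Sn * (k - 1) + (\<Sum>s\<in>Sn. card (Lb s)) + card Sn" .
qed

end

section \<open>The instance as a graph on natural numbers and the size of its spanners\<close>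

locale named_rep_game = rep_game Sn Lb SE Rel k c
  for Sn :: "'s set" and Lb :: "'s \<Rightarrow> 'l set" and SE Rel k c +
  fixes nm :: "('s, 'l) vert \<Rightarrow> nat"
  assumes inj_nm: "inj_on nm verts"
begin

definition edge_of :: "('s, 'l) vert \<times> ('s, 'l) vert \<Rightarrow> nat set" where
  "edge_of a = {nm (fst a), nm (snd a)}"

definition edges :: "nat set set" where
  "edges = edge_of ` arcs"

lemma inj_on_edge_of: "inj_on edge_of arcs"
proof (rule inj_onI)
  fix a b assume ab: "a \<in> arcs" "b \<in> arcs" "edge_of a = edge_of b"
  have V: "fst a \<in> verts" "snd a \<in> verts" "fst b \<in> verts" "snd b \<in> verts"
    using ab by (auto simp: verts_def)
  have eq: "nm x = nm y \<longleftrightarrow> x = y" if "x \<in> verts" "y \<in> verts" for x y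
    using inj_nm that by (auto dest: inj_onD)
  have "a = b \<or> a = (snd b, fst b)"
    using ab(3) by (auto simp: edge_of_def doubleton_eq_iff eq V prod_eq_iff)
  then show "a = b" using ab arcs_asym[of "fst b" "snd b"] by (metis prod.collapse)
qed

lemma finite_edges: "finite edges"
  unfolding edges_def using finite_arcs by simp

lemma edge_of_in_edges: "a \<in> arcs \<Longrightarrow> edge_of a \<in> edges"
  unfolding edges_def by simp


lemma outer_edge_covered:
  assumes H: "is_spanner edges (2 * k - 1) H" and SE: "(s, s') \<in> SE" and i: "i < c"
    and noshort: "\<And>h. h \<le> 2 * k - 1 \<Longrightarrow> (s, s') \<notin> (superadj - {(s, s'), (s', s)}) ^^ h"
    and notin: "edge_of (Chain s i (k - 2), Chain s' i (k - 2)) \<notin> H"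
  shows "\<exists>l l'. (l, l') \<in> Rel s s' \<and> edge_of (Chain s i 0, Lab s l) \<in> H \<and> edge_of (Chain s' i 0, Lab s' l') \<in> H"
proof -
  let ?u = "Chain s i (k - 2)" and ?v = "Chain s' i (k - 2)"
  have arc: "(?u, ?v) \<in> arcs" using outer_arcI[OF SE i] by (simp add: arcs_def)
  then have uv: "?u \<in> verts" "?v \<in> verts" unfolding verts_def by (metis UnI1 UnI2 fst_conv snd_conv image_eqI)+
  have HE: "H \<subseteq> edges" using H by (simp add: is_spanner_def)
  have "{nm ?u, nm ?v} \<in> edges" using edge_of_in_edges[OF arc] by (simp add: edge_of_def)
  then obtain p where p: "is_path H (nm ?u) (nm ?v) p" "length p \<le> 2 * k - 1 + 1"
    using H unfolding is_spanner_def short_paths_def by (metis (mono_tags, lifting) Collect_empty_eq)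
  have p0: "p \<noteq> []" "hd p = nm ?u" "last p = nm ?v" "path_edges p \<subseteq> H" using p by (auto simp: is_path_def)
  \<comment> \<open>Membership in \<open>verts\<close> is part of adjacency because
    \<open>nm\<close> is injective only there.\<close>
  define adj where "adj = (\<lambda>a b. a \<in> verts \<and> b \<in> verts \<and> {nm a, nm b} \<in> H)"
  define g where "g = the_inv_into verts nm"
  have g: "g (nm x) = x" if "x \<in> verts" for x
    unfolding g_def using that inj_nm by (simp add: the_inv_into_f_f)
  have steps: "adj (g (p ! j)) (g (p ! Suc j))" if "j < length p - 1" for j
  proof -
    have pe: "{p ! j, p ! Suc j} \<in> H" using p0(4) that unfolding path_edges_def by force
    then obtain a where a: "a \<in> arcs" "{p ! j, p ! Suc j} = {nm (fst a), nm (snd a)}"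
      using HE by (auto simp: edges_def edge_of_def)
    have "fst a \<in> verts" "snd a \<in> verts" using a by (auto simp: verts_def)
    then have "\<exists>x\<in>verts. p ! j = nm x" "\<exists>x\<in>verts. p ! Suc j = nm x" using a(2) by (auto simp: doubleton_eq_iff)
    then show ?thesis using pe g by (auto simp: adj_def)
  qed
  have adj: "(a, b) \<in> arcs \<or> (b, a) \<in> arcs" if "adj a b" for a b
  proof -
    have ab: "a \<in> verts" "b \<in> verts" "{nm a, nm b} \<in> edges" using that HE by (auto simp: adj_def)
    then obtain e where e: "e \<in> arcs" "{nm a, nm b} = {nm (fst e), nm (snd e)}" by (auto simp: edges_def edge_of_def)
    have "fst e \<in> verts" "snd e \<in> verts" using e by (auto simp: verts_def)
    then have "(a = fst e \<and> b = snd e) \<or> (a = snd e \<and> b = fst e)"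
      using e(2) ab inj_nm by (metis doubleton_eq_iff inj_onD)
    then show ?thesis using e(1) by auto
  qed
  have "\<exists>l l'. (l, l') \<in> Rel s s' \<and> adj (Chain s i 0) (Lab s l) \<and> adj (Chain s' i 0) (Lab s' l')"
  proof (rule short_walk_covers[where w = "\<lambda>j. g (p ! j)" and m = "length p - 1"])
    show "adj a b \<Longrightarrow> adj b a" for a b by (auto simp: adj_def insert_commute)
    show "\<not> adj ?u ?v" using notin by (auto simp: adj_def edge_of_def)
    show "g (p ! 0) = ?u" using p0 g uv by (simp add: hd_conv_nth[symmetric])
    show "g (p ! (length p - 1)) = ?v" using p0 g uv last_conv_nth[OF p0(1)] by simp
  qed (use adj SE p steps noshort in auto)
  then show ?thesis by (auto simp: adj_def edge_of_def)
qed

text \<open>Each copy \<open>i\<close> of the hubs defines its own label sets \<open>S i\<close>,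
  namely the labels whose choice edges at that copy are bought. An outer edge of the copy whose
  superedge these sets leave unsatisfied must be bought itself. Different copies use disjoint edges,
  so the bound \<open>G\<close> for one copy counts \<open>c\<close> times.\<close>

lemma spanner_size_lower_bound:
  assumes H: "is_spanner edges (2 * k - 1) H"
    and noshort: "\<And>s s' h. (s, s') \<in> SE \<Longrightarrow> h \<le> 2 * k - 1 \<Longrightarrow> (s, s') \<notin> (superadj - {(s, s'), (s', s)}) ^^ h"
    and sound: "\<And>S. (\<And>s. s \<in> Sn \<Longrightarrow> S s \<subseteq> Lb s) \<Longrightarrow>
        G \<le> (\<Sum>s\<in>Sn. card (S s)) + card {(s, s') \<in> SE. \<not> (\<exists>(l, l')\<in>Rel s s'. l \<in> S s \<and> l' \<in> S s')}"
  shows "c * G \<le> card H"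
proof -
  define S where "S = (\<lambda>i s. {l \<in> Lb s. edge_of (Chain s i 0, Lab s l) \<in> H})"
  define U where "U = (\<lambda>i. {(s, s') \<in> SE. \<not> (\<exists>(l, l')\<in>Rel s s'. l \<in> S i s \<and> l' \<in> S i s')})"
  define A :: "nat \<Rightarrow> (('s, 'l) vert \<times> ('s, 'l) vert) set" where "A = (\<lambda>i. (\<lambda>(s, l). (Chain s i 0, Lab s l)) ` (SIGMA s:Sn. S i s))"
  define B :: "nat \<Rightarrow> (('s, 'l) vert \<times> ('s, 'l) vert) set" where "B = (\<lambda>i. (\<lambda>(s, s'). (Chain s i (k - 2), Chain s' i (k - 2))) ` U i)"
  have HE: "H \<subseteq> edges" using H by (simp add: is_spanner_def)
  then have finH: "finite H" using finite_edges finite_subset by blast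
  have finS: "finite (S i s)" if "s \<in> Sn" for i s unfolding S_def using finite_Lb that by auto
  have finU: "finite (U i)" for i by (rule finite_subset[OF _ finite_SE]) (auto simp: U_def)
  have cardA: "card (A i) = (\<Sum>s\<in>Sn. card (S i s))" for i
    unfolding A_def by (subst card_image) (auto simp: inj_on_def finite_Sn finS card_SigmaI)
  have cardB: "card (B i) = card (U i)" for i
    unfolding B_def by (subst card_image) (auto simp: inj_on_def)
  have fin: "finite (A i)" "finite (B i)" for i unfolding A_def B_def using finite_Sn finS finU by auto
  have sub: "A i \<subseteq> arcs" "B i \<subseteq> arcs" if "i < c" for i
    using that choice_arcI outer_arcI by (auto simp: A_def B_def U_def S_def arcs_def)
  have inH: "edge_of a \<in> H" if "i < c" "a \<in> A i \<union> B i" for i a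
  proof -
    have "edge_of (Chain s i (k - 2), Chain s' i (k - 2)) \<in> H" if ss: "(s, s') \<in> U i" for s s'
    proof (rule ccontr)
      assume n: "\<not> ?thesis"
      have SE: "(s, s') \<in> SE" using ss by (auto simp: U_def)
      obtain l l' where "(l, l') \<in> Rel s s'" "edge_of (Chain s i 0, Lab s l) \<in> H" "edge_of (Chain s' i 0, Lab s' l') \<in> H"
        using outer_edge_covered[OF H SE \<open>i < c\<close> noshort[OF SE] n] by blast
      then show False using ss Rel_sub[OF SE] by (auto simp: U_def S_def)
    qed
    then show ?thesis using that by (auto simp: A_def B_def S_def)
  qed
  have disj: "A i \<inter> B i = {}" for i by (auto simp: A_def B_def)
  have ge: "G \<le> card (A i \<union> B i)" for i
    using sound[of "S i"] cardA cardB fin disj[of i] by (subst card_Un_disjoint) (auto simp: S_def U_def)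
  have "c * G = (\<Sum>i<c. G)" by simp
  also have "\<dots> \<le> (\<Sum>i<c. card (A i \<union> B i))" by (intro sum_mono ge)
  also have "\<dots> = card (\<Union>i<c. A i \<union> B i)"
    using fin by (subst card_UN_disjoint) (auto simp: A_def B_def)
  also have "\<dots> = card (edge_of ` (\<Union>i<c. A i \<union> B i))"
    using sub by (intro card_image[symmetric] inj_on_subset[OF inj_on_edge_of]) auto
  also have "\<dots> \<le> card H" using inH by (intro card_mono finH) auto
  finally show ?thesis .
qed

end

section \<open>Paths, spanners and the SDP on arbitrary graphs\<close>

lemma is_path_rev: "is_path S u v p \<Longrightarrow> is_path S v u (rev p)" and path_edges_rev: "path_edges (rev p) = path_edges p"
proof -
  have sub: "path_edges (rev p) \<subseteq> path_edges p" for p :: "nat list"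
  proof
    fix e assume "e \<in> path_edges (rev p)"
    then obtain i where i: "Suc i < length p" "e = {rev p ! i, rev p ! Suc i}" by (auto simp: path_edges_def)
    define j where "j = length p - Suc (Suc i)"
    have "rev p ! i = p ! Suc j" "rev p ! Suc i = p ! j" using i by (auto simp: rev_nth j_def Suc_diff_Suc)
    then show "e \<in> path_edges p" using i unfolding path_edges_def j_def by auto
  qed
  show eq: "path_edges (rev p) = path_edges p" for p using sub[of p] sub[of "rev p"] by auto
  show "is_path S u v p \<Longrightarrow> is_path S v u (rev p)" by (auto simp: is_path_def eq hd_rev last_rev)
qed

text \<open>The SDP quantifies over both orders of the ends of an edge; this lets a slack constraint
  be checked for the orientation given by the arc.\<close>

lemma Zset_commute: "Zset E t u v = Zset E t v u"
proof -
  have "Zset E t u v \<subseteq> Zset E t v u" for u v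
  proof
    fix z assume z: "z \<in> Zset E t u v"
    have "(\<Sum>e\<in>path_edges p. z e) \<ge> 1" if "p \<in> short_paths E t v u" for p
    proof -
      have "rev p \<in> short_paths E t u v" using that is_path_rev by (auto simp: short_paths_def)
      then have "(\<Sum>e\<in>path_edges (rev p). z e) \<ge> 1" using z by (auto simp: Zset_def)
      then show ?thesis by (simp add: path_edges_rev)
    qed
    then show "z \<in> Zset E t v u" using z by (auto simp: Zset_def)
  qed
  then show ?thesis by blast
qed

lemma path_edges_Cons: "path_edges (a # b # p) = insert {a, b} (path_edges (b # p))"
proof -
  have "{i. Suc i < length (a # b # p)} = insert 0 (Suc ` {i. Suc i < length (b # p)})"
    by (auto simp: image_iff) (metis Suc_less_eq not0_implies_Suc)
  then have "path_edges (a # b # p) = (\<lambda>i. {(a # b # p) ! i, (a # b # p) ! Suc i}) ` insert 0 (Suc ` {i. Suc i < length (b # p)})"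
    unfolding path_edges_def by blast
  then show ?thesis unfolding path_edges_def by (auto simp: image_iff)
qed

lemma finite_path_edges: "finite (path_edges p)"
  by (rule finite_subset[of _ "(\<lambda>i. {p ! i, p ! Suc i}) ` {..<length p}"]) (auto simp: path_edges_def)

lemma path_edges_single: "path_edges [a] = {}"
  by (simp add: path_edges_def)

lemma finite_spanners: "finite E \<Longrightarrow> finite {S. is_spanner E t S}"
  by (rule finite_subset[of _ "Pow E"]) (auto simp: is_spanner_def)

lemma edge_in_short_paths: "u \<noteq> v \<Longrightarrow> {u, v} \<in> S \<Longrightarrow> t \<ge> 1 \<Longrightarrow> [u, v] \<in> short_paths S t u v"
  by (auto simp: short_paths_def is_path_def path_edges_Cons path_edges_single)

lemma spanner_self:
  assumes "is_graph n E" "t \<ge> 1"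
  shows "is_spanner E t E"
proof -
  have "u \<noteq> v" if "{u, v} \<in> E" for u v using assms(1) that by (auto simp: is_graph_def doubleton_eq_iff)
  then show ?thesis using edge_in_short_paths assms(2) by (fastforce simp: is_spanner_def)
qed

text \<open>The constraint for constant \<open>z = 1\<close>, tested on the vector concentrated at
  the empty set. It keeps the infimum well defined and the denominator of the gap positive.\<close>

lemma sdp_feasible_value_ge_1:
  assumes G: "is_graph n E" "finite E" "E \<noteq> {}" and y: "sdp_feasible E t r y"
  shows "1 \<le> (\<Sum>e\<in>E. y {e})"
proof -
  obtain u v where uv: "{u, v} \<in> E" "u \<noteq> v" using G by (fastforce simp: is_graph_def)
  have "(\<lambda>_. 1) \<in> Zset E t u v"
  proof -
    have "1 \<le> card (path_edges p)" if "p \<in> short_paths E t u v" for p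
    proof -
      have p: "p \<noteq> []" "hd p = u" "last p = v" using that by (auto simp: short_paths_def is_path_def)
      then obtain b q where "p = u # b # q" using uv(2) by (cases p; cases "tl p") auto
      moreover have "finite (path_edges p)" by (rule finite_path_edges)
      ultimately show ?thesis by (auto simp: path_edges_Cons card_insert_if Suc_le_eq card_gt_0_iff)
    qed
    then show ?thesis by (auto simp: Zset_def)
  qed
  moreover have "\<forall>z\<in>Zset E t u v. psd_on (lasserre_index E r) (\<lambda>I J. (\<Sum>f\<in>E. z f * y (I \<union> J \<union> {f})) - y (I \<union> J))"
    using y uv(1) unfolding sdp_feasible_def by simp
  ultimately have psd: "psd_on (lasserre_index E r) (\<lambda>I J. (\<Sum>f\<in>E. 1 * y (I \<union> J \<union> {f})) - y (I \<union> J))"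
    by (rule bspec[rotated])
  let ?x = "\<lambda>I. of_bool (I = {}) :: real"
  have fin: "finite (lasserre_index E r)" using G by (auto simp: lasserre_index_def)
  have mem: "{} \<in> lasserre_index E r" by (simp add: lasserre_index_def)
  have "0 \<le> (\<Sum>I\<in>lasserre_index E r. \<Sum>J\<in>lasserre_index E r. ?x I * ?x J * ((\<Sum>f\<in>E. 1 * y (I \<union> J \<union> {f})) - y (I \<union> J)))"
    using psd unfolding psd_on_def by (rule spec)
  also have "\<dots> = (\<Sum>I\<in>lasserre_index E r. if I = {} then (\<Sum>f\<in>E. y {f}) - y {} else 0)"
  proof (rule sum.cong)
    fix I assume I: "I \<in> lasserre_index E r"
    have "(\<Sum>J\<in>lasserre_index E r. ?x I * ?x J * ((\<Sum>f\<in>E. 1 * y (I \<union> J \<union> {f})) - y (I \<union> J)))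
       = (\<Sum>J\<in>lasserre_index E r. if J = {} then ?x I * ((\<Sum>f\<in>E. 1 * y (I \<union> {f})) - y I) else 0)"
      by (rule sum.cong) auto
    then show "(\<Sum>J\<in>lasserre_index E r. ?x I * ?x J * ((\<Sum>f\<in>E. 1 * y (I \<union> J \<union> {f})) - y (I \<union> J)))
      = (if I = {} then (\<Sum>f\<in>E. y {f}) - y {} else 0)" using fin mem by simp
  qed simp
  also have "\<dots> = (\<Sum>f\<in>E. y {f}) - 1" using fin mem y by (simp add: sdp_feasible_def)
  finally show ?thesis by simp
qed

lemma integrality_gap_ge:
  assumes G: "is_graph n E" "finite E" "E \<noteq> {}" and t: "t \<ge> 1" and y: "sdp_feasible E t r y"
    and val: "(\<Sum>e\<in>E. y {e}) \<le> V" and size: "\<And>S. is_spanner E t S \<Longrightarrow> P \<le> real (card S)" and P: "P \<ge> 0"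
  shows "P / V \<le> integrality_gap E t r"
proof -
  let ?Y = "{(\<Sum>e\<in>E. y {e}) | y. sdp_feasible E t r y}"
  have ge1: "1 \<le> x" if "x \<in> ?Y" for x using that sdp_feasible_value_ge_1[OF G] by blast
  have "sdp_value E t r \<le> (\<Sum>e\<in>E. y {e})" unfolding sdp_value_def
    by (rule cInf_lower) (use y ge1 in \<open>auto intro!: bdd_belowI[of _ 1]\<close>)
  then have le: "sdp_value E t r \<le> V" using val by simp
  have ge: "1 \<le> sdp_value E t r" unfolding sdp_value_def
    by (rule cInf_greatest) (use y ge1 in auto)
  have "min_spanner_size E t \<in> card ` {S. is_spanner E t S}" unfolding min_spanner_size_def
    using finite_spanners[OF G(2)] spanner_self[OF G(1) t] by (intro Min_in) auto
  then have "P \<le> real (min_spanner_size E t)" using size by auto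
  then have "P / V \<le> real (min_spanner_size E t) / sdp_value E t r"
    using P le ge by (intro frac_le) auto
  then show ?thesis by (simp add: integrality_gap_def)
qed

section \<open>The SDP solution given by a pseudo-distribution on labellings\<close>

locale rep_sdp = named_rep_game Sn Lb SE Rel k c nm
  for Sn :: "'s set" and Lb :: "'s \<Rightarrow> 'l set" and SE Rel k c nm +
  fixes \<Omega> :: "('s \<Rightarrow> 'l) set" and \<mu> :: "('s \<Rightarrow> 'l) \<Rightarrow> real" and r :: nat
  assumes \<Omega>_lab: "\<omega> \<in> \<Omega> \<Longrightarrow> s \<in> Sn \<Longrightarrow> \<omega> s \<in> Lb s"
    and mass_one: "(\<Sum>\<omega>\<in>\<Omega>. \<mu> \<omega>) = 1"
    and square_nonneg: "local_fun Sn Lb (2 * r + 4) f \<Longrightarrow> 0 \<le> (\<Sum>\<omega>\<in>\<Omega>. \<mu> \<omega> * (f \<omega>)\<^sup>2)"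
    and kills: "(s, s') \<in> SE \<Longrightarrow> l \<in> Lb s \<Longrightarrow> l' \<in> Lb s' \<Longrightarrow> (l, l') \<notin> Rel s s' \<Longrightarrow>
      local_fun Sn Lb (2 * r + 4) f \<Longrightarrow>
      (\<Sum>\<omega>\<in>\<Omega>. \<mu> \<omega> * (of_bool (\<omega> s = l) * of_bool (\<omega> s' = l') * f \<omega>)) = 0"
begin

definition L :: "(('s \<Rightarrow> 'l) \<Rightarrow> real) \<Rightarrow> real" where
  "L f = (\<Sum>\<omega>\<in>\<Omega>. \<mu> \<omega> * f \<omega>)"

lemma L_sum: "L (\<lambda>\<omega>. \<Sum>i\<in>I. f i \<omega>) = (\<Sum>i\<in>I. L (f i))"
  unfolding L_def by (simp add: sum_distrib_left sum.swap[of _ I])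

lemma L_scale: "L (\<lambda>\<omega>. a * f \<omega>) = a * L f"
  unfolding L_def by (simp add: sum_distrib_left mult.left_commute)

lemma L_add: "L (\<lambda>\<omega>. f \<omega> + g \<omega>) = L f + L g"
  unfolding L_def by (simp add: distrib_left sum.distrib)

lemma L_diff: "L (\<lambda>\<omega>. f \<omega> - g \<omega>) = L f - L g"
  unfolding L_def by (simp add: right_diff_distrib sum_subtractf)

lemma L_cong: "(\<And>\<omega>. \<omega> \<in> \<Omega> \<Longrightarrow> f \<omega> = g \<omega>) \<Longrightarrow> L f = L g"
  unfolding L_def by (auto intro: sum.cong)

lemma L_one: "L (\<lambda>_. 1) = 1"
  unfolding L_def using mass_one by simp

lemma L_sq: "local_fun Sn Lb R f \<Longrightarrow> R \<le> 2 * r + 4 \<Longrightarrow> 0 \<le> L (\<lambda>\<omega>. (f \<omega>)\<^sup>2)"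
  unfolding L_def using square_nonneg local_fun_mono by blast

text \<open>The integral solution that a labelling satisfying all relations would provide. Outer
  edges are never bought; they are spanned through the labels.\<close>

definition active :: "('s \<Rightarrow> 'l) \<Rightarrow> nat set set" where
  "active \<omega> = edge_of ` (fixed_arcs \<union> {a \<in> choice_arcs. \<exists>s i. a = (Chain s i 0, Lab s (\<omega> s))})"

text \<open>The sets of more than \<open>2 r + 3\<close> edges do not occur in the SDP.\<close>

definition y :: "nat set set \<Rightarrow> real" where
  "y I = (if card I \<le> 2 * r + 3 then L (\<lambda>\<omega>. of_bool (I \<subseteq> active \<omega>)) else 0)"

lemma active_iff:
  "a \<in> arcs \<Longrightarrow> edge_of a \<in> active \<omega> \<longleftrightarrow> a \<in> fixed_arcs \<or> (a \<in> choice_arcs \<and> (\<exists>s i. a = (Chain s i 0, Lab s (\<omega> s))))"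
  unfolding active_def by (subst inj_on_image_mem_iff[OF inj_on_edge_of]) (auto simp: arcs_def)

lemma fixed_not_choice: "a \<in> fixed_arcs \<Longrightarrow> a \<notin> choice_arcs" "a \<in> outer_arcs \<Longrightarrow> a \<notin> fixed_arcs"
  "a \<in> outer_arcs \<Longrightarrow> a \<notin> choice_arcs"
  using SE_asym by (auto simp: arc_defs)

lemma active_fixed: "a \<in> fixed_arcs \<Longrightarrow> edge_of a \<in> active \<omega>"
  by (simp add: active_iff arcs_def)

lemma active_outer: "a \<in> outer_arcs \<Longrightarrow> edge_of a \<notin> active \<omega>"
  using fixed_not_choice by (subst active_iff) (auto simp: arcs_def)

lemma active_choice:
  assumes "s \<in> Sn" "i < c" "l \<in> Lb s"
  shows "edge_of (Chain s i 0, Lab s l) \<in> active \<omega> \<longleftrightarrow> \<omega> s = l"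
  using choice_arcI[OF assms] fixed_not_choice(1) by (subst active_iff) (auto simp: arcs_def)

lemma local_edge:
  assumes e: "e \<in> edges" and f: "local_fun Sn Lb R f"
  shows "local_fun Sn Lb (Suc R) (\<lambda>\<omega>. of_bool (e \<in> active \<omega>) * f \<omega>)"
proof -
  obtain a where a: "a \<in> arcs" "e = edge_of a" using e by (auto simp: edges_def)
  from a(1) consider "a \<in> choice_arcs" | "a \<in> fixed_arcs" | "a \<in> outer_arcs" by (auto simp: arcs_def)
  then show ?thesis
  proof cases
    case 1
    then obtain s i l where *: "s \<in> Sn" "i < c" "l \<in> Lb s" "a = (Chain s i 0, Lab s l)" by (auto simp: choice_arcs_def)
    then show ?thesis using local_fun.ind[OF f *(1,3)] active_choice[OF *(1-3)] a by simp
  next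
    case 2
    then show ?thesis using local_fun_mono[OF f, of "Suc R"] active_fixed a by simp
  next
    case 3
    then show ?thesis using local_fun_const[of Sn Lb "Suc R" 0] active_outer a by simp
  qed
qed

lemma local_edges:
  assumes "finite I" "I \<subseteq> edges" "local_fun Sn Lb R f" "card I + R \<le> R'"
  shows "local_fun Sn Lb R' (\<lambda>\<omega>. of_bool (I \<subseteq> active \<omega>) * f \<omega>)"
  using assms
proof (induction I arbitrary: R')
  case empty
  then show ?case using local_fun_mono by simp
next
  case (insert e I)
  then obtain R'' where R'': "R' = Suc R''" "card I + R \<le> R''" by (cases R') auto
  have "local_fun Sn Lb R'' (\<lambda>\<omega>. of_bool (I \<subseteq> active \<omega>) * f \<omega>)" using insert R'' by auto
  then have "local_fun Sn Lb R' (\<lambda>\<omega>. of_bool (e \<in> active \<omega>) * (of_bool (I \<subseteq> active \<omega>) * f \<omega>))"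
    using local_edge insert.prems R'' by auto
  then show ?case by (simp add: of_bool_conj mult.assoc)
qed

lemma local_active:
  assumes "I \<subseteq> edges" "card I \<le> R"
  shows "local_fun Sn Lb R (\<lambda>\<omega>. of_bool (I \<subseteq> active \<omega>))"
  using local_edges[OF finite_subset[OF assms(1) finite_edges] assms(1) local_fun.one, of 0 R] assms(2) by simp

text \<open>The indicator of a set of edges and its complement are their own squares. With up to
  \<open>2 * r + 3\<close> edges they have degree at most \<open>2 * r + 4\<close>, the degree up to
  which squares have nonnegative mean.\<close>

lemma y_bounds:
  assumes "I \<subseteq> edges"
  shows "0 \<le> y I" "y I \<le> 1"
proof -
  have "0 \<le> y I \<and> y I \<le> 1" if c: "card I \<le> 2 * r + 3"
  proof -
    let ?f = "\<lambda>\<omega>. of_bool (I \<subseteq> active \<omega>) :: real"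
    have lf: "local_fun Sn Lb (2 * r + 4) ?f" using local_active[OF assms] c by simp
    have "0 \<le> L (\<lambda>\<omega>. (?f \<omega>)\<^sup>2)" using L_sq[OF lf] by simp
    moreover have "(\<lambda>\<omega>. (?f \<omega>)\<^sup>2) = ?f" by (auto simp: of_bool_def)
    moreover have "local_fun Sn Lb (2 * r + 4) (\<lambda>\<omega>. 1 + (-1) * ?f \<omega>)"
      by (rule local_fun.add[OF local_fun.one local_fun.scale[OF lf]])
    then have "0 \<le> L (\<lambda>\<omega>. (1 + (-1) * ?f \<omega>)\<^sup>2)" using L_sq by blast
    moreover have "(\<lambda>\<omega>. (1 + (-1) * ?f \<omega>)\<^sup>2) = (\<lambda>\<omega>. 1 - ?f \<omega>)" by (auto simp: of_bool_def)
    ultimately show ?thesis using c L_diff[of "\<lambda>_. 1" ?f] L_one by (simp add: y_def)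
  qed
  then show "0 \<le> y I" "y I \<le> 1" by (auto simp: y_def)
qed

lemma psd_moment: "psd_on (lasserre_index edges (r + 1)) (\<lambda>I J. y (I \<union> J))"
  unfolding psd_on_def
proof
  fix x :: "nat set set \<Rightarrow> real"
  let ?S = "lasserre_index edges (r + 1)"
  let ?X = "\<lambda>I \<omega>. of_bool (I \<subseteq> active \<omega>) :: real"
  have yIJ: "y (I \<union> J) = L (\<lambda>\<omega>. ?X I \<omega> * ?X J \<omega>)" if "I \<in> ?S" "J \<in> ?S" for I J
  proof -
    have "card (I \<union> J) \<le> 2 * r + 3"
      using card_Un_le[of I J] that by (auto simp: lasserre_index_def)
    then show ?thesis by (simp add: y_def of_bool_conj)
  qed
  have "(\<Sum>I\<in>?S. \<Sum>J\<in>?S. x I * x J * y (I \<union> J)) = (\<Sum>I\<in>?S. \<Sum>J\<in>?S. L (\<lambda>\<omega>. (x I * ?X I \<omega>) * (x J * ?X J \<omega>)))"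
  proof (intro sum.cong refl)
    fix I J assume "I \<in> ?S" "J \<in> ?S"
    then show "x I * x J * y (I \<union> J) = L (\<lambda>\<omega>. (x I * ?X I \<omega>) * (x J * ?X J \<omega>))"
      using yIJ L_scale[of "x I * x J" "\<lambda>\<omega>. ?X I \<omega> * ?X J \<omega>"] by (simp add: mult.assoc mult.left_commute)
  qed
  also have "\<dots> = L (\<lambda>\<omega>. (\<Sum>I\<in>?S. x I * ?X I \<omega>)\<^sup>2)"
    by (simp add: L_sum power2_eq_square sum_product)
  also have "\<dots> \<ge> 0"
    by (rule L_sq[where R = "r + 1"]) (auto intro!: local_fun_sum local_fun.scale local_active simp: lasserre_index_def)
  finally show "0 \<le> (\<Sum>I\<in>?S. \<Sum>J\<in>?S. x I * x J * y (I \<union> J))" .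
qed

text \<open>Split by the labels of \<open>s\<close> and \<open>s'\<close>. A pair outside
  \<open>W\<close> contributes nothing, by \<open>kill\<close>. For a pair in \<open>W\<close> the
  edges of \<open>P\<close> are all active, so the slack is the constant \<open>sum z P - 1\<close>
  plus nonnegative multiples of edge indicators, and each term multiplied by the square of
  \<open>f\<close> is a nonnegative multiple of a square.\<close>

lemma slack_nonneg:
  assumes s: "s \<in> Sn" "s' \<in> Sn" and f: "local_fun Sn Lb r f" and z: "\<And>e. e \<in> edges \<Longrightarrow> 0 \<le> z e"
    and cov: "\<And>l l'. (l, l') \<in> W \<Longrightarrow> \<exists>P. P \<subseteq> edges \<and> 1 \<le> sum z P \<and>
       (\<forall>\<omega>. \<omega> s = l \<longrightarrow> \<omega> s' = l' \<longrightarrow> P \<subseteq> active \<omega>)"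
    and kill: "\<And>l l' g. l \<in> Lb s \<Longrightarrow> l' \<in> Lb s' \<Longrightarrow> (l, l') \<notin> W \<Longrightarrow> local_fun Sn Lb (2 * r + 4) g \<Longrightarrow>
       L (\<lambda>\<omega>. of_bool (\<omega> s = l) * of_bool (\<omega> s' = l') * g \<omega>) = 0"
  shows "0 \<le> L (\<lambda>\<omega>. (f \<omega>)\<^sup>2 * ((\<Sum>e\<in>edges. z e * of_bool (e \<in> active \<omega>)) - 1))"
proof -
  let ?q = "\<lambda>\<omega>. (\<Sum>e\<in>edges. z e * of_bool (e \<in> active \<omega>)) - 1"
  let ?i = "\<lambda>l l' \<omega>. of_bool (\<omega> s = l) * of_bool (\<omega> s' = l') :: real"
  have unity: "(\<Sum>l\<in>Lb s. \<Sum>l'\<in>Lb s'. ?i l l' \<omega>) = 1" if "\<omega> \<in> \<Omega>" for \<omega>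
  proof -
    have d: "(\<Sum>l\<in>Lb \<sigma>. of_bool (\<omega> \<sigma> = l) :: real) = 1" if "\<sigma> \<in> Sn" for \<sigma>
      using \<Omega>_lab[OF \<open>\<omega> \<in> \<Omega>\<close> that] finite_Lb[OF that] by (simp add: of_bool_def)
    have "(\<Sum>l\<in>Lb s. \<Sum>l'\<in>Lb s'. ?i l l' \<omega>) = (\<Sum>l\<in>Lb s. of_bool (\<omega> s = l)) * (\<Sum>l'\<in>Lb s'. of_bool (\<omega> s' = l'))"
      by (rule sum_product[symmetric])
    then show ?thesis using d s by simp
  qed
  have "L (\<lambda>\<omega>. (f \<omega>)\<^sup>2 * ?q \<omega>) = L (\<lambda>\<omega>. \<Sum>l\<in>Lb s. \<Sum>l'\<in>Lb s'. ?i l l' \<omega> * ((f \<omega>)\<^sup>2 * ?q \<omega>))"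
    by (rule L_cong) (simp add: sum_distrib_right[symmetric] unity)
  also have "\<dots> = (\<Sum>l\<in>Lb s. \<Sum>l'\<in>Lb s'. L (\<lambda>\<omega>. ?i l l' \<omega> * ((f \<omega>)\<^sup>2 * ?q \<omega>)))"
    by (simp add: L_sum)
  also have "\<dots> \<ge> 0"
  proof (intro sum_nonneg)
    fix l l' assume l: "l \<in> Lb s" "l' \<in> Lb s'"
    show "0 \<le> L (\<lambda>\<omega>. ?i l l' \<omega> * ((f \<omega>)\<^sup>2 * ?q \<omega>))"
    proof (cases "(l, l') \<in> W")
      case False
      have "local_fun Sn Lb 1 (\<lambda>\<omega>. (\<Sum>e\<in>edges. z e * (of_bool (e \<in> active \<omega>) * 1)) + (-1))"
        using local_edge[OF _ local_fun.one, of _ 0]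
        by (intro local_fun.add local_fun_sum local_fun.scale local_fun_const) simp
      from local_fun_mult[OF local_fun_mult[OF f f] this]
      have "local_fun Sn Lb (r + r + 1) (\<lambda>\<omega>. (f \<omega> * f \<omega>) * ?q \<omega>)" by simp
      then have "local_fun Sn Lb (2 * r + 4) (\<lambda>\<omega>. (f \<omega>)\<^sup>2 * ?q \<omega>)"
        unfolding power2_eq_square by (rule local_fun_mono) simp
      from kill[OF l False this] show ?thesis by simp
    next
      case True
      then obtain P where P: "P \<subseteq> edges" "1 \<le> sum z P" "\<And>\<omega>. \<omega> s = l \<Longrightarrow> \<omega> s' = l' \<Longrightarrow> P \<subseteq> active \<omega>"
        using cov by blast
      let ?g = "\<lambda>\<omega>. of_bool (\<omega> s = l) * (of_bool (\<omega> s' = l') * f \<omega>)"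
      have g: "local_fun Sn Lb (Suc (Suc r)) ?g" using f s l by (intro local_fun.ind)
      have "?i l l' \<omega> * ((f \<omega>)\<^sup>2 * ?q \<omega>) =
         (sum z P - 1) * (?g \<omega>)\<^sup>2 + (\<Sum>e\<in>edges - P. z e * (of_bool (e \<in> active \<omega>) * ?g \<omega>)\<^sup>2)" for \<omega>
      proof (cases "\<omega> s = l \<and> \<omega> s' = l'")
        case True
        have "(\<Sum>e\<in>edges. z e * of_bool (e \<in> active \<omega>)) = sum z P + (\<Sum>e\<in>edges - P. z e * of_bool (e \<in> active \<omega>))"
        proof -
          have "(\<Sum>e\<in>P. z e * of_bool (e \<in> active \<omega>)) = sum z P" using P(3)[of \<omega>] True by (intro sum.cong) auto
          then show ?thesis using sum.subset_diff[OF P(1) finite_edges, of "\<lambda>e. z e * of_bool (e \<in> active \<omega>)"] by simp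
        qed
        then have "?i l l' \<omega> * ((f \<omega>)\<^sup>2 * ?q \<omega>) = (sum z P - 1) * (f \<omega>)\<^sup>2 + (\<Sum>e\<in>edges - P. z e * of_bool (e \<in> active \<omega>) * (f \<omega>)\<^sup>2)"
          using True by (simp add: algebra_simps sum_distrib_left)
        then show ?thesis using True by (auto simp: power_mult_distrib mult.assoc of_bool_def intro!: sum.cong)
      qed auto
      then have "L (\<lambda>\<omega>. ?i l l' \<omega> * ((f \<omega>)\<^sup>2 * ?q \<omega>)) =
         (sum z P - 1) * L (\<lambda>\<omega>. (?g \<omega>)\<^sup>2) + (\<Sum>e\<in>edges - P. z e * L (\<lambda>\<omega>. (of_bool (e \<in> active \<omega>) * ?g \<omega>)\<^sup>2))"
        by (simp only: L_add L_sum L_scale)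
      also have "\<dots> \<ge> 0"
      proof -
        have "0 \<le> L (\<lambda>\<omega>. (?g \<omega>)\<^sup>2)" by (rule L_sq[OF g]) simp
        moreover have "0 \<le> L (\<lambda>\<omega>. (of_bool (e \<in> active \<omega>) * ?g \<omega>)\<^sup>2)" if "e \<in> edges" for e
          by (rule L_sq[OF local_edge[OF that g]]) simp
        ultimately show ?thesis using P(2) z by (intro add_nonneg_nonneg sum_nonneg mult_nonneg_nonneg) auto
      qed
      finally show ?thesis .
    qed
  qed
  finally show ?thesis .
qed

lemma slack_psd:
  assumes s: "s \<in> Sn" "s' \<in> Sn" and z: "\<And>e. e \<in> edges \<Longrightarrow> 0 \<le> z e"
    and cov: "\<And>l l'. (l, l') \<in> W \<Longrightarrow> \<exists>P. P \<subseteq> edges \<and> 1 \<le> sum z P \<and>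
       (\<forall>\<omega>. \<omega> s = l \<longrightarrow> \<omega> s' = l' \<longrightarrow> P \<subseteq> active \<omega>)"
    and kill: "\<And>l l' g. l \<in> Lb s \<Longrightarrow> l' \<in> Lb s' \<Longrightarrow> (l, l') \<notin> W \<Longrightarrow> local_fun Sn Lb (2 * r + 4) g \<Longrightarrow>
       L (\<lambda>\<omega>. of_bool (\<omega> s = l) * of_bool (\<omega> s' = l') * g \<omega>) = 0"
  shows "psd_on (lasserre_index edges r) (\<lambda>I J. (\<Sum>f\<in>edges. z f * y (I \<union> J \<union> {f})) - y (I \<union> J))"
  unfolding psd_on_def
proof
  fix x :: "nat set set \<Rightarrow> real"
  let ?S = "lasserre_index edges r"
  let ?X = "\<lambda>I \<omega>. of_bool (I \<subseteq> active \<omega>) :: real"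
  let ?q = "\<lambda>\<omega>. (\<Sum>e\<in>edges. z e * of_bool (e \<in> active \<omega>)) - 1"
  have ent: "(\<Sum>f\<in>edges. z f * y (I \<union> J \<union> {f})) - y (I \<union> J) = L (\<lambda>\<omega>. (?X I \<omega> * ?X J \<omega>) * ?q \<omega>)"
    if "I \<in> ?S" "J \<in> ?S" for I J
  proof -
    have c: "card (I \<union> J) \<le> 2 * r" using card_Un_le[of I J] that by (auto simp: lasserre_index_def)
    have y1: "y (I \<union> J) = L (\<lambda>\<omega>. ?X I \<omega> * ?X J \<omega>)" using c by (simp add: y_def of_bool_conj)
    have y2: "y (I \<union> J \<union> {e}) = L (\<lambda>\<omega>. (?X I \<omega> * ?X J \<omega>) * of_bool (e \<in> active \<omega>))" for e
    proof -
      have "card (I \<union> J \<union> {e}) \<le> 2 * r + 3" using card_Un_le[of "I \<union> J" "{e}"] c by auto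
      then have "y (I \<union> J \<union> {e}) = L (\<lambda>\<omega>. of_bool (I \<union> J \<union> {e} \<subseteq> active \<omega>))" by (simp add: y_def)
      moreover have "(\<lambda>\<omega>. of_bool (I \<union> J \<union> {e} \<subseteq> active \<omega>) :: real) = (\<lambda>\<omega>. (?X I \<omega> * ?X J \<omega>) * of_bool (e \<in> active \<omega>))"
        by auto
      ultimately show ?thesis by simp
    qed
    have "L (\<lambda>\<omega>. (?X I \<omega> * ?X J \<omega>) * ?q \<omega>) =
      L (\<lambda>\<omega>. (\<Sum>e\<in>edges. z e * ((?X I \<omega> * ?X J \<omega>) * of_bool (e \<in> active \<omega>))) - ?X I \<omega> * ?X J \<omega>)"
      by (rule L_cong) (simp add: right_diff_distrib sum_distrib_left mult_ac)
    then show ?thesis by (simp only: L_diff L_sum L_scale y1 y2)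
  qed
  have "(\<Sum>I\<in>?S. \<Sum>J\<in>?S. x I * x J * ((\<Sum>f\<in>edges. z f * y (I \<union> J \<union> {f})) - y (I \<union> J))) =
     (\<Sum>I\<in>?S. \<Sum>J\<in>?S. L (\<lambda>\<omega>. (x I * ?X I \<omega>) * (x J * ?X J \<omega>) * ?q \<omega>))"
  proof (intro sum.cong refl)
    fix I J assume IJ: "I \<in> ?S" "J \<in> ?S"
    show "x I * x J * ((\<Sum>f\<in>edges. z f * y (I \<union> J \<union> {f})) - y (I \<union> J)) = L (\<lambda>\<omega>. (x I * ?X I \<omega>) * (x J * ?X J \<omega>) * ?q \<omega>)"
      unfolding ent[OF IJ] L_scale[symmetric] by (rule L_cong) (simp only: mult_ac)
  qed
  also have "\<dots> = L (\<lambda>\<omega>. (\<Sum>I\<in>?S. x I * ?X I \<omega>)\<^sup>2 * ?q \<omega>)"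
    unfolding L_sum[symmetric] power2_eq_square sum_product by (rule L_cong) (simp only: sum_distrib_right)
  also have "\<dots> \<ge> 0"
    by (rule slack_nonneg[where s = s and s' = s' and W = W])
      (use s z cov kill in \<open>auto intro!: local_fun_sum local_fun.scale local_active simp: lasserre_index_def\<close>)
  finally show "0 \<le> (\<Sum>I\<in>?S. \<Sum>J\<in>?S. x I * x J * ((\<Sum>f\<in>edges. z f * y (I \<union> J \<union> {f})) - y (I \<union> J)))" .
qed


lemma cover_path:
  assumes z: "z \<in> Zset edges (2 * k - 1) (nm (hd q)) (nm (last q))"
    and q: "q \<noteq> []" "distinct q" "set q \<subseteq> verts" "length q \<le> 2 * k" and ll: "s = s' \<Longrightarrow> l = l'"
    and act: "\<And>\<omega>. \<omega> s = l \<Longrightarrow> \<omega> s' = l' \<Longrightarrow> successively (\<lambda>a b. {nm a, nm b} \<in> active \<omega>) q"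
  shows "\<exists>P. P \<subseteq> edges \<and> 1 \<le> sum z P \<and> (\<forall>\<omega>. \<omega> s = l \<longrightarrow> \<omega> s' = l' \<longrightarrow> P \<subseteq> active \<omega>)"
proof (intro exI[of _ "path_edges (map nm q)"] conjI allI impI)
  show sub: "path_edges (map nm q) \<subseteq> active \<omega>" if "\<omega> s = l" "\<omega> s' = l'" for \<omega>
    using act[OF that] by (auto simp: path_edges_def successively_conv_nth)
  have "active \<omega> \<subseteq> edges" for \<omega> by (auto simp: active_def edges_def arcs_def)
  \<comment> \<open>A labelling taking the values \<open>l\<close> and \<open>l'\<close> is needed
    as a witness; if \<open>s = s'\<close> it exists because then \<open>l = l'\<close>.\<close>
  then show sub': "path_edges (map nm q) \<subseteq> edges"
    using sub[of "\<lambda>x. if x = s then l else l'"] ll by fastforce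
  have "distinct (map nm q)" using q inj_nm by (auto simp: distinct_map intro: inj_on_subset)
  then have "map nm q \<in> short_paths edges (2 * k - 1) (nm (hd q)) (nm (last q))"
    using q sub' by (auto simp: short_paths_def is_path_def hd_map last_map)
  then show "1 \<le> sum z (path_edges (map nm q))" using z by (auto simp: Zset_def)
qed

lemma verts_arc: "(a, b) \<in> arcs \<Longrightarrow> a \<in> verts" "(a, b) \<in> arcs \<Longrightarrow> b \<in> verts"
  unfolding verts_def by (auto intro: rev_image_eqI)

text \<open>A choice edge is spanned by itself or, through the star, by the choice edge of the label
  actually taken; a fixed edge spans itself; an outer edge is spanned along both chains through two
  compatible labels. In the first two cases one supernode decides, so the split is along the
  diagonal.\<close>

lemma slack_arc:
  assumes a: "a \<in> arcs" and z: "z \<in> Zset edges (2 * k - 1) (nm (fst a)) (nm (snd a))"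
  shows "psd_on (lasserre_index edges r) (\<lambda>I J. (\<Sum>f\<in>edges. z f * y (I \<union> J \<union> {f})) - y (I \<union> J))"
proof -
  have zn: "0 \<le> z e" if "e \<in> edges" for e using z that by (auto simp: Zset_def)
  have kill_diag: "L (\<lambda>\<omega>. of_bool (\<omega> s = l) * of_bool (\<omega> s = l') * g \<omega>) = 0" if "l \<noteq> l'" for s l l' g
    using that by (auto simp: L_def intro!: sum.neutral)
  have fx: "{nm u, nm v} \<in> active \<omega>" "{nm v, nm u} \<in> active \<omega>" if "(u, v) \<in> fixed_arcs" for u v \<omega>
    using active_fixed[OF that] by (auto simp: edge_of_def insert_commute)
  have ch: "{nm (Chain s i 0), nm (Lab s (\<omega> s))} \<in> active \<omega>" "{nm (Lab s (\<omega> s)), nm (Chain s i 0)} \<in> active \<omega>"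
    if "s \<in> Sn" "i < c" "\<omega> s \<in> Lb s" for s i \<omega>
    using active_choice[OF that] by (auto simp: edge_of_def insert_commute)
  from a consider "a \<in> choice_arcs" | "a \<in> fixed_arcs" | "a \<in> outer_arcs" by (auto simp: arcs_def)
  then show ?thesis
  proof cases
    case 1
    then obtain s i m where *: "s \<in> Sn" "i < c" "m \<in> Lb s" "a = (Chain s i 0, Lab s m)" by (auto simp: choice_arcs_def)
    have V: "Chain s i 0 \<in> verts" "Lab s l \<in> verts" "Star s \<in> verts" if "l \<in> Lb s" for l
      using verts_arc choice_arcI[OF *(1,2) that] star_arcI[OF *(1) that] by (auto simp: arcs_def fixed_arcs_def)
    show ?thesis
    proof (rule slack_psd[where s = s and s' = s and W = "{(l, l) | l. l \<in> Lb s}"])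
      fix l l' assume "(l, l') \<in> {(l, l) | l. l \<in> Lb s}"
      then have l: "l' = l" "l \<in> Lb s" by auto
      show "\<exists>P. P \<subseteq> edges \<and> 1 \<le> sum z P \<and> (\<forall>\<omega>. \<omega> s = l \<longrightarrow> \<omega> s = l' \<longrightarrow> P \<subseteq> active \<omega>)"
      proof (cases "l = m")
        case True
        show ?thesis by (rule cover_path[where q = "[Chain s i 0, Lab s m]"])
          (use z * l True V ch k_ge_2 in auto)
      next
        case False
        have st: "(Star s, Lab s l'') \<in> fixed_arcs" if "l'' \<in> Lb s" for l''
          using star_arcI[OF *(1) that] by (simp add: fixed_arcs_def)
        show ?thesis by (rule cover_path[where q = "[Chain s i 0, Lab s l, Star s, Lab s m]"])
          (use z * l False V ch fx[OF st] k_ge_2 in auto)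
      qed
    qed (use * zn kill_diag in auto)
  next
    case 2
    \<comment> \<open>A fixed edge is bought under every labelling, so any supernode may serve for
      the split.\<close>
    obtain s where s: "s \<in> Sn" using 2 SE_sub by (auto simp: arc_defs)
    have ne: "fst a \<noteq> snd a" using a arcs_asym[of "fst a" "snd a"] by (cases a) auto
    show ?thesis
    proof (rule slack_psd[where s = s and s' = s and W = "{(l, l) | l. l \<in> Lb s}"])
      fix l l' assume "(l, l') \<in> {(l, l) | l. l \<in> Lb s}"
      then show "\<exists>P. P \<subseteq> edges \<and> 1 \<le> sum z P \<and> (\<forall>\<omega>. \<omega> s = l \<longrightarrow> \<omega> s = l' \<longrightarrow> P \<subseteq> active \<omega>)"
        using 2 z a ne verts_arc[of "fst a" "snd a"] fx[of "fst a" "snd a"] k_ge_2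
        by (intro cover_path[where q = "[fst a, snd a]"]) auto
    qed (use s zn kill_diag in auto)
  next
    case 3
    then obtain s s' i where *: "(s, s') \<in> SE" "i < c" "a = (Chain s i (k - 2), Chain s' i (k - 2))"
      by (auto simp: outer_arcs_def)
    have ss: "s \<in> Sn" "s' \<in> Sn" "s \<noteq> s'" using * SE_sub SE_asym by auto
    show ?thesis
    proof (rule slack_psd[where s = s and s' = s' and W = "Rel s s'"])
      fix l l' assume R: "(l, l') \<in> Rel s s'"
      then have l: "l \<in> Lb s" "l' \<in> Lb s'" using Rel_sub *(1) by auto
      \<comment> \<open>\<open>k - 1\<close> chain vertices on either side and two labels make
        \<open>2 * k\<close> vertices, hence \<open>2 * k - 1\<close> edges, the longest path
        allowed.\<close>
      let ?q = "rev (map (Chain s i) [0..<k - 1]) @ [Lab s l, Lab s' l'] @ map (Chain s' i) [0..<k - 1]"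
      have chain_ends: "hd ?q = Chain s i (k - 2)" "last ?q = Chain s' i (k - 2)"
        using k_ge_2 by (auto simp: hd_append hd_rev last_map Suc_diff_Suc numeral_2_eq_2)
      have chv: "Chain \<sigma> i j \<in> verts" if "\<sigma> \<in> Sn" "j < k - 1" "Lb \<sigma> \<noteq> {}" for \<sigma> j
      proof (cases j)
        case 0
        then show ?thesis using that verts_arc(1) choice_arcI[OF that(1) *(2)] by (fastforce simp: arcs_def)
      next
        case (Suc j')
        then show ?thesis using that verts_arc(2) chain_arcI[OF that(1) *(2), of j'] by (fastforce simp: arcs_def fixed_arcs_def)
      qed
      have labv: "Lab \<sigma> m \<in> verts" if "\<sigma> \<in> Sn" "m \<in> Lb \<sigma>" for \<sigma> m
        using verts_arc(2) choice_arcI[OF that(1) *(2) that(2)] by (fastforce simp: arcs_def)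
      have cha: "successively (\<lambda>a b. {nm a, nm b} \<in> active \<omega>) (map (Chain \<sigma> i) [0..<k - 1])"
        "successively (\<lambda>a b. {nm a, nm b} \<in> active \<omega>) (rev (map (Chain \<sigma> i) [0..<k - 1]))" if "\<sigma> \<in> Sn" for \<omega> \<sigma>
      proof -
        have "{nm (Chain \<sigma> i j), nm (Chain \<sigma> i (Suc j))} \<in> active \<omega>" if "Suc j < k - 1" for j
          using fx chain_arcI[OF \<open>\<sigma> \<in> Sn\<close> *(2), of j] that by (auto simp: fixed_arcs_def)
        then show "successively (\<lambda>a b. {nm a, nm b} \<in> active \<omega>) (map (Chain \<sigma> i) [0..<k - 1])"
          by (auto simp: successively_conv_nth)
        then show "successively (\<lambda>a b. {nm a, nm b} \<in> active \<omega>) (rev (map (Chain \<sigma> i) [0..<k - 1]))"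
          unfolding successively_rev by (simp add: insert_commute)
      qed
      show "\<exists>P. P \<subseteq> edges \<and> 1 \<le> sum z P \<and> (\<forall>\<omega>. \<omega> s = l \<longrightarrow> \<omega> s' = l' \<longrightarrow> P \<subseteq> active \<omega>)"
      proof (rule cover_path[where q = ?q])
        show "z \<in> Zset edges (2 * k - 1) (nm (hd ?q)) (nm (last ?q))" using z * chain_ends by simp
        show "distinct ?q" using ss by (auto simp: distinct_map inj_on_def)
        show "set ?q \<subseteq> verts"
        proof -
          have "Lb s \<noteq> {}" "Lb s' \<noteq> {}" using l by auto
          then have "Chain s i ` {..<k - 1} \<subseteq> verts" "Chain s' i ` {..<k - 1} \<subseteq> verts"
            using chv ss(1,2) by (auto simp del: One_nat_def)
          moreover have "set ?q = Chain s i ` {..<k - 1} \<union> {Lab s l, Lab s' l'} \<union> Chain s' i ` {..<k - 1}"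
            by (simp add: lessThan_atLeast0 Un_assoc)
          ultimately show ?thesis using labv ss l by simp
        qed
        show "length ?q \<le> 2 * k" using k_ge_2 by simp
        fix \<omega> assume w: "\<omega> s = l" "\<omega> s' = l'"
        have inn: "{nm (Lab s l), nm (Lab s' l')} \<in> active \<omega>" using fx inner_arcI[OF *(1) R] by (auto simp: fixed_arcs_def)
        define U :: "('s, 'l) vert list" where "U = map (Chain s' i) [0..<k - 1]"
        define U' :: "('s, 'l) vert list" where "U' = rev (map (Chain s i) [0..<k - 1])"
        have hdl: "hd U = Chain s' i 0" "last U' = Chain s i 0"
          using k_ge_2 by (auto simp: U_def U'_def hd_map last_rev)
        have "successively (\<lambda>a b. {nm a, nm b} \<in> active \<omega>) (U' @ [Lab s l, Lab s' l'] @ U)"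
          using cha(2)[OF ss(1), of \<omega>, folded U'_def] cha(1)[OF ss(2), of \<omega>, folded U_def] inn
            ch[of s i \<omega>] ch[of s' i \<omega>] ss *(2) w l
          by (simp add: successively_append_iff successively_Cons hdl)
        then show "successively (\<lambda>a b. {nm a, nm b} \<in> active \<omega>) ?q" by (simp only: U_def U'_def)
      qed (use ss in \<open>simp_all\<close>)
    next
      show "L (\<lambda>\<omega>. of_bool (\<omega> s = l) * of_bool (\<omega> s' = l') * g \<omega>) = 0"
        if "l \<in> Lb s" "l' \<in> Lb s'" "(l, l') \<notin> Rel s s'" "local_fun Sn Lb (2 * r + 4) g" for l l' g
        unfolding L_def by (rule kills[OF *(1) that])
    qed (use ss zn in auto)
  qed
qed

lemma feasible: "sdp_feasible edges (2 * k - 1) r y"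
  unfolding sdp_feasible_def
proof (intro conjI allI impI ballI)
  show "y {} = 1" using L_one by (simp add: y_def)
  fix u v z assume uv: "{u, v} \<in> edges" and z: "z \<in> Zset edges (2 * k - 1) u v"
  then obtain a where a: "a \<in> arcs" "{u, v} = {nm (fst a), nm (snd a)}" by (auto simp: edges_def edge_of_def)
  then have "z \<in> Zset edges (2 * k - 1) (nm (fst a)) (nm (snd a))"
    using z Zset_commute by (auto simp: doubleton_eq_iff)
  then show "psd_on (lasserre_index edges r) (\<lambda>I J. (\<Sum>f\<in>edges. z f * y (I \<union> J \<union> {f})) - y (I \<union> J))"
    using slack_arc a by blast
qed (use y_bounds psd_moment in auto)

text \<open>A labelling takes exactly one label at each supernode, so the choice edges of each hub
  copy have total value 1; fixed edges cost 1 each and outer edges nothing.\<close>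

lemma value_le:
  "(\<Sum>e\<in>edges. y {e}) \<le> real (c * card Sn * (k - 1) + (\<Sum>s\<in>Sn. card (Lb s)) + (\<Sum>e\<in>SE. card (Rel (fst e) (snd e))))"
proof -
  have ysing: "y {e} = L (\<lambda>\<omega>. of_bool (e \<in> active \<omega>))" for e by (simp add: y_def)
  have "(\<Sum>e\<in>edges. y {e}) = (\<Sum>a\<in>arcs. y {edge_of a})"
    unfolding edges_def by (subst sum.reindex[OF inj_on_edge_of]) simp
  also have "\<dots> = (\<Sum>a\<in>choice_arcs. y {edge_of a}) + (\<Sum>a\<in>fixed_arcs. y {edge_of a}) + (\<Sum>a\<in>outer_arcs. y {edge_of a})"
    unfolding arcs_def using finite_fixed finite_choice finite_outer fixed_not_choice
    by (subst sum.union_disjoint; auto)+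
  also have "(\<Sum>a\<in>outer_arcs. y {edge_of a}) = 0"
    using active_outer by (auto simp: ysing L_def intro!: sum.neutral)
  also have "(\<Sum>a\<in>fixed_arcs. y {edge_of a}) = card fixed_arcs"
    using active_fixed L_one by (simp add: ysing)
  also have "(\<Sum>a\<in>choice_arcs. y {edge_of a}) = real (c * card Sn)"
  proof -
    have inj: "inj_on (\<lambda>(s, i, l). (Chain s i 0, Lab s l)) (SIGMA s:Sn. {..<c} \<times> Lb s)" by (auto simp: inj_on_def)
    have "(\<Sum>a\<in>choice_arcs. y {edge_of a}) = (\<Sum>(s, i, l)\<in>(SIGMA s:Sn. {..<c} \<times> Lb s). y {edge_of (Chain s i 0, Lab s l)})"
      unfolding choice_arcs_def by (subst sum.reindex[OF inj]) (simp add: case_prod_unfold)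
    also have "\<dots> = (\<Sum>s\<in>Sn. \<Sum>(i, l)\<in>{..<c} \<times> Lb s. y {edge_of (Chain s i 0, Lab s l)})"
      using finite_Sn finite_Lb by (subst sum.Sigma[symmetric]) (auto simp: case_prod_unfold)
    also have "\<dots> = (\<Sum>s\<in>Sn. \<Sum>i<c. \<Sum>l\<in>Lb s. y {edge_of (Chain s i 0, Lab s l)})"
      by (simp add: sum.cartesian_product)
    also have "\<dots> = (\<Sum>s\<in>Sn. \<Sum>i<c. 1)"
    proof (intro sum.cong refl)
      fix s i assume si: "s \<in> Sn" "i \<in> {..<c}"
      have "(\<Sum>l\<in>Lb s. y {edge_of (Chain s i 0, Lab s l)}) = (\<Sum>l\<in>Lb s. L (\<lambda>\<omega>. of_bool (\<omega> s = l)))"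
        using si active_choice by (intro sum.cong) (auto simp: ysing)
      also have "\<dots> = L (\<lambda>\<omega>. \<Sum>l\<in>Lb s. of_bool (\<omega> s = l))" by (simp only: L_sum)
      also have "\<dots> = L (\<lambda>_. 1)" using si \<Omega>_lab finite_Lb by (intro L_cong) (simp add: of_bool_def)
      finally show "(\<Sum>l\<in>Lb s. y {edge_of (Chain s i 0, Lab s l)}) = 1" by (simp add: L_one)
    qed
    finally show ?thesis by simp
  qed
  finally have eq: "(\<Sum>e\<in>edges. y {e}) = real (c * card Sn) + real (card fixed_arcs)" by simp
  have c1: "card chain_arcs \<le> c * card Sn * (k - 2)" unfolding chain_arcs_def
    by (rule order.trans[OF card_image_le]) (auto simp: finite_Sn card_cartesian_product mult_ac)
  have c2: "card star_arcs \<le> (\<Sum>s\<in>Sn. card (Lb s))" unfolding star_arcs_def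
    by (rule order.trans[OF card_image_le]) (auto simp: finite_Sn finite_Lb)
  have c3: "card inner_arcs \<le> (\<Sum>e\<in>SE. card (Rel (fst e) (snd e)))" unfolding inner_arcs_def
    by (rule order.trans[OF card_image_le]) (auto simp: finite_SE finite_Rel)
  have "card fixed_arcs \<le> card chain_arcs + card star_arcs + card inner_arcs"
    unfolding fixed_arcs_def by (meson add_le_mono1 card_Un_le order.trans)
  then have "c * card Sn + card fixed_arcs \<le> c * card Sn * (k - 1) + (\<Sum>s\<in>Sn. card (Lb s)) + (\<Sum>e\<in>SE. card (Rel (fst e) (snd e)))"
  proof -
    have "c * card Sn * (k - 1) = c * card Sn * (k - 2) + c * card Sn" using k_ge_2
      by (metis Suc_1 Suc_diff_Suc Suc_le_lessD add.commute mult_Suc_right diff_Suc_1 numeral_2_eq_2 One_nat_def)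
    then show ?thesis using \<open>card fixed_arcs \<le> _\<close> c1 c2 c3 by linarith
  qed
  then show ?thesis unfolding eq by linarith
qed

theorem gap:
  assumes nm: "nm ` verts \<subseteq> {..<n}" and SE_ne: "arcs \<noteq> {}"
    and noshort: "\<And>s s' h. (s, s') \<in> SE \<Longrightarrow> h \<le> 2 * k - 1 \<Longrightarrow> (s, s') \<notin> (superadj - {(s, s'), (s', s)}) ^^ h"
    and sound: "\<And>S. (\<And>s. s \<in> Sn \<Longrightarrow> S s \<subseteq> Lb s) \<Longrightarrow>
        G \<le> (\<Sum>s\<in>Sn. card (S s)) + card {(s, s') \<in> SE. \<not> (\<exists>(l, l')\<in>Rel s s'. l \<in> S s \<and> l' \<in> S s')}"
  shows "is_graph n edges"
    and "real (c * G) / real (c * card Sn * (k - 1) + (\<Sum>s\<in>Sn. card (Lb s)) + (\<Sum>e\<in>SE. card (Rel (fst e) (snd e))))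
      \<le> integrality_gap edges (2 * k - 1) r"
proof -
  show gr: "is_graph n edges" unfolding is_graph_def
  proof
    fix e assume "e \<in> edges"
    then obtain u v where uv: "(u, v) \<in> arcs" "e = {nm u, nm v}" by (auto simp: edges_def edge_of_def)
    have V: "u \<in> verts" "v \<in> verts" using verts_arc[OF uv(1)] by auto
    have "u \<noteq> v" using arcs_asym[OF uv(1)] uv(1) by auto
    then have "nm u \<noteq> nm v" using V inj_nm by (auto dest: inj_onD)
    then show "\<exists>a b. a < n \<and> b < n \<and> a \<noteq> b \<and> e = {a, b}" using uv V nm by blast
  qed
  show "real (c * G) / real (c * card Sn * (k - 1) + (\<Sum>s\<in>Sn. card (Lb s)) + (\<Sum>e\<in>SE. card (Rel (fst e) (snd e))))
      \<le> integrality_gap edges (2 * k - 1) r"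
  proof (rule integrality_gap_ge[OF gr finite_edges _ _ feasible value_le])
    show "edges \<noteq> {}" using SE_ne by (simp add: edges_def)
    show "real (c * G) \<le> real (card H)" if "is_spanner edges (2 * k - 1) H" for H
      using spanner_size_lower_bound[OF that noshort sound] by (simp only: of_nat_le_iff)
  qed (use k_ge_2 in auto)
qed

end

section \<open>Pseudo-distributions from characters\<close>

text \<open>Nonvanishing of \<open>\<kappa>\<close> is an equivalence relation, and on the class of
  \<open>x0\<close> the matrix is the rank-one matrix \<open>\<kappa> x0 x * \<kappa> x0 y\<close>.
  The induction removes one class at a time.\<close>

lemma psd_of_partial_cocycle:
  fixes \<kappa> :: "'x \<Rightarrow> 'x \<Rightarrow> real"
  assumes "finite A"
    and rfl: "\<And>x. x \<in> A \<Longrightarrow> \<kappa> x x = 1"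
    and sym: "\<And>x y. x \<in> A \<Longrightarrow> y \<in> A \<Longrightarrow> \<kappa> x y = \<kappa> y x"
    and cocycle: "\<And>x y z. x \<in> A \<Longrightarrow> y \<in> A \<Longrightarrow> z \<in> A \<Longrightarrow> \<kappa> x y \<noteq> 0 \<Longrightarrow> \<kappa> y z \<noteq> 0 \<Longrightarrow> \<kappa> x z = \<kappa> x y * \<kappa> y z"
  shows "0 \<le> (\<Sum>x\<in>A. \<Sum>y\<in>A. a x * a y * \<kappa> x y)"
  using assms
proof (induction A rule: finite_psubset_induct)
  case (psubset A)
  note rfl = psubset.prems(1) and sym = psubset.prems(2) and coc = psubset.prems(3)
  show ?case
  proof (cases "A = {}")
    case False
    then obtain x0 where x0: "x0 \<in> A" by auto
    define C where "C = {y \<in> A. \<kappa> x0 y \<noteq> 0}"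
    have C: "C \<subseteq> A" "x0 \<in> C" "finite C" using x0 rfl psubset.hyps by (auto simp: C_def)
    have split: "sum g A = sum g C + sum g (A - C)" for g :: "'x \<Rightarrow> real"
      using sum.subset_diff[OF C(1) psubset.hyps, of g] by simp
    have cross: "\<kappa> x y = 0" "\<kappa> y x = 0" if "x \<in> C" "y \<in> A - C" for x y
    proof -
      show "\<kappa> x y = 0"
      proof (rule ccontr)
        assume n: "\<kappa> x y \<noteq> 0"
        have "\<kappa> x0 y = \<kappa> x0 x * \<kappa> x y" using coc[of x0 x y] x0 that n by (auto simp: C_def)
        then show False using n that by (auto simp: C_def)
      qed
      then show "\<kappa> y x = 0" using sym[of x y] that C by auto
    qed
    have CC: "\<kappa> x y = \<kappa> x0 x * \<kappa> x0 y" if "x \<in> C" "y \<in> C" for x y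
      using coc[of x x0 y] sym[of x x0] that x0 by (auto simp: C_def)
    have "(\<Sum>x\<in>A. \<Sum>y\<in>A. a x * a y * \<kappa> x y) =
      (\<Sum>x\<in>C. \<Sum>y\<in>C. a x * a y * \<kappa> x y) + (\<Sum>x\<in>A - C. \<Sum>y\<in>A - C. a x * a y * \<kappa> x y)"
    proof -
      have "(\<Sum>y\<in>A. a x * a y * \<kappa> x y) = (\<Sum>y\<in>C. a x * a y * \<kappa> x y)" if "x \<in> C" for x
        using cross(1)[OF that] by (subst split) simp
      moreover have "(\<Sum>y\<in>A. a x * a y * \<kappa> x y) = (\<Sum>y\<in>A - C. a x * a y * \<kappa> x y)" if "x \<in> A - C" for x
        using cross(2)[OF _ that] by (subst split) simp
      ultimately show ?thesis by (subst split) simp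
    qed
    also have "(\<Sum>x\<in>C. \<Sum>y\<in>C. a x * a y * \<kappa> x y) = (\<Sum>x\<in>C. a x * \<kappa> x0 x)\<^sup>2"
      unfolding power2_eq_square sum_product by (intro sum.cong refl) (subst CC, simp_all add: mult_ac)
    also have "0 \<le> (\<Sum>x\<in>C. a x * \<kappa> x0 x)\<^sup>2 + (\<Sum>x\<in>A - C. \<Sum>y\<in>A - C. a x * a y * \<kappa> x y)"
    proof -
      have "0 \<le> (\<Sum>x\<in>A - C. \<Sum>y\<in>A - C. a x * a y * \<kappa> x y)"
      proof (rule psubset.IH)
        show "A - C \<subset> A" using C x0 by auto
        show "\<kappa> x x = 1" if "x \<in> A - C" for x using rfl that by simp
        show "\<kappa> x y = \<kappa> y x" if "x \<in> A - C" "y \<in> A - C" for x y using that by (intro sym) auto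
        show "\<kappa> x z = \<kappa> x y * \<kappa> y z" if "x \<in> A - C" "y \<in> A - C" "z \<in> A - C" "\<kappa> x y \<noteq> 0" "\<kappa> y z \<noteq> 0" for x y z
          using that by (intro coc) auto
      qed
      then show ?thesis by simp
    qed
    finally show ?thesis .
  qed simp
qed

text \<open>Every label set is a finite group of exponent two inside the common set
  \<open>Q\<close>, paired with itself by \<open>\<beta>\<close>. Hence characters of labellings are
  again indexed by labellings, and \<open>U\<close> plays both roles.\<close>

locale char_space =
  fixes Sn :: "'s set" and Lb :: "'s \<Rightarrow> 'l :: ab_group_add set" and Q :: "'l set" and \<beta> :: "'l \<Rightarrow> 'l \<Rightarrow> real"
  assumes finite_Sn: "finite Sn"
    and finite_Lb: "s \<in> Sn \<Longrightarrow> finite (Lb s)"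
    and Lb_0: "s \<in> Sn \<Longrightarrow> 0 \<in> Lb s"
    and Lb_add: "s \<in> Sn \<Longrightarrow> x \<in> Lb s \<Longrightarrow> y \<in> Lb s \<Longrightarrow> x + y \<in> Lb s"
    and Lb_Q: "s \<in> Sn \<Longrightarrow> Lb s \<subseteq> Q"
    and char_2: "x \<in> Q \<Longrightarrow> x + x = 0"
    and \<beta>_add_left: "x \<in> Q \<Longrightarrow> y \<in> Q \<Longrightarrow> z \<in> Q \<Longrightarrow> \<beta> (x + y) z = \<beta> x z * \<beta> y z"
    and \<beta>_add_right: "x \<in> Q \<Longrightarrow> y \<in> Q \<Longrightarrow> z \<in> Q \<Longrightarrow> \<beta> z (x + y) = \<beta> z x * \<beta> z y"
    and \<beta>_sq: "x \<in> Q \<Longrightarrow> y \<in> Q \<Longrightarrow> \<beta> x y * \<beta> x y = 1"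
    and \<beta>_sym: "x \<in> Q \<Longrightarrow> y \<in> Q \<Longrightarrow> \<beta> x y = \<beta> y x"
    and \<beta>_nondeg: "s \<in> Sn \<Longrightarrow> x \<in> Lb s \<Longrightarrow> x \<noteq> 0 \<Longrightarrow> (\<Sum>l\<in>Lb s. \<beta> x l) = 0"
begin

text \<open>The value zero outside \<open>Sn\<close> makes this a group under pointwise addition,
  with equality of functions as its equality.\<close>

definition U :: "('s \<Rightarrow> 'l) set" where
  "U = {u. (\<forall>s\<in>Sn. u s \<in> Lb s) \<and> (\<forall>s. s \<notin> Sn \<longrightarrow> u s = 0)}"

definition \<chi> :: "('s \<Rightarrow> 'l) \<Rightarrow> ('s \<Rightarrow> 'l) \<Rightarrow> real" where
  "\<chi> u \<omega> = (\<Prod>s\<in>Sn. \<beta> (u s) (\<omega> s))"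

definition supp :: "('s \<Rightarrow> 'l) \<Rightarrow> 's set" where
  "supp u = {s \<in> Sn. u s \<noteq> 0}"

definition UR :: "nat \<Rightarrow> ('s \<Rightarrow> 'l) set" where
  "UR R = {u \<in> U. card (supp u) \<le> R}"

lemma \<beta>_0: "x \<in> Q \<Longrightarrow> Sn \<noteq> {} \<Longrightarrow> \<beta> 0 x = 1"
proof -
  assume x: "x \<in> Q" and "Sn \<noteq> {}"
  then have "0 \<in> Q" using Lb_0 Lb_Q by blast
  then have "\<beta> 0 x = \<beta> 0 x * \<beta> 0 x" using \<beta>_add_left[of 0 0 x] x by simp
  then show ?thesis using \<beta>_sq[of 0 x] x \<open>0 \<in> Q\<close> by simp
qed

lemma U_Q: "u \<in> U \<Longrightarrow> s \<in> Sn \<Longrightarrow> u s \<in> Q"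
  using Lb_Q by (auto simp: U_def)

lemma U_bij: "bij_betw (\<lambda>u. restrict u Sn) U (PiE Sn Lb)"
  by (rule bij_betw_byWitness[where f' = "\<lambda>g s. if s \<in> Sn then g s else 0"])
    (auto simp: U_def fun_eq_iff restrict_def PiE_def extensional_def Lb_0)

lemma finite_U: "finite U"
  using U_bij finite_PiE[OF finite_Sn, of Lb] finite_Lb bij_betw_finite by blast

lemma finite_UR: "finite (UR R)"
  unfolding UR_def using finite_U by simp

lemma sum_U_prod: "(\<Sum>u\<in>U. \<Prod>s\<in>Sn. g s (u s)) = (\<Prod>s\<in>Sn. \<Sum>l\<in>Lb s. g s l :: real)"
proof -
  have "(\<Sum>u\<in>U. \<Prod>s\<in>Sn. g s (u s)) = (\<Sum>u\<in>U. \<Prod>s\<in>Sn. g s (restrict u Sn s))" by simp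
  also have "\<dots> = (\<Sum>u\<in>PiE Sn Lb. \<Prod>s\<in>Sn. g s (u s))"
    by (rule sum.reindex_bij_betw[OF U_bij])
  also have "\<dots> = (\<Prod>s\<in>Sn. \<Sum>l\<in>Lb s. g s l)"
    using finite_Sn finite_Lb by (intro prod_sum_PiE[symmetric]) auto
  finally show ?thesis .
qed

lemma U_add: "u \<in> U \<Longrightarrow> v \<in> U \<Longrightarrow> u + v \<in> U"
  by (auto simp: U_def Lb_add)

lemma U_0: "0 \<in> U"
  by (auto simp: U_def Lb_0)

lemma U_add_self: "u \<in> U \<Longrightarrow> u + u = 0"
  using char_2 U_Q by (fastforce simp: U_def fun_eq_iff)

lemma U_add_eq_0: "u \<in> U \<Longrightarrow> v \<in> U \<Longrightarrow> u + v = 0 \<longleftrightarrow> u = v"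
  by (metis U_add_self add_right_cancel)

lemma card_U_pos: "card U > 0"
  using finite_U U_0 card_gt_0_iff by blast

lemma \<chi>_add: "u \<in> U \<Longrightarrow> v \<in> U \<Longrightarrow> \<omega> \<in> U \<Longrightarrow> \<chi> (u + v) \<omega> = \<chi> u \<omega> * \<chi> v \<omega>"
  unfolding \<chi>_def using U_Q \<beta>_add_left by (simp add: prod.distrib[symmetric])

lemma \<chi>_0: "\<omega> \<in> U \<Longrightarrow> \<chi> 0 \<omega> = 1"
  unfolding \<chi>_def using U_Q \<beta>_0 by (intro prod.neutral) auto

lemma \<chi>_orth: "u \<in> U \<Longrightarrow> (\<Sum>\<omega>\<in>U. \<chi> u \<omega>) = of_bool (u = 0) * real (card U)"
proof -
  assume u: "u \<in> U"
  show ?thesis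
  proof (cases "u = 0")
    case True
    then show ?thesis using \<chi>_0 by simp
  next
    case False
    then obtain s where s: "u s \<noteq> 0" by (auto simp: fun_eq_iff)
    then have "s \<in> Sn" using u by (auto simp: U_def)
    moreover have "(\<Sum>l\<in>Lb s. \<beta> (u s) l) = 0" using \<beta>_nondeg[of s "u s"] s u \<open>s \<in> Sn\<close> by (auto simp: U_def)
    ultimately show ?thesis using False finite_Sn sum_U_prod[of "\<lambda>s. \<beta> (u s)"] by (auto simp: \<chi>_def prod_zero_iff)
  qed
qed

lemma supp_add: "supp (u + v) \<subseteq> supp u \<union> supp v"
  by (auto simp: supp_def)

lemma finite_supp: "finite (supp u)"
  using finite_Sn by (auto simp: supp_def)

lemma UR_add: "u \<in> UR R \<Longrightarrow> v \<in> UR R' \<Longrightarrow> u + v \<in> UR (R + R')"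
  using card_mono[OF _ supp_add[of u v]] card_Un_le[of "supp u" "supp v"] finite_supp U_add
  by (force simp: UR_def)

definition spec :: "nat \<Rightarrow> (('s \<Rightarrow> 'l) \<Rightarrow> real) \<Rightarrow> bool" where
  "spec R f \<longleftrightarrow> (\<exists>a. \<forall>\<omega>\<in>U. f \<omega> = (\<Sum>u\<in>UR R. a u * \<chi> u \<omega>))"

lemma specE:
  assumes "spec R f"
  obtains a where "\<And>\<omega>. \<omega> \<in> U \<Longrightarrow> f \<omega> = (\<Sum>u\<in>UR R. a u * \<chi> u \<omega>)"
  using assms unfolding spec_def by blast

lemma spec_\<chi>: "u \<in> UR R \<Longrightarrow> spec R (\<chi> u)"
  unfolding spec_def
  by (rule exI[of _ "\<lambda>v. of_bool (v = u)"]) (simp add: of_bool_def if_distrib[of "\<lambda>x. x * _"] finite_UR cong: if_cong)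

lemma spec_add: "spec R f \<Longrightarrow> spec R g \<Longrightarrow> spec R (\<lambda>\<omega>. f \<omega> + g \<omega>)"
  by (elim specE, unfold spec_def, rule_tac x = "\<lambda>u. a u + aa u" in exI) (simp add: distrib_right sum.distrib)

lemma spec_scale: "spec R f \<Longrightarrow> spec R (\<lambda>\<omega>. c * f \<omega>)"
  by (elim specE, unfold spec_def, rule_tac x = "\<lambda>u. c * a u" in exI) (simp add: sum_distrib_left mult.assoc)

lemma spec_zero: "spec R (\<lambda>_. 0)"
  unfolding spec_def by (rule exI[of _ "\<lambda>_. 0"]) simp

lemma spec_sum: "(\<And>i. i \<in> I \<Longrightarrow> spec R (f i)) \<Longrightarrow> spec R (\<lambda>\<omega>. \<Sum>i\<in>I. f i \<omega>)"
  by (induction I rule: infinite_finite_induct) (auto simp: spec_zero spec_add)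

lemma spec_cong: "spec R f \<Longrightarrow> (\<And>\<omega>. \<omega> \<in> U \<Longrightarrow> g \<omega> = f \<omega>) \<Longrightarrow> spec R g"
  unfolding spec_def by simp

definition point :: "'s \<Rightarrow> 'l \<Rightarrow> 's \<Rightarrow> 'l" where
  "point s l = (\<lambda>s'. if s' = s then l else 0)"

lemma point_UR: "s \<in> Sn \<Longrightarrow> l \<in> Lb s \<Longrightarrow> point s l \<in> UR 1"
proof -
  assume a: "s \<in> Sn" "l \<in> Lb s"
  have "card (supp (point s l)) \<le> card {s}" by (rule card_mono) (auto simp: supp_def point_def)
  then show ?thesis using a Lb_0 by (auto simp: UR_def U_def point_def)
qed

lemma \<chi>_point: "s \<in> Sn \<Longrightarrow> l \<in> Lb s \<Longrightarrow> \<omega> \<in> U \<Longrightarrow> \<chi> (point s l) \<omega> = \<beta> l (\<omega> s)"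
proof -
  assume a: "s \<in> Sn" "l \<in> Lb s" "\<omega> \<in> U"
  have "\<chi> (point s l) \<omega> = (\<Prod>s'\<in>Sn. if s' = s then \<beta> l (\<omega> s) else 1)"
    unfolding \<chi>_def point_def using a U_Q \<beta>_0 by (intro prod.cong) auto
  then show ?thesis using a finite_Sn by simp
qed

text \<open>Fourier inversion on \<open>Lb s\<close>: averaging all characters at
  \<open>\<omega> s + l\<close> detects whether this sum is zero, which in characteristic two means
  \<open>\<omega> s = l\<close>.\<close>

lemma indicator_expansion:
  assumes "s \<in> Sn" "l \<in> Lb s" "\<omega> \<in> U"
  shows "of_bool (\<omega> s = l) = (\<Sum>\<tau>\<in>Lb s. (\<beta> \<tau> l / real (card (Lb s))) * \<chi> (point s \<tau>) \<omega>)"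
proof -
  have ws: "\<omega> s \<in> Lb s" using assms by (auto simp: U_def)
  have Q: "\<omega> s \<in> Q" "l \<in> Q" using ws assms Lb_Q by auto
  have sum_in: "\<omega> s + l \<in> Lb s" using Lb_add assms ws by auto
  have eq0: "\<omega> s + l = 0 \<longleftrightarrow> \<omega> s = l" using char_2[OF Q(2)] by (metis add_right_cancel)
  have "(\<Sum>\<tau>\<in>Lb s. (\<beta> \<tau> l / real (card (Lb s))) * \<chi> (point s \<tau>) \<omega>) = (\<Sum>\<tau>\<in>Lb s. \<beta> (\<omega> s + l) \<tau>) / real (card (Lb s))"
    unfolding sum_divide_distrib
  proof (rule sum.cong)
    fix \<tau> assume t: "\<tau> \<in> Lb s"
    then have "\<tau> \<in> Q" using Lb_Q assms by auto
    then have "\<beta> (\<omega> s + l) \<tau> = \<beta> \<tau> (\<omega> s) * \<beta> \<tau> l" using \<beta>_add_left Q \<beta>_sym by simp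
    then show "\<beta> \<tau> l / real (card (Lb s)) * \<chi> (point s \<tau>) \<omega> = \<beta> (\<omega> s + l) \<tau> / real (card (Lb s))"
      using \<chi>_point assms t by simp
  qed simp
  also have "\<dots> = of_bool (\<omega> s = l)"
  proof (cases "\<omega> s = l")
    case True
    have "(\<Sum>\<tau>\<in>Lb s. \<beta> (\<omega> s + l) \<tau>) = (\<Sum>\<tau>\<in>Lb s. 1)"
      using True eq0 \<beta>_0 Lb_Q assms by (intro sum.cong) auto
    moreover have "card (Lb s) > 0" using finite_Lb assms card_gt_0_iff by blast
    ultimately show ?thesis using True by simp
  next
    case False
    then show ?thesis using \<beta>_nondeg[OF assms(1) sum_in] eq0 by simp
  qed
  finally show ?thesis by simp
qed

lemma spec_mult_\<chi>:
  assumes "spec R f" "v \<in> UR R'"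
  shows "spec (R + R') (\<lambda>\<omega>. \<chi> v \<omega> * f \<omega>)"
proof -
  obtain a where a: "\<And>\<omega>. \<omega> \<in> U \<Longrightarrow> f \<omega> = (\<Sum>u\<in>UR R. a u * \<chi> u \<omega>)" using specE[OF assms(1)] by blast
  have "spec (R + R') (\<lambda>\<omega>. \<Sum>u\<in>UR R. a u * \<chi> (u + v) \<omega>)"
    using UR_add assms(2) by (intro spec_sum spec_scale spec_\<chi>) auto
  then show ?thesis
  proof (rule spec_cong)
    fix \<omega> assume w: "\<omega> \<in> U"
    show "\<chi> v \<omega> * f \<omega> = (\<Sum>u\<in>UR R. a u * \<chi> (u + v) \<omega>)"
      unfolding a[OF w] sum_distrib_left using w assms(2) by (intro sum.cong) (auto simp: \<chi>_add UR_def)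
  qed
qed

text \<open>An indicator expands into characters supported on a single supernode, so each label that
  is read raises the degree by at most one.\<close>

lemma local_fun_spec: "local_fun Sn Lb R f \<Longrightarrow> spec R f"
proof (induction rule: local_fun.induct)
  case (one R)
  have "0 \<in> UR R" by (simp add: UR_def U_0 supp_def)
  from spec_\<chi>[OF this] show ?case by (rule spec_cong) (simp add: \<chi>_0)
next
  case (ind R f s l)
  have "spec (R + 1) (\<lambda>\<omega>. \<Sum>\<tau>\<in>Lb s. (\<beta> \<tau> l / real (card (Lb s))) * (\<chi> (point s \<tau>) \<omega> * f \<omega>))"
    using ind point_UR by (intro spec_sum spec_scale spec_mult_\<chi>) auto
  then have "spec (R + 1) (\<lambda>\<omega>. of_bool (\<omega> s = l) * f \<omega>)"
    by (rule spec_cong) (use ind in \<open>simp add: indicator_expansion sum_distrib_right mult.assoc\<close>)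
  then show ?case by simp
qed (auto intro: spec_add spec_scale)

end

text \<open>\<open>lam\<close> prescribes the Fourier coefficients, and \<open>\<mu>\<close> below
  is the inverse transform, a signed measure of total mass 1. Positivity on squares of degree
  \<open>R\<close> is the matrix \<open>lam (u + v)\<close> being positive semidefinite, for which
  \<open>lam_cocycle\<close> is the partial cocycle condition.\<close>

locale pseudo_density = char_space +
  fixes lam :: "('a \<Rightarrow> 'b) \<Rightarrow> real" and R :: nat
  assumes lam_0: "lam 0 = 1"
    and lam_cocycle: "u \<in> UR R \<Longrightarrow> v \<in> UR R \<Longrightarrow> w \<in> UR R \<Longrightarrow> lam (u + v) \<noteq> 0 \<Longrightarrow> lam (v + w) \<noteq> 0 \<Longrightarrow>
      lam (u + w) = lam (u + v) * lam (v + w)"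
begin

definition \<mu> :: "('a \<Rightarrow> 'b) \<Rightarrow> real" where
  "\<mu> \<omega> = (\<Sum>u\<in>U. lam u * \<chi> u \<omega>) / real (card U)"

definition L :: "(('a \<Rightarrow> 'b) \<Rightarrow> real) \<Rightarrow> real" where
  "L f = (\<Sum>\<omega>\<in>U. \<mu> \<omega> * f \<omega>)"

lemma L_\<chi>:
  assumes "v \<in> U"
  shows "L (\<chi> v) = lam v"
proof -
  have "L (\<chi> v) = (\<Sum>\<omega>\<in>U. (\<Sum>u\<in>U. lam u * \<chi> (u + v) \<omega>) / real (card U))"
    unfolding L_def \<mu>_def by (intro sum.cong refl) (simp add: \<chi>_add assms sum_distrib_right mult.assoc)
  also have "\<dots> = (\<Sum>u\<in>U. lam u * (\<Sum>\<omega>\<in>U. \<chi> (u + v) \<omega>)) / real (card U)"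
  proof -
    have "(\<Sum>\<omega>\<in>U. \<Sum>u\<in>U. lam u * \<chi> (u + v) \<omega>) = (\<Sum>u\<in>U. \<Sum>\<omega>\<in>U. lam u * \<chi> (u + v) \<omega>)" by (rule sum.swap)
    then show ?thesis by (simp only: sum_divide_distrib[symmetric] sum_distrib_left)
  qed
  also have "(\<Sum>u\<in>U. lam u * (\<Sum>\<omega>\<in>U. \<chi> (u + v) \<omega>)) = (\<Sum>u\<in>U. if u = v then lam v * real (card U) else 0)"
    using assms by (intro sum.cong refl) (simp add: \<chi>_orth U_add U_add_eq_0)
  also have "\<dots> = lam v * real (card U)" using assms finite_U by simp
  finally show ?thesis using card_U_pos by simp
qed

lemma L_spec:
  assumes "\<And>\<omega>. \<omega> \<in> U \<Longrightarrow> f \<omega> = (\<Sum>i\<in>I. a i * \<chi> (g i) \<omega>)" "\<And>i. i \<in> I \<Longrightarrow> g i \<in> U"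
  shows "L f = (\<Sum>i\<in>I. a i * lam (g i))"
proof -
  have "L f = (\<Sum>\<omega>\<in>U. \<Sum>i\<in>I. a i * (\<mu> \<omega> * \<chi> (g i) \<omega>))"
    unfolding L_def using assms(1) by (intro sum.cong refl) (simp add: sum_distrib_left mult.left_commute)
  also have "\<dots> = (\<Sum>i\<in>I. a i * L (\<chi> (g i)))"
    unfolding L_def sum_distrib_left by (rule sum.swap)
  finally show ?thesis using assms(2) L_\<chi> by simp
qed

lemma total_mass: "(\<Sum>\<omega>\<in>U. \<mu> \<omega>) = 1"
  using L_\<chi>[OF U_0] lam_0 by (simp add: L_def \<chi>_0)

lemma L_square_nonneg:
  assumes "spec R f"
  shows "0 \<le> L (\<lambda>\<omega>. (f \<omega>)\<^sup>2)"
proof -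
  obtain a where a: "\<And>\<omega>. \<omega> \<in> U \<Longrightarrow> f \<omega> = (\<Sum>u\<in>UR R. a u * \<chi> u \<omega>)" using specE[OF assms] by blast
  have sub: "u \<in> U" if "u \<in> UR R" for u using that by (simp add: UR_def)
  have "L (\<lambda>\<omega>. (f \<omega>)\<^sup>2) = (\<Sum>i\<in>UR R \<times> UR R. (a (fst i) * a (snd i)) * lam (fst i + snd i))"
  proof (rule L_spec)
    fix \<omega> assume w: "\<omega> \<in> U"
    have "(f \<omega>)\<^sup>2 = (\<Sum>u\<in>UR R. \<Sum>v\<in>UR R. (a u * a v) * \<chi> (u + v) \<omega>)"
      unfolding a[OF w] power2_eq_square sum_product using sub w by (intro sum.cong refl) (simp add: \<chi>_add)
    then show "(f \<omega>)\<^sup>2 = (\<Sum>i\<in>UR R \<times> UR R. (a (fst i) * a (snd i)) * \<chi> (fst i + snd i) \<omega>)"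
      by (simp add: sum.cartesian_product case_prod_unfold)
  qed (use sub U_add in fastforce)
  also have "\<dots> = (\<Sum>u\<in>UR R. \<Sum>v\<in>UR R. a u * a v * lam (u + v))"
    by (simp add: sum.cartesian_product case_prod_unfold)
  also have "\<dots> \<ge> 0"
  proof (rule psd_of_partial_cocycle[OF finite_UR])
    show "lam (u + u) = 1" if "u \<in> UR R" for u using U_add_self[OF sub[OF that]] lam_0 by simp
    show "lam (u + v) = lam (v + u)" for u v by (simp add: add.commute)
  qed (rule lam_cocycle)
  finally show ?thesis .
qed

text \<open>By \<open>shift\<close>, multiplication by the character of \<open>d\<close> scales
  \<open>L g\<close> by \<open>\<kappa>\<close>; by \<open>const\<close> it also scales it by
  \<open>- \<kappa>\<close>.\<close>

lemma L_kills:
  assumes g: "spec R g" and d: "d \<in> U"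
    and shift: "\<And>u. u \<in> UR R \<Longrightarrow> lam (u + d) = \<kappa> * lam u"
    and const: "\<And>\<omega>. \<omega> \<in> U \<Longrightarrow> g \<omega> \<noteq> 0 \<Longrightarrow> \<chi> d \<omega> = - \<kappa>" and \<kappa>: "\<kappa> \<noteq> 0"
  shows "L g = 0"
proof -
  obtain a where a: "\<And>\<omega>. \<omega> \<in> U \<Longrightarrow> g \<omega> = (\<Sum>u\<in>UR R. a u * \<chi> u \<omega>)" using specE[OF g] by blast
  have sub: "u \<in> U" if "u \<in> UR R" for u using that by (simp add: UR_def)
  have "L (\<lambda>\<omega>. \<chi> d \<omega> * g \<omega>) = (\<Sum>u\<in>UR R. a u * lam (u + d))"
  proof (rule L_spec)
    fix \<omega> assume w: "\<omega> \<in> U"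
    show "\<chi> d \<omega> * g \<omega> = (\<Sum>u\<in>UR R. a u * \<chi> (u + d) \<omega>)"
      unfolding a[OF w] sum_distrib_left using sub w d by (intro sum.cong refl) (simp add: \<chi>_add)
  qed (auto intro: U_add sub d)
  also have "\<dots> = \<kappa> * (\<Sum>u\<in>UR R. a u * lam u)"
    unfolding sum_distrib_left using shift by (intro sum.cong refl) simp
  also have "(\<Sum>u\<in>UR R. a u * lam u) = L g"
    using a sub by (intro L_spec[symmetric]) auto
  finally have "L (\<lambda>\<omega>. \<chi> d \<omega> * g \<omega>) = \<kappa> * L g" .
  moreover have "L (\<lambda>\<omega>. \<chi> d \<omega> * g \<omega>) = - \<kappa> * L g"
    unfolding L_def sum_distrib_left using const by (intro sum.cong refl) (metis mult.left_commute mult_zero_right)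
  ultimately show ?thesis using \<kappa> by simp
qed

end

text \<open>
  An element \<open>t\<close> of \<open>T\<close> is a linear combination of constraints: it derives the character \<open>bd t\<close>, whose value on
  every solution is \<open>\<rho> t\<close>, and \<open>sz t\<close> counts the clauses involved. The gap between \<open>W0\<close> and \<open>W\<close> in \<open>shrink\<close> is what
  makes derivability transitive.
\<close>

locale derivation_system = char_space +
  fixes T :: "'t :: ab_group_add set" and bd :: "'t \<Rightarrow> 'a \<Rightarrow> 'b" and sz :: "'t \<Rightarrow> nat" and \<rho> :: "'t \<Rightarrow> real"
    and R W W0 :: nat
  assumes T_0: "0 \<in> T" and T_add: "t \<in> T \<Longrightarrow> t' \<in> T \<Longrightarrow> t + t' \<in> T" and T_char2: "t \<in> T \<Longrightarrow> t + t = 0"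
    and bd_U: "t \<in> T \<Longrightarrow> bd t \<in> U"
    and bd_add: "t \<in> T \<Longrightarrow> t' \<in> T \<Longrightarrow> bd (t + t') = bd t + bd t'"
    and sz_0: "sz 0 = 0" and sz_add: "t \<in> T \<Longrightarrow> t' \<in> T \<Longrightarrow> sz (t + t') \<le> sz t + sz t'"
    and \<rho>_add: "t \<in> T \<Longrightarrow> t' \<in> T \<Longrightarrow> \<rho> (t + t') = \<rho> t * \<rho> t'"
    and \<rho>_sq: "t \<in> T \<Longrightarrow> \<rho> t * \<rho> t = 1"
    and kernel: "t \<in> T \<Longrightarrow> sz t \<le> W \<Longrightarrow> bd t = 0 \<Longrightarrow> t = 0"
    and shrink: "t \<in> T \<Longrightarrow> sz t \<le> W \<Longrightarrow> card (supp (bd t)) \<le> 2 * R + 2 \<Longrightarrow> sz t \<le> W0"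
    and W0: "2 * W0 + 1 \<le> W"
begin

definition derivable :: "('a \<Rightarrow> 'b) \<Rightarrow> bool" where
  "derivable u \<longleftrightarrow> (\<exists>t\<in>T. sz t \<le> W0 \<and> bd t = u)"

definition lam :: "('a \<Rightarrow> 'b) \<Rightarrow> real" where
  "lam u = (if derivable u then \<rho> (SOME t. t \<in> T \<and> sz t \<le> W0 \<and> bd t = u) else 0)"

text \<open>The choice in \<open>lam\<close> is immaterial: two short derivations of the same
  character add up to one of size at most \<open>2 * W0\<close> without boundary, which
  \<open>kernel\<close> forces to be zero.\<close>

lemma lam_bd: "t \<in> T \<Longrightarrow> sz t \<le> W0 \<Longrightarrow> lam (bd t) = \<rho> t"
proof -
  assume t: "t \<in> T" "sz t \<le> W0"
  define t' where "t' = (SOME t'. t' \<in> T \<and> sz t' \<le> W0 \<and> bd t' = bd t)"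
  have t': "t' \<in> T" "sz t' \<le> W0" "bd t' = bd t"
    using someI[of "\<lambda>t'. t' \<in> T \<and> sz t' \<le> W0 \<and> bd t' = bd t" t] t by (auto simp: t'_def)
  have "bd (t + t') = 0" using bd_add t t' U_add_self bd_U by simp
  then have "t + t' = 0" using kernel[of "t + t'"] T_add sz_add[of t t'] t t' W0 by auto
  then have "t = t'" using T_char2[OF t'(1)] by (metis add_right_cancel)
  moreover have "derivable (bd t)" using t by (auto simp: derivable_def)
  then have "lam (bd t) = \<rho> t'" by (simp add: lam_def t'_def)
  ultimately show ?thesis by simp
qed

lemma lam_nonzero: "lam u \<noteq> 0 \<Longrightarrow> \<exists>t\<in>T. sz t \<le> W0 \<and> bd t = u"
  by (auto simp: lam_def derivable_def split: if_splits)

lemma \<rho>_0: "\<rho> 0 = 1"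
  using \<rho>_add[OF T_0 T_0] \<rho>_sq[OF T_0] by simp

lemma bd_0: "bd 0 = 0"
  using bd_add[OF T_0 T_0] by simp

text \<open>Adding one clause keeps the size below \<open>W\<close> and the support below
  \<open>2 * R + 2\<close>, so \<open>shrink\<close> returns it below \<open>W0\<close>, in either
  direction. The summand 1 in \<open>W0\<close> leaves room for the extra clause even if the
  threshold is zero.\<close>

lemma lam_add_bd:
  assumes u: "u \<in> UR R" and t: "t \<in> T" "sz t \<le> 1" "card (supp (bd t)) \<le> 2"
  shows "lam (u + bd t) = \<rho> t * lam u"
proof -
  have uU: "u \<in> U" using u by (simp add: UR_def)
  have key: "\<exists>t''\<in>T. sz t'' \<le> W0 \<and> bd t'' = v + bd t \<and> \<rho> t'' = \<rho> t' * \<rho> t"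
    if "t' \<in> T" "sz t' \<le> W0" "bd t' = v" "card (supp (v + bd t)) \<le> 2 * R + 2" for t' v
  proof -
    have "sz (t' + t) \<le> W0"
      using shrink[of "t' + t"] T_add sz_add[of t' t] t that W0 bd_add by auto
    then show ?thesis using that t T_add bd_add \<rho>_add by (intro bexI[of _ "t' + t"]) auto
  qed
  have "u + bd t \<in> UR (R + 2)" using UR_add[OF u, of "bd t" 2] t bd_U by (auto simp: UR_def)
  then have c1: "card (supp (u + bd t)) \<le> 2 * R + 2" by (simp add: UR_def)
  have c2: "card (supp (u + bd t + bd t)) \<le> 2 * R + 2"
    using U_add_self[OF bd_U[OF t(1)]] u by (simp add: add.assoc UR_def)
  show ?thesis
  proof (cases "lam u = 0")
    case True
    have "lam (u + bd t) = 0"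
    proof (rule ccontr)
      assume "lam (u + bd t) \<noteq> 0"
      then obtain t' where "t' \<in> T" "sz t' \<le> W0" "bd t' = u + bd t" using lam_nonzero by blast
      then obtain t'' where t'': "t'' \<in> T" "sz t'' \<le> W0" "bd t'' = u + bd t + bd t" using key c2 by blast
      then have "bd t'' = u" using U_add_self[OF bd_U[OF t(1)]] by (simp add: add.assoc)
      then have "lam u = \<rho> t''" using lam_bd t'' by blast
      then show False using True \<rho>_sq[OF t''(1)] by simp
    qed
    then show ?thesis using True by simp
  next
    case False
    then obtain t' where t': "t' \<in> T" "sz t' \<le> W0" "bd t' = u" using lam_nonzero by blast
    then obtain t'' where "t'' \<in> T" "sz t'' \<le> W0" "bd t'' = u + bd t" "\<rho> t'' = \<rho> t' * \<rho> t" using key c1 by blast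
    then show ?thesis using lam_bd t' by (metis mult.commute)
  qed
qed

sublocale pseudo_density Sn Lb Q \<beta> lam R
proof
  show "lam 0 = 1" using lam_bd[OF T_0] sz_0 \<rho>_0 bd_0 by simp
  fix u v w assume uvw: "u \<in> UR R" "v \<in> UR R" "w \<in> UR R" "lam (u + v) \<noteq> 0" "lam (v + w) \<noteq> 0"
  obtain t where t: "t \<in> T" "sz t \<le> W0" "bd t = u + v" using lam_nonzero uvw by blast
  obtain t' where t': "t' \<in> T" "sz t' \<le> W0" "bd t' = v + w" using lam_nonzero uvw by blast
  have vU: "v \<in> U" using uvw by (simp add: UR_def)
  have "bd (t + t') = u + w"
    using bd_add t t' U_add_self[OF vU] by (metis add.assoc add.left_neutral)
  moreover have "card (supp (u + w)) \<le> 2 * R + 2" using UR_add[OF uvw(1,3)] by (simp add: UR_def)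
  ultimately have "sz (t + t') \<le> W0" using shrink[of "t + t'"] T_add t t' sz_add[of t t'] W0 by auto
  then show "lam (u + w) = lam (u + v) * lam (v + w)"
    using lam_bd T_add t t' \<rho>_add \<open>bd (t + t') = u + w\<close> by metis
qed

end

section \<open>Linear constraints over a field of characteristic two\<close>

text \<open>A finite subring of a field, hence itself a field, with a nontrivial additive character.
  It is a subset of an ambient field because its order varies with the instance.\<close>

locale binary_field =
  fixes F :: "'f :: field set" and \<psi> :: "'f \<Rightarrow> real"
  assumes finite_F: "finite F" and F_0: "0 \<in> F" and F_1: "1 \<in> F"
    and F_add: "x \<in> F \<Longrightarrow> y \<in> F \<Longrightarrow> x + y \<in> F" and F_mult: "x \<in> F \<Longrightarrow> y \<in> F \<Longrightarrow> x * y \<in> F"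
    and F_char2: "x + x = (0 :: 'f)"
    and \<psi>_add: "x \<in> F \<Longrightarrow> y \<in> F \<Longrightarrow> \<psi> (x + y) = \<psi> x * \<psi> y"
    and \<psi>_sq: "x \<in> F \<Longrightarrow> \<psi> x * \<psi> x = 1"
    and \<psi>_nontrivial: "\<exists>x\<in>F. \<psi> x = - 1"
begin

lemma add_eq_0: "x + y = 0 \<longleftrightarrow> x = (y :: 'f)"
  by (metis F_char2 add_right_cancel)

text \<open>Multiplication by a nonzero element permutes the finite set \<open>F\<close>, so some
  multiple hits the element where \<open>\<psi>\<close> is -1.\<close>

lemma \<psi>_separates:
  assumes "x \<in> F" "x \<noteq> 0"
  shows "\<exists>\<tau>\<in>F. \<psi> (\<tau> * x) = - 1"
proof -
  have "inj_on (\<lambda>\<tau>. \<tau> * x) F" using assms by (auto simp: inj_on_def)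
  moreover have "(\<lambda>\<tau>. \<tau> * x) ` F \<subseteq> F" using assms F_mult by auto
  ultimately have "(\<lambda>\<tau>. \<tau> * x) ` F = F" using finite_F by (simp add: endo_inj_surj)
  then show ?thesis using \<psi>_nontrivial by (metis imageE)
qed

lemma F_sum: "(\<And>i. i \<in> I \<Longrightarrow> g i \<in> F) \<Longrightarrow> sum g I \<in> F"
  by (induction I rule: infinite_finite_induct) (auto simp: F_0 F_add)

definition \<beta> :: "'f \<times> 'f \<Rightarrow> 'f \<times> 'f \<Rightarrow> real" where
  "\<beta> x y = \<psi> (fst x * fst y + snd x * snd y)"

lemma \<beta>_sum_zero:
  assumes sub: "A \<subseteq> F \<times> F" and add: "\<And>x y. x \<in> A \<Longrightarrow> y \<in> A \<Longrightarrow> x + y \<in> A"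
    and x: "x \<in> F \<times> F" and \<tau>: "\<tau> \<in> A" "\<beta> x \<tau> = - 1"
  shows "(\<Sum>l\<in>A. \<beta> x l) = 0"
proof -
  have inv: "l + \<tau> + \<tau> = l" for l by (simp add: prod_eq_iff add.assoc F_char2)
  have "bij_betw (\<lambda>l. l + \<tau>) A A"
    by (rule bij_betw_byWitness[where f' = "\<lambda>l. l + \<tau>"]) (use inv add \<tau>(1) in \<open>simp_all add: image_subset_iff del: split_paired_All\<close>)
  then have "(\<Sum>l\<in>A. \<beta> x l) = (\<Sum>l\<in>A. \<beta> x (l + \<tau>))" by (rule sum.reindex_bij_betw[symmetric])
  also have "\<dots> = (\<Sum>l\<in>A. - \<beta> x l)"
  proof (rule sum.cong)
    fix l assume l: "l \<in> A"
    have "\<beta> x (l + \<tau>) = \<psi> ((fst x * fst l + snd x * snd l) + (fst x * fst \<tau> + snd x * snd \<tau>))"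
      by (simp add: \<beta>_def distrib_left add_ac)
    also have "\<dots> = \<beta> x l * \<beta> x \<tau>"
      unfolding \<beta>_def using l \<tau> x sub by (intro \<psi>_add) (auto intro!: F_add F_mult)
    finally show "\<beta> x (l + \<tau>) = - \<beta> x l" using \<tau> by simp
  qed simp
  finally show ?thesis by (simp add: sum_negf)
qed

end

section \<open>The constraint system and the boundaries of its derivations\<close>

datatype node = Cl nat | Va nat nat

text \<open>A clause label \<open>(x, y)\<close> is the linear polynomial with these coefficients,
  read at the distinct points \<open>\<theta> i\<close>: a Reed-Solomon code of dimension two, up to
  the shifts \<open>c\<close>. Variable labels are padded with a zero so that both kinds live in
  \<open>F \<times> F\<close>.\<close>

locale linear_csp = binary_field F \<psi> for F :: "'f :: field set" and \<psi> +
  fixes M K N :: nat and h :: "nat \<Rightarrow> nat \<Rightarrow> nat" and \<theta> :: "nat \<Rightarrow> 'f" and c :: "nat \<Rightarrow> nat \<Rightarrow> 'f" and W D R :: nat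
  assumes h_less: "a < M \<Longrightarrow> i < K \<Longrightarrow> h a i < N"
    and \<theta>_F: "i < K \<Longrightarrow> \<theta> i \<in> F" and \<theta>_inj: "inj_on \<theta> {..<K}"
    and c_F: "a < M \<Longrightarrow> i < K \<Longrightarrow> c a i \<in> F"
    and expansion: "A \<subseteq> {..<M} \<Longrightarrow> A \<noteq> {} \<Longrightarrow> card A \<le> W \<Longrightarrow>
      2 * D * K * card A + card A < 3 * D * card A + 2 * D * card ((\<lambda>(a, i). (i, h a i)) ` (A \<times> {..<K}))"
    and W_large: "8 * D * (R + 1) + 1 \<le> W"
begin

definition Sn :: "node set" where
  "Sn = Cl ` {..<M} \<union> (\<lambda>(i, j). Va i j) ` ({..<K} \<times> {..<N})"

definition Lb :: "node \<Rightarrow> ('f \<times> 'f) set" where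
  "Lb s = (case s of Cl a \<Rightarrow> F \<times> F | Va i j \<Rightarrow> F \<times> {0})"

definition Rel :: "node \<Rightarrow> node \<Rightarrow> (('f \<times> 'f) \<times> ('f \<times> 'f)) set" where
  "Rel s s' = (case (s, s') of (Cl a, Va i j) \<Rightarrow>
     (\<lambda>(x, y). ((x, y), (x + \<theta> i * y + c a i, 0))) ` (F \<times> F) | _ \<Rightarrow> {})"

lemma finite_Sn: "finite Sn"
  by (simp add: Sn_def)

lemma Lb_sub: "Lb s \<subseteq> F \<times> F"
  by (auto simp: Lb_def F_0 split: node.splits)

lemma Lb_add: "x \<in> Lb s \<Longrightarrow> y \<in> Lb s \<Longrightarrow> x + y \<in> Lb s"
  by (auto simp: Lb_def F_add plus_prod_def split: node.splits)

sublocale char_space Sn Lb "F \<times> F" \<beta>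
proof
  show "finite Sn" by (rule finite_Sn)
  show "finite (Lb s)" for s using finite_subset[OF Lb_sub] finite_F by auto
  show "0 \<in> Lb s" for s by (auto simp: Lb_def F_0 zero_prod_def split: node.splits)
  show "x + y \<in> Lb s" if "x \<in> Lb s" "y \<in> Lb s" for x y s using Lb_add that .
  show "Lb s \<subseteq> F \<times> F" for s by (rule Lb_sub)
  show "x + x = 0" for x :: "'f \<times> 'f" by (simp add: prod_eq_iff F_char2)
  fix x y z assume xyz: "x \<in> F \<times> F" "y \<in> F \<times> F"
  have inF: "fst u * fst v + snd u * snd v \<in> F" if "u \<in> F \<times> F" "v \<in> F \<times> F" for u v
    using that by (auto intro!: F_add F_mult)
  show "\<beta> x y * \<beta> x y = 1" unfolding \<beta>_def by (rule \<psi>_sq[OF inF[OF xyz]])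
  show "\<beta> x y = \<beta> y x" by (simp add: \<beta>_def mult.commute)
  assume z: "z \<in> F \<times> F"
  have "\<beta> (x + y) z = \<psi> ((fst x * fst z + snd x * snd z) + (fst y * fst z + snd y * snd z))"
    by (simp add: \<beta>_def distrib_right add_ac)
  then show "\<beta> (x + y) z = \<beta> x z * \<beta> y z" using \<psi>_add[OF inF[OF xyz(1) z] inF[OF xyz(2) z]] by (simp add: \<beta>_def)
  have "\<beta> z (x + y) = \<psi> ((fst z * fst x + snd z * snd x) + (fst z * fst y + snd z * snd y))"
    by (simp add: \<beta>_def distrib_left add_ac)
  then show "\<beta> z (x + y) = \<beta> z x * \<beta> z y" using \<psi>_add[OF inF[OF z xyz(1)] inF[OF z xyz(2)]] by (simp add: \<beta>_def)
next
  fix s x assume "s \<in> Sn" and x: "x \<in> Lb s" "x \<noteq> 0"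
  have xF: "x \<in> F \<times> F" using Lb_sub x by auto
  have "\<exists>\<tau>\<in>Lb s. \<beta> x \<tau> = - 1"
  proof (cases "fst x = 0")
    case False
    then obtain t where "t \<in> F" "\<psi> (t * fst x) = - 1" using \<psi>_separates[of "fst x"] xF by (auto simp: mem_Times_iff)
    then show ?thesis by (intro bexI[of _ "(t, 0)"]) (auto simp: \<beta>_def mult.commute Lb_def F_0 split: node.splits)
  next
    case True
    then have n: "snd x \<noteq> 0" using x by (auto simp: prod_eq_iff)
    then obtain t where "t \<in> F" "\<psi> (t * snd x) = - 1" using \<psi>_separates[of "snd x"] xF by (auto simp: mem_Times_iff)
    then show ?thesis using n x by (intro bexI[of _ "(0, t)"]) (auto simp: \<beta>_def mult.commute Lb_def F_0 split: node.splits)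
  qed
  then show "(\<Sum>l\<in>Lb s. \<beta> x l) = 0" using \<beta>_sum_zero[OF Lb_sub Lb_add xF] by blast
qed

text \<open>\<open>t a i\<close> is the coefficient of the equation linking clause \<open>a\<close>
  to its \<open>i\<close>-th variable; \<open>bd t\<close> collects the resulting coefficients of
  the clause labels and of the variables.\<close>

definition T :: "(nat \<Rightarrow> nat \<Rightarrow> 'f) set" where
  "T = {t. (\<forall>a i. t a i \<in> F) \<and> (\<forall>a i. \<not> (a < M \<and> i < K) \<longrightarrow> t a i = 0)}"

definition bd :: "(nat \<Rightarrow> nat \<Rightarrow> 'f) \<Rightarrow> node \<Rightarrow> 'f \<times> 'f" where
  "bd t s = (case s of Cl a \<Rightarrow> (\<Sum>i<K. t a i, \<Sum>i<K. \<theta> i * t a i)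
     | Va i j \<Rightarrow> (\<Sum>a | a < M \<and> h a i = j. t a i, 0))"

definition csupp :: "(nat \<Rightarrow> nat \<Rightarrow> 'f) \<Rightarrow> nat set" where
  "csupp t = {a. \<exists>i. t a i \<noteq> 0}"

definition \<rho> :: "(nat \<Rightarrow> nat \<Rightarrow> 'f) \<Rightarrow> real" where
  "\<rho> t = \<psi> (\<Sum>a<M. \<Sum>i<K. t a i * c a i)"

lemma csupp_sub: "t \<in> T \<Longrightarrow> csupp t \<subseteq> {..<M}"
  by (auto simp: T_def csupp_def)

text \<open>The vectors \<open>(1, \<theta> i)\<close> are pairwise independent, so a nontrivial
  linear relation among them has at least three terms.\<close>

lemma row_support:
  assumes t: "t \<in> T" and a: "a \<in> csupp t" and z: "bd t (Cl a) = 0"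
  shows "3 \<le> card {i. t a i \<noteq> 0}"
proof (rule ccontr)
  let ?I = "{i. t a i \<noteq> 0}"
  assume "\<not> 3 \<le> card ?I"
  have sub: "?I \<subseteq> {..<K}" using t by (auto simp: T_def)
  then have fin: "finite ?I" using finite_subset by blast
  have "?I \<noteq> {}" using a by (auto simp: csupp_def)
  then have "card ?I > 0" using fin card_gt_0_iff by blast
  then have "card ?I = 1 \<or> card ?I = 2" using \<open>\<not> 3 \<le> card ?I\<close> by linarith
  have s1: "(\<Sum>i\<in>?I. t a i) = 0" and s2: "(\<Sum>i\<in>?I. \<theta> i * t a i) = 0"
  proof -
    have "(\<Sum>i\<in>?I. t a i) = (\<Sum>i<K. t a i)" "(\<Sum>i\<in>?I. \<theta> i * t a i) = (\<Sum>i<K. \<theta> i * t a i)"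
      using sub by (intro sum.mono_neutral_left; auto)+
    then show "(\<Sum>i\<in>?I. t a i) = 0" "(\<Sum>i\<in>?I. \<theta> i * t a i) = 0" using z by (auto simp: bd_def zero_prod_def)
  qed
  from \<open>card ?I = 1 \<or> card ?I = 2\<close> show False
  proof
    assume "card ?I = 1"
    then obtain i where i: "?I = {i}" by (auto simp: card_1_singleton_iff)
    then show False using s1 by auto
  next
    assume "card ?I = 2"
    then obtain i j where ij: "?I = {i, j}" "i \<noteq> j" by (auto simp: card_2_iff)
    then have n: "t a i \<noteq> 0" "i < K" "j < K" using sub by auto
    have "t a i = t a j" using s1 ij by (simp add: add_eq_0)
    then have "(\<theta> i + \<theta> j) * t a i = 0" using s2 ij by (simp add: distrib_right)
    then have "\<theta> i = \<theta> j" using n by (simp add: add_eq_0)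
    then show False using \<theta>_inj n ij by (auto dest: inj_onD)
  qed
qed

text \<open>
  Double counting: the support of \<open>t\<close> has at least three entries in each row and at least two over each variable, except
  where the boundary of \<open>t\<close> does not vanish, so a large \<open>csupp t\<close> with small boundary would violate the expansion.
\<close>

lemma support_bound:
  assumes t: "t \<in> T" and ne: "csupp t \<noteq> {}" and le: "card (csupp t) \<le> W"
  shows "card (csupp t) < 2 * D * card (supp (bd t))"
proof -
  let ?A = "csupp t" and ?B = "supp (bd t)"
  define p where "p = (\<lambda>(a, i). (i, h a i))"
  define S where "S = {(a, i). t a i \<noteq> 0}"
  define A0 where "A0 = {a \<in> ?A. Cl a \<in> ?B}"
  define B0 where "B0 = {(i, j). Va i j \<in> ?B}"
  have A: "?A \<subseteq> {..<M}" using csupp_sub t .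
  have finA: "finite ?A" using A finite_subset by blast
  have finB: "finite ?B" using finite_supp .
  have SA: "S \<subseteq> ?A \<times> {..<K}" using t by (auto simp: S_def csupp_def T_def)
  then have finS: "finite S" using finA finite_subset by blast
  have finB0: "finite B0"
  proof -
    have "inj_on (\<lambda>(i, j). Va i j) B0" by (auto simp: inj_on_def)
    moreover have "(\<lambda>(i, j). Va i j) ` B0 \<subseteq> ?B" by (auto simp: B0_def)
    ultimately show ?thesis using finB by (metis finite_imageD finite_subset)
  qed
  have cardAB: "card A0 + card B0 \<le> card ?B"
  proof -
    have "card A0 = card (Cl ` A0)" by (simp add: card_image inj_on_def)
    moreover have "card B0 = card ((\<lambda>(i, j). Va i j) ` B0)" by (rule card_image[symmetric]) (auto simp: inj_on_def)
    moreover have "card (Cl ` A0) + card ((\<lambda>(i, j). Va i j) ` B0) = card (Cl ` A0 \<union> (\<lambda>(i, j). Va i j) ` B0)"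
      using finA finB0 by (intro card_Un_disjoint[symmetric]) (auto simp: A0_def)
    moreover have "\<dots> \<le> card ?B" using finB by (intro card_mono) (auto simp: A0_def B0_def)
    ultimately show ?thesis by simp
  qed
  have rows: "3 * card ?A \<le> card S + 2 * card A0"
  proof -
    have Sig: "S = (SIGMA a:?A. {i. t a i \<noteq> 0})" by (auto simp: S_def csupp_def)
    have fini: "finite {i. t a i \<noteq> 0}" for a
      by (rule finite_subset[of _ "{..<K}"]) (use t in \<open>auto simp: T_def\<close>)
    have "card S = (\<Sum>a\<in>?A. card {i. t a i \<noteq> 0})" unfolding Sig using finA fini by simp
    moreover have "(\<Sum>a\<in>?A. 3) \<le> (\<Sum>a\<in>?A. card {i. t a i \<noteq> 0} + (if a \<in> A0 then 2 else 0))"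
    proof (rule sum_mono)
      fix a assume a: "a \<in> ?A"
      show "3 \<le> card {i. t a i \<noteq> 0} + (if a \<in> A0 then 2 else 0)"
      proof (cases "a \<in> A0")
        case True
        have "{i. t a i \<noteq> 0} \<noteq> {}" using a by (auto simp: csupp_def)
        then have "0 < card {i. t a i \<noteq> 0}" using fini card_gt_0_iff by blast
        then show ?thesis using True by simp
      next
        case False
        have "Cl a \<in> Sn" using a A by (auto simp: Sn_def)
        then have "bd t (Cl a) = 0" using a False by (auto simp: A0_def supp_def)
        then show ?thesis using row_support[OF t a] by simp
      qed
    qed
    moreover have "(\<Sum>a\<in>?A. if a \<in> A0 then 2 else 0) = 2 * card A0"
      using finA by (simp add: sum.If_cases A0_def Int_def conj_commute mult.commute)
    ultimately show ?thesis by (simp add: sum.distrib)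
  qed
  have cols: "2 * card (p ` S) \<le> card S + card B0"
  proof -
    have "card S = (\<Sum>v\<in>p ` S. card {x \<in> S. p x = v})"
      using sum.image_gen[OF finS, of "\<lambda>_. 1 :: nat" p] by simp
    moreover have "(\<Sum>v\<in>p ` S. 2) \<le> (\<Sum>v\<in>p ` S. card {x \<in> S. p x = v} + (if v \<in> B0 then 1 else 0))"
    proof (rule sum_mono)
      fix v assume v: "v \<in> p ` S"
      obtain i j where ij: "v = (i, j)" by (cases v)
      let ?X = "{x \<in> S. p x = v}"
      have fX: "finite ?X" using finS by simp
      obtain x0 where "x0 \<in> S" "v = p x0" using v by (rule imageE)
      then have "?X \<noteq> {}" by blast
      then have pos: "0 < card ?X" using fX by (simp only: card_gt_0_iff simp_thms)
      have "2 \<le> card ?X" if nB: "v \<notin> B0"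
      proof (rule ccontr)
        assume "\<not> 2 \<le> card ?X"
        then have "card ?X = 1" using pos by linarith
        then obtain x where x: "?X = {x}" by (auto simp: card_1_singleton_iff)
        obtain a i' where xa: "x = (a, i')" by (cases x)
        have xS: "(a, i') \<in> S" "p (a, i') = v" using x xa by auto
        then have i': "i' = i" and hij: "h a i = j" by (auto simp: p_def ij)
        have ta: "t a i \<noteq> 0" using xS i' by (auto simp: S_def)
        have aM: "a < M" "i < K" using ta t by (auto simp: T_def)
        have jN: "j < N" using h_less[OF aM] hij by simp
        have "Va i j \<in> Sn" using aM jN by (auto simp: Sn_def)
        then have bz: "bd t (Va i j) = 0" using nB ij by (auto simp: B0_def supp_def)
        have "(\<Sum>b | b < M \<and> h b i = j. t b i) = (\<Sum>b\<in>{a}. t b i)"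
        proof (rule sum.mono_neutral_right)
          show "finite {b. b < M \<and> h b i = j}" by simp
          show "{a} \<subseteq> {b. b < M \<and> h b i = j}" using aM hij by auto
          show "\<forall>b\<in>{b. b < M \<and> h b i = j} - {a}. t b i = 0"
          proof
            fix b assume b: "b \<in> {b. b < M \<and> h b i = j} - {a}"
            show "t b i = 0"
            proof (rule ccontr)
              assume "t b i \<noteq> 0"
              then have "(b, i) \<in> ?X" using b by (auto simp: S_def p_def ij)
              then have "(b, i) = x" using x by blast
              then show False using b xa by simp
            qed
          qed
        qed
        then show False using bz ta by (simp add: bd_def zero_prod_def)
      qed
      then show "2 \<le> card ?X + (if v \<in> B0 then 1 else 0)" using pos by auto
    qed
    moreover have "(\<Sum>v\<in>p ` S. if v \<in> B0 then 1 else 0) \<le> card B0"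
    proof -
      have "(\<Sum>v\<in>p ` S. if v \<in> B0 then 1 else 0) = card (p ` S \<inter> B0)"
        using finS by (simp add: sum.If_cases)
      also have "\<dots> \<le> card B0" using finB0 by (intro card_mono) auto
      finally show ?thesis .
    qed
    ultimately show ?thesis by (simp add: sum.distrib)
  qed
  have "card (p ` (?A \<times> {..<K})) \<le> card (p ` (?A \<times> {..<K} - S)) + card (p ` S)"
  proof -
    have "p ` (?A \<times> {..<K}) = p ` (?A \<times> {..<K} - S) \<union> p ` S" using SA by auto
    then show ?thesis by (metis card_Un_le)
  qed
  also have "card (p ` (?A \<times> {..<K} - S)) \<le> card (?A \<times> {..<K} - S)" using finA by (intro card_image_le) auto
  also have "card (?A \<times> {..<K} - S) = card ?A * K - card S" using SA finS by (simp add: card_Diff_subset card_cartesian_product)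
  \<comment> \<open>Each incidence outside \<open>S\<close> adds at most one variable to those met
    by \<open>S\<close>. Together with \<open>rows\<close> and \<open>cols\<close> this eliminates
    \<open>card S\<close>.\<close>
  finally have g1: "card (p ` (?A \<times> {..<K})) + card S \<le> card ?A * K + card (p ` S)"
    using card_mono[OF _ SA] finA by (simp add: card_cartesian_product)
  then have g: "2 * card (p ` (?A \<times> {..<K})) + 3 * card ?A \<le> 2 * K * card ?A + 2 * card A0 + card B0"
    using rows cols by (simp add: mult.commute mult.left_commute)
  then have "D * (2 * card (p ` (?A \<times> {..<K})) + 3 * card ?A) \<le> D * (2 * K * card ?A + 2 * card A0 + card B0)"
    by (rule mult_le_mono2)
  moreover have "2 * D * K * card ?A + card ?A < 3 * D * card ?A + 2 * D * card (p ` (?A \<times> {..<K}))"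
    using expansion[OF A ne le] by (simp add: p_def)
  ultimately have "card ?A < D * (2 * card A0 + card B0)" by (simp add: algebra_simps)
  also have "\<dots> \<le> D * (2 * card ?B)" using cardAB by (intro mult_le_mono2) simp
  finally show ?thesis by (simp add: mult.assoc mult.left_commute)
qed

text \<open>For a zero boundary \<open>support_bound\<close> leaves only the zero combination, which
  is \<open>kernel\<close>. For a boundary of at most \<open>2 * R + 2\<close> supernodes it gives
  the threshold \<open>4 * D * (R + 1)\<close>, which is less than half of \<open>W\<close>.\<close>

sublocale derivation_system Sn Lb "F \<times> F" \<beta> T bd "\<lambda>t. card (csupp t)" \<rho> R W "4 * D * (R + 1)"
proof
  show "0 \<in> T" by (simp add: T_def F_0)
  show "t + t' \<in> T" if "t \<in> T" "t' \<in> T" for t t' using that by (auto simp: T_def F_add)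
  show "t + t = 0" for t :: "nat \<Rightarrow> nat \<Rightarrow> 'f" by (rule ext)+ (simp only: plus_fun_apply zero_fun_apply F_char2)
  show "bd t \<in> U" if "t \<in> T" for t
  proof -
    have "bd t s \<in> Lb s" for s
      using that \<theta>_F by (auto simp: bd_def Lb_def T_def intro!: F_sum F_mult split: node.splits)
    moreover have "bd t s = 0" if "s \<notin> Sn" for s
    proof (cases s)
      case (Cl a)
      then have "\<not> a < M" using that by (auto simp: Sn_def)
      then show ?thesis using Cl \<open>t \<in> T\<close> by (simp add: bd_def T_def zero_prod_def)
    next
      case (Va i j)
      then have "\<not> (i < K \<and> j < N)" using that by (auto simp: Sn_def)
      then have "t a i = 0" if "a < M" "h a i = j" for a
        using \<open>t \<in> T\<close> h_less[of a i] that by (auto simp: T_def)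
      then show ?thesis using Va by (simp add: bd_def zero_prod_def)
    qed
    ultimately show ?thesis by (simp add: U_def)
  qed
  show "bd (t + t') = bd t + bd t'" for t t'
    by (auto simp: fun_eq_iff bd_def plus_prod_def sum.distrib distrib_left split: node.splits)
  show "card (csupp 0) = 0" by (simp add: csupp_def)
  show "card (csupp (t + t')) \<le> card (csupp t) + card (csupp t')" if "t \<in> T" "t' \<in> T" for t t'
  proof -
    have "finite (csupp t)" "finite (csupp t')" using csupp_sub that finite_subset by blast+
    moreover have "csupp (t + t') \<subseteq> csupp t \<union> csupp t'" by (auto simp: csupp_def)
    ultimately show ?thesis by (meson card_Un_le card_mono finite_UnI order_trans)
  qed
  have inF: "(\<Sum>a<M. \<Sum>i<K. t a i * c a i) \<in> F" if "t \<in> T" for t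
    using that c_F by (intro F_sum F_mult) (auto simp: T_def)
  show "\<rho> (t + t') = \<rho> t * \<rho> t'" if "t \<in> T" "t' \<in> T" for t t'
    unfolding \<rho>_def \<psi>_add[OF inF[OF that(1)] inF[OF that(2)], symmetric] by (simp add: distrib_right sum.distrib)
  show "\<rho> t * \<rho> t = 1" if "t \<in> T" for t unfolding \<rho>_def by (rule \<psi>_sq[OF inF[OF that]])
  show "t = 0" if "t \<in> T" "card (csupp t) \<le> W" "bd t = 0" for t
  proof (rule ccontr)
    assume "t \<noteq> 0"
    then have "csupp t \<noteq> {}" by (auto simp: csupp_def fun_eq_iff)
    from support_bound[OF that(1) this that(2)] show False using that(3) by (simp add: supp_def)
  qed
  show "card (csupp t) \<le> 4 * D * (R + 1)" if "t \<in> T" "card (csupp t) \<le> W" "card (supp (bd t)) \<le> 2 * R + 2" for t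
  proof (cases "csupp t = {}")
    case False
    have "card (csupp t) < 2 * D * card (supp (bd t))" using support_bound[OF that(1) False that(2)] .
    also have "\<dots> \<le> 2 * D * (2 * R + 2)" using that(3) by (rule mult_le_mono2)
    finally show ?thesis by (simp add: algebra_simps)
  qed simp
  show "2 * (4 * D * (R + 1)) + 1 \<le> W" using W_large by (simp add: mult.assoc)
qed

text \<open>For an incompatible pair some multiple \<open>\<tau>\<close> of the single violated
  equation has character value -1 on the error \<open>e + c a i\<close>. The derivation with this
  one coefficient forces its character to be \<open>\<rho> t\<close>, while the pair makes it
  \<open>- \<rho> t\<close>. The two extra degrees pay for the two indicators.\<close>

lemma constraint_kills:
  assumes a: "a < M" and i: "i < K"
    and l: "l \<in> Lb (Cl a)" "l' \<in> Lb (Va i (h a i))" "(l, l') \<notin> Rel (Cl a) (Va i (h a i))"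
    and f: "local_fun Sn Lb R' f" and R': "R' + 2 \<le> R"
  shows "L (\<lambda>\<omega>. of_bool (\<omega> (Cl a) = l) * of_bool (\<omega> (Va i (h a i)) = l') * f \<omega>) = 0"
proof -
  let ?v = "Va i (h a i)"
  have Sn: "Cl a \<in> Sn" "?v \<in> Sn" using a i h_less by (auto simp: Sn_def)
  obtain x y where xy: "l = (x, y)" "x \<in> F" "y \<in> F" using l by (auto simp: Lb_def)
  obtain w where w: "l' = (w, 0)" "w \<in> F" using l by (auto simp: Lb_def)
  define e where "e = x + \<theta> i * y + w"
  have eF: "e \<in> F" unfolding e_def using xy w \<theta>_F i by (intro F_add F_mult) auto
  have cF: "c a i \<in> F" using c_F a i .
  have "w \<noteq> x + \<theta> i * y + c a i" using l(3) xy w by (auto simp: Rel_def)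
  then have "e + c a i \<noteq> 0" unfolding e_def by (metis add_eq_0 add.assoc add.commute)
  then obtain \<tau> where \<tau>: "\<tau> \<in> F" "\<psi> (\<tau> * (e + c a i)) = - 1" using \<psi>_separates F_add eF cF by blast
  define t where "t = (\<lambda>b j. if b = a \<and> j = i then \<tau> else 0)"
  have tT: "t \<in> T" using \<tau> a i F_0 by (auto simp: t_def T_def)
  have bdt: "bd t = point (Cl a) (\<tau>, \<theta> i * \<tau>) + point ?v (\<tau>, 0)"
  proof
    fix s
    show "bd t s = (point (Cl a) (\<tau>, \<theta> i * \<tau>) + point ?v (\<tau>, 0)) s"
    proof (cases s)
      case (Cl b)
      have "(\<Sum>j<K. t b j) = (if b = a then \<tau> else 0)" "(\<Sum>j<K. \<theta> j * t b j) = (if b = a then \<theta> i * \<tau> else 0)"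
        using i by (auto simp: t_def if_distrib cong: if_cong)
      then show ?thesis using Cl by (auto simp: bd_def point_def zero_prod_def)
    next
      case (Va i' j)
      have "(\<Sum>b | b < M \<and> h b i' = j. t b i') = (if i' = i \<and> j = h a i then \<tau> else 0)"
        using a by (cases "i' = i") (auto simp: t_def sum.delta)
      then show ?thesis using Va by (auto simp: bd_def point_def zero_prod_def)
    qed
  qed
  have pU: "point (Cl a) (\<tau>, \<theta> i * \<tau>) \<in> UR 1" "point ?v (\<tau>, 0) \<in> UR 1"
    using \<tau> \<theta>_F i F_mult by (auto intro!: point_UR Sn simp: Lb_def simp del: One_nat_def)
  have "bd t \<in> UR (1 + 1)" unfolding bdt by (rule UR_add[OF pU])
  then have supp2: "card (supp (bd t)) \<le> 2" and bdU: "bd t \<in> U" by (auto simp: UR_def)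
  have "card (csupp t) \<le> card {a}" by (rule card_mono) (auto simp: csupp_def t_def)
  then have sz1: "card (csupp t) \<le> 1" by simp
  have \<rho>t: "\<rho> t = \<psi> (\<tau> * c a i)"
  proof -
    have "(\<Sum>b<M. \<Sum>j<K. t b j * c b j) = (\<Sum>b<M. if b = a then \<tau> * c a i else 0)"
      using i by (intro sum.cong refl) (auto simp: t_def if_distrib[of "\<lambda>x. x * _"] cong: if_cong)
    then show ?thesis using a by (simp add: \<rho>_def)
  qed
  have \<rho>sq: "\<rho> t * \<rho> t = 1" using \<rho>_sq tT by simp
  have chi: "\<chi> (bd t) \<omega> = - \<rho> t" if w': "\<omega> \<in> U" "\<omega> (Cl a) = l" "\<omega> ?v = l'" for \<omega>
  proof -
    have "\<chi> (bd t) \<omega> = \<beta> (\<tau>, \<theta> i * \<tau>) l * \<beta> (\<tau>, 0) l'"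
      unfolding bdt using pU w' \<tau> \<theta>_F i F_mult
      by (subst \<chi>_add) (auto simp: UR_def \<chi>_point Sn Lb_def F_0)
    also have "\<dots> = \<psi> (\<tau> * x + \<theta> i * \<tau> * y) * \<psi> (\<tau> * w)" using xy w by (simp add: \<beta>_def)
    also have "\<dots> = \<psi> (\<tau> * x + \<theta> i * \<tau> * y + \<tau> * w)"
      using \<tau> xy w \<theta>_F i by (intro \<psi>_add[symmetric]) (auto intro!: F_add F_mult)
    also have "\<dots> = \<psi> (\<tau> * e)" by (simp add: e_def algebra_simps)
    finally have ch: "\<chi> (bd t) \<omega> = \<psi> (\<tau> * e)" .
    have "\<psi> (\<tau> * e) * \<rho> t = \<psi> (\<tau> * (e + c a i))"
      unfolding \<rho>t distrib_left using \<tau> eF cF by (intro \<psi>_add[symmetric]) (auto intro!: F_mult)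
    then have "\<psi> (\<tau> * e) * \<rho> t * \<rho> t = - \<rho> t" using \<tau> by simp
    then show ?thesis using ch \<rho>sq by (simp add: mult.assoc)
  qed
  have "local_fun Sn Lb (Suc (Suc R')) (\<lambda>\<omega>. of_bool (\<omega> (Cl a) = l) * (of_bool (\<omega> ?v = l') * f \<omega>))"
    using f l Sn by (intro local_fun.ind)
  then have "local_fun Sn Lb R (\<lambda>\<omega>. of_bool (\<omega> (Cl a) = l) * of_bool (\<omega> ?v = l') * f \<omega>)"
    using local_fun_mono R' by (fastforce simp: mult.assoc)
  then have sp: "spec R (\<lambda>\<omega>. of_bool (\<omega> (Cl a) = l) * of_bool (\<omega> ?v = l') * f \<omega>)" by (rule local_fun_spec)
  show ?thesis
    by (rule L_kills[OF sp bdU, where \<kappa> = "\<rho> t"])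
      (use lam_add_bd[OF _ tT sz1 supp2] chi \<rho>sq in \<open>auto split: if_splits\<close>)
qed

end

section \<open>Binary fields with a nontrivial additive character\<close>

text \<open>A repeated linear factor would make its root a root of the derivative, so the factors
  are distinct.\<close>

lemma card_roots_separable:
  fixes p :: "'a :: alg_closed_field Polynomial.poly"
  assumes p: "p \<noteq> 0" and sep: "\<And>a. Polynomial.poly p a = 0 \<Longrightarrow> Polynomial.poly (pderiv p) a \<noteq> 0"
  shows "card {a. Polynomial.poly p a = 0} = Polynomial.degree p"
proof -
  obtain A where A: "size A = Polynomial.degree p" "p = Polynomial.smult (Polynomial.lead_coeff p) (\<Prod>x\<in>#A. [:-x, 1:])"
    using alg_closed_imp_factorization[OF p] by blast
  have lc: "Polynomial.lead_coeff p \<noteq> 0" using p by simp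
  have roots: "{a. Polynomial.poly p a = 0} = set_mset A"
  proof -
    have "Polynomial.poly p a = 0 \<longleftrightarrow> a \<in># A" for a
      using lc by (subst A(2)) (auto simp: poly_prod_mset prod_mset_zero_iff)
    then show ?thesis by auto
  qed
  have "count A x \<le> 1" for x
  proof (rule ccontr)
    assume "\<not> count A x \<le> 1"
    then have "{#x, x#} \<subseteq># A" by (auto simp: subseteq_mset_def)
    then obtain B where B: "A = add_mset x (add_mset x B)" by (auto simp: mset_subset_eq_exists_conv)
    have pp: "p = [:-x, 1:] * ([:-x, 1:] * Polynomial.smult (Polynomial.lead_coeff p) (\<Prod>x\<in>#B. [:-x, 1:]))"
      by (subst A(2)) (simp add: B)
    then obtain r where r: "p = [:-x, 1:] * ([:-x, 1:] * r)" by blast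
    have "Polynomial.poly (pderiv p) x = 0" unfolding r pderiv_mult by (simp only: poly_add poly_mult) simp
    moreover have "Polynomial.poly p x = 0" unfolding r by (simp only: poly_mult) simp
    ultimately show False using sep by blast
  qed
  then have cnt: "count A x = 1" if "x \<in># A" for x using that by (simp add: antisym)
  have "size A = (\<Sum>x\<in>set_mset A. count A x)" by (rule size_multiset_overloaded_eq)
  also have "\<dots> = card (set_mset A)" using cnt by simp
  finally show ?thesis using A(1) roots by simp
qed

lemma char_2_bit_closure: "x + x = (0 :: bit alg_closure)"
proof -
  have "(2 :: bit alg_closure) = to_ac 2" by (simp only: to_ac_numeral)
  also have "\<dots> = 0" by (simp only: bit_2_eq_0 to_ac_0)
  finally have "(1 + 1 :: bit alg_closure) = 0" by simp
  then have "x * (1 + 1) = 0" by simp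
  then show ?thesis by (simp only: distrib_left mult_1_right)
qed

lemma frobenius_bit_closure: "(x + y) ^ (2 ^ j) = x ^ (2 ^ j) + (y :: bit alg_closure) ^ (2 ^ j)"
proof (induction j)
  case (Suc j)
  have sq: "(a + b)\<^sup>2 = a\<^sup>2 + (b :: bit alg_closure)\<^sup>2" for a b
  proof -
    have "(a + b)\<^sup>2 = a\<^sup>2 + b\<^sup>2 + (a * b + a * b)" by (simp add: power2_eq_square algebra_simps)
    then show ?thesis by (simp only: char_2_bit_closure add_0_right)
  qed
  have "(x + y) ^ (2 ^ Suc j) = ((x + y) ^ (2 ^ j))\<^sup>2" by (simp add: power_mult[symmetric] mult.commute)
  also have "\<dots> = (x ^ (2 ^ j))\<^sup>2 + (y ^ (2 ^ j))\<^sup>2" by (simp only: Suc sq)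
  finally show ?case by (simp add: power_mult[symmetric] mult.commute)
qed simp

text \<open>The field is the root set of \<open>x ^ q + x\<close> with \<open>q = 2 ^ m\<close> in
  the algebraic closure of GF(2); the derivative is 1, so there are \<open>q\<close> roots. The
  character is the sign of the trace, a polynomial of degree \<open>q / 2\<close>, which cannot
  vanish at \<open>q\<close> points.\<close>

lemma binary_field_exists:
  assumes "m \<ge> 1"
  shows "\<exists>(F :: bit alg_closure set) \<psi>. binary_field F \<psi> \<and> card F = 2 ^ m"
proof -
  let ?q = "2 ^ m :: nat"
  define F :: "bit alg_closure set" where "F = {x. x ^ ?q = x}"
  define tr :: "bit alg_closure \<Rightarrow> bit alg_closure" where "tr x = (\<Sum>j<m. x ^ (2 ^ j))" for x
  define \<psi> :: "bit alg_closure \<Rightarrow> real" where "\<psi> x = (if tr x = 0 then 1 else - 1)" for x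
  have q: "1 < ?q" using assms one_less_power[of "2 :: nat" m] by simp
  have neg: "- x = x" for x :: "bit alg_closure" using char_2_bit_closure[of x] by (metis add_eq_0_iff)
  define p :: "bit alg_closure Polynomial.poly" where "p = Polynomial.monom 1 ?q + Polynomial.monom 1 1"
  have polyp: "Polynomial.poly p x = x ^ ?q + x" for x by (simp add: p_def Polynomial.poly_monom)
  have coeffp: "Polynomial.coeff p ?q = 1" using q by (simp add: p_def)
  have degp: "Polynomial.degree p = ?q"
  proof (rule antisym)
    show "Polynomial.degree p \<le> ?q" using q unfolding p_def
      by (intro degree_add_le) (auto intro: order_trans[OF degree_monom_le])
    show "?q \<le> Polynomial.degree p" by (rule le_degree) (simp add: coeffp)
  qed
  have F_roots: "F = {x. Polynomial.poly p x = 0}"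
    unfolding F_def polyp by (auto simp: add_eq_0_iff neg)
  have der: "Polynomial.poly (pderiv p) x = 1" for x
  proof -
    have "of_nat ?q = (0 :: bit alg_closure)"
    proof -
      have "of_nat ?q = (2 :: bit alg_closure) ^ m" by simp
      moreover have "(2 :: bit alg_closure) = 0" using char_2_bit_closure[of 1] by simp
      ultimately show ?thesis using assms by (simp add: power_0_left)
    qed
    then show ?thesis by (simp add: p_def pderiv_add pderiv_monom Polynomial.poly_monom)
  qed
  have "p \<noteq> 0" using coeffp by auto
  then have cardF: "card F = ?q" unfolding F_roots using card_roots_separable[of p] der degp by simp
  have finF: "finite F" using cardF q by (metis card.infinite not_one_less_zero)
  \<comment> \<open>The Frobenius map permutes the summands of the trace cyclically, so the trace is
    its own square.\<close>
  have trF: "tr x = 0 \<or> tr x = 1" if "x \<in> F" for x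
  proof -
    have "(tr x)\<^sup>2 = (\<Sum>j<m. (x ^ (2 ^ j))\<^sup>2)"
    proof -
      have "(\<Sum>j\<in>J. f j)\<^sup>2 = (\<Sum>j\<in>J. (f j)\<^sup>2)" for J :: "nat set" and f :: "nat \<Rightarrow> bit alg_closure"
        by (induction J rule: infinite_finite_induct) (use frobenius_bit_closure[where j = 1] in auto)
      then show ?thesis by (simp add: tr_def)
    qed
    also have "\<dots> = (\<Sum>j<m. x ^ (2 ^ Suc j))" by (simp add: power_mult[symmetric] mult.commute)
    also have "\<dots> + x = (\<Sum>j<Suc m. x ^ (2 ^ j))" by (subst sum.lessThan_Suc_shift) (simp add: add.commute)
    also have "\<dots> = tr x + x" using that by (simp add: tr_def F_def)
    finally have "(tr x)\<^sup>2 = tr x" by simp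
    then show ?thesis by (simp add: power2_eq_square)
  qed
  have tr_add: "tr (x + y) = tr x + tr y" for x y by (simp add: tr_def frobenius_bit_closure sum.distrib)
  have nontriv: "\<exists>x\<in>F. tr x \<noteq> 0"
  proof (rule ccontr)
    assume triv: "\<not> (\<exists>x\<in>F. tr x \<noteq> 0)"
    define t :: "bit alg_closure Polynomial.poly" where "t = (\<Sum>j<m. Polynomial.monom 1 (2 ^ j))"
    have "Polynomial.poly t x = tr x" for x by (simp add: t_def tr_def Polynomial.poly_sum Polynomial.poly_monom)
    then have sub: "F \<subseteq> {x. Polynomial.poly t x = 0}" using triv by auto
    have "Polynomial.coeff t (2 ^ (m - 1)) = (\<Sum>j<m. if j = m - 1 then 1 else 0)"
      unfolding t_def Polynomial.coeff_sum by (intro sum.cong) auto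
    then have t0: "t \<noteq> 0" using assms by auto
    have "Polynomial.degree t \<le> 2 ^ (m - 1)" unfolding t_def
      by (intro degree_sum_le) (auto intro!: order_trans[OF degree_monom_le] power_increasing)
    then have "card {x. Polynomial.poly t x = 0} \<le> 2 ^ (m - 1)"
      using card_poly_roots_bound[OF t0] by (rule order_trans[rotated])
    moreover have "card F \<le> card {x. Polynomial.poly t x = 0}"
      using sub poly_roots_finite[OF t0] by (rule card_mono[rotated])
    moreover have "(2 :: nat) ^ (m - 1) < 2 ^ m" using assms by (intro power_strict_increasing) auto
    ultimately show False using cardF by linarith
  qed
  have "binary_field F \<psi>"
  proof
    show "finite F" by (rule finF)
    show "0 \<in> F" "1 \<in> F" by (auto simp: F_def)
    show "x + y \<in> F" if "x \<in> F" "y \<in> F" for x y using that by (simp add: F_def frobenius_bit_closure)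
    show "x * y \<in> F" if "x \<in> F" "y \<in> F" for x y using that by (simp add: F_def power_mult_distrib)
    show "x + x = 0" for x :: "bit alg_closure" by (rule char_2_bit_closure)
    show "\<psi> (x + y) = \<psi> x * \<psi> y" if "x \<in> F" "y \<in> F" for x y
      using trF[OF that(1)] trF[OF that(2)] char_2_bit_closure[of 1] by (auto simp: \<psi>_def tr_add)
    show "\<psi> x * \<psi> x = 1" for x by (simp add: \<psi>_def)
    show "\<exists>x\<in>F. \<psi> x = - 1" using nontriv by (auto simp: \<psi>_def)
  qed
  then show ?thesis using cardF by blast
qed

section \<open>Random hypergraphs\<close>

text \<open>Each equation determines the value at \<open>f j\<close> from the value at a point of
  smaller rank, so the function is fixed by its values off the image of \<open>f\<close>. The rank
  prevents circular equations, which would determine less.\<close>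

lemma card_identified:
  fixes rk :: "'p \<Rightarrow> nat"
  assumes P: "finite P" and J: "finite J" and f: "inj_on f J" "f ` J \<subseteq> P" and g: "g ` J \<subseteq> P"
    and rk: "\<And>j. j \<in> J \<Longrightarrow> rk (g j) < rk (f j)" and Y: "finite Y"
  shows "card {h \<in> PiE P (\<lambda>_. Y). \<forall>j\<in>J. h (f j) = h (g j)} * card Y ^ card J \<le> card Y ^ card P"
proof -
  let ?Q = "f ` J" and ?C = "{h \<in> PiE P (\<lambda>_. Y). \<forall>j\<in>J. h (f j) = h (g j)}"
  have "inj_on (\<lambda>h. restrict h (P - ?Q)) ?C"
  proof (rule inj_onI)
    fix h h' assume h: "h \<in> ?C" "h' \<in> ?C" "restrict h (P - ?Q) = restrict h' (P - ?Q)"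
    have off: "h p = h' p" if "p \<in> P" "p \<notin> ?Q" for p
      using fun_cong[OF h(3), of p] that by simp
    have "p \<in> P \<longrightarrow> h p = h' p" for p
    proof (induction "rk p" arbitrary: p rule: less_induct)
      case less
      show ?case
      proof (cases "p \<in> ?Q")
        case True
        then obtain j where j: "j \<in> J" "p = f j" by auto
        then have "h (g j) = h' (g j)" using less[of "g j"] rk g by auto
        then show ?thesis using h j by auto
      qed (use off in auto)
    qed
    then show "h = h'" using h by (intro PiE_ext[of h P "\<lambda>_. Y" h']) auto
  qed
  moreover have "(\<lambda>h. restrict h (P - ?Q)) ` ?C \<subseteq> PiE (P - ?Q) (\<lambda>_. Y)" by (auto simp: PiE_def Pi_def)
  ultimately have "card ?C \<le> card (PiE (P - ?Q) (\<lambda>_. Y))"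
    using P Y by (intro card_inj_on_le) (auto intro!: finite_PiE)
  also have "\<dots> = card Y ^ (card P - card J)"
    using P f J by (simp add: card_PiE card_Diff_subset card_image)
  finally have "card ?C * card Y ^ card J \<le> card Y ^ (card P - card J) * card Y ^ card J" by (rule mult_right_mono) simp
  also have "\<dots> = card Y ^ card P"
    using card_mono[OF P f(2)] f(1) by (simp add: power_add[symmetric] card_image)
  finally show ?thesis .
qed

lemma card_UN_le_const:
  assumes "finite I" "\<And>i. i \<in> I \<Longrightarrow> real (card (f i)) \<le> b"
  shows "real (card (\<Union>i\<in>I. f i)) \<le> real (card I) * b"
proof -
  have "real (card (\<Union>i\<in>I. f i)) \<le> real (\<Sum>i\<in>I. card (f i))" using card_UN_le[OF assms(1)] by (simp only: of_nat_le_iff)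
  also have "\<dots> \<le> real (card I) * b" unfolding of_nat_sum using assms(2) by (rule sum_bounded_above)
  finally show ?thesis .
qed

definition hypergraphs :: "nat \<Rightarrow> nat \<Rightarrow> nat \<Rightarrow> (nat \<times> nat \<Rightarrow> nat) set" where
  "hypergraphs M K N = PiE ({..<M} \<times> {..<K}) (\<lambda>_. {..<N})"

text \<open>
  This is \<open>K |A| - |\<Gamma>(A)| < (3/2 - 1/(2D)) |A|\<close> cleared of denominators, where \<open>\<Gamma>(A)\<close> is the set of variables of the
  clauses in \<open>A\<close>. The \<open>i\<close>-th variables of all clauses form their own block, so they are pairs \<open>(i, h (a, i))\<close>.
\<close>

definition expands :: "nat \<Rightarrow> nat \<Rightarrow> nat \<Rightarrow> nat \<Rightarrow> (nat \<times> nat \<Rightarrow> nat) \<Rightarrow> bool" where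
  "expands M K W D h \<longleftrightarrow> (\<forall>A. A \<subseteq> {..<M} \<longrightarrow> A \<noteq> {} \<longrightarrow> card A \<le> W \<longrightarrow>
      2 * D * K * card A + card A < 3 * D * card A + 2 * D * card ((\<lambda>(a, i). (i, h (a, i))) ` (A \<times> {..<K})))"

lemma card_hypergraphs: "card (hypergraphs M K N) = N ^ (M * K)" "finite (hypergraphs M K N)"
  by (auto simp: hypergraphs_def card_PiE card_cartesian_product intro!: finite_PiE)

text \<open>The incidences whose variable already occurs in a smaller clause of \<open>A\<close>
  account for the whole loss of variables. Each is given such a clause as witness; its being smaller
  supplies the rank for \<open>card_identified\<close>.\<close>

lemma repeats_of_non_expanding:
  fixes A :: "nat set"
  assumes A: "finite A" and D: "D \<ge> 1"
    and ne: "3 * D * card A + 2 * D * card ((\<lambda>(a, i). (i, h (a, i))) ` (A \<times> {..<K})) \<le> 2 * D * K * card A + card A"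
    and x: "2 * D * x < (3 * D - 1) * card A + 2 * D"
  shows "\<exists>Q w. Q \<subseteq> A \<times> {..<K} \<and> card Q = x \<and> w \<in> PiE Q (\<lambda>_. A) \<and> (\<forall>p\<in>Q. w p < fst p \<and> h p = h (w p, snd p))"
proof -
  let ?p = "\<lambda>(a, i). (i, h (a, i))"
  define Q where "Q = {(a, i) \<in> A \<times> {..<K}. \<exists>a'\<in>A. a' < a \<and> h (a, i) = h (a', i)}"
  have finQ: "finite Q" by (rule finite_subset[of _ "A \<times> {..<K}"]) (use A in \<open>auto simp: Q_def\<close>)
  have "inj_on ?p (A \<times> {..<K} - Q)"
  proof (rule inj_onI)
    fix x y assume *: "x \<in> A \<times> {..<K} - Q" "y \<in> A \<times> {..<K} - Q" "?p x = ?p y"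
    obtain a i a' where xy: "x = (a, i)" "y = (a', i)" "h (a, i) = h (a', i)" using *(3) by (cases x, cases y) auto
    then show "x = y" using *(1,2) by (cases a a' rule: linorder_cases) (auto simp: Q_def)
  qed
  then have "card (A \<times> {..<K} - Q) = card (?p ` (A \<times> {..<K} - Q))" by (simp add: card_image)
  also have "\<dots> \<le> card (?p ` (A \<times> {..<K}))" using A by (intro card_mono) auto
  finally have "card A * K - card Q \<le> card (?p ` (A \<times> {..<K}))"
    using A finQ by (subst (asm) card_Diff_subset) (auto simp: Q_def card_cartesian_product)
  then have "K * card A \<le> card Q + card (?p ` (A \<times> {..<K}))" by (simp add: mult.commute)
  then have "2 * D * (K * card A) \<le> 2 * D * (card Q + card (?p ` (A \<times> {..<K})))" by (rule mult_le_mono2)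
  then have "3 * D * card A \<le> 2 * D * card Q + card A" using ne by (simp add: algebra_simps)
  then have "(3 * D - 1) * card A \<le> 2 * D * card Q" by (simp add: diff_mult_distrib)
  then have "2 * D * x < 2 * D * (card Q + 1)" using x by simp
  then have "x < card Q + 1" by (metis mult_less_cancel1)
  then have "x \<le> card Q" by simp
  then obtain Q' where Q': "Q' \<subseteq> Q" "card Q' = x" by (metis obtain_subset_with_card_n)
  have "\<forall>p\<in>Q'. \<exists>a'\<in>A. a' < fst p \<and> h p = h (a', snd p)" using Q' by (auto simp: Q_def)
  then obtain w where w: "\<forall>p\<in>Q'. w p \<in> A \<and> w p < fst p \<and> h p = h (w p, snd p)" by metis
  show ?thesis using Q' w by (intro exI[of _ Q'] exI[of _ "restrict w Q'"]) (auto simp: Q_def)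
qed

text \<open>First moment over a set of \<open>s\<close> clauses, its \<open>x = xx s\<close> repeats
  and their witnesses: at most \<open>M ^ s * (s * K) ^ x * s ^ x\<close> choices, each realised by
  a fraction of at most \<open>1 / N ^ x\<close> of all hypergraphs. The conditions on
  \<open>Z\<close> bound the product by \<open>1 / 8 ^ s\<close>, and these sum to less than
  \<open>1 / 7\<close>.\<close>

lemma card_non_expanding:
  assumes D: "D \<ge> 1" and M: "M \<ge> 1" and N: "N \<ge> 1" and Z: "W\<^sup>2 * K * Z \<le> N" "(8 * M) ^ (2 * D) \<le> Z ^ (3 * D - 1)"
  shows "real (card {h \<in> hypergraphs M K N. \<not> expands M K W D h}) \<le> real (N ^ (M * K)) / 7"
proof -
  \<comment> \<open>The ceiling of \<open>(3 * D - 1) * s / (2 * D)\<close>, a number of repeats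
    that every non-expanding set of \<open>s\<close> clauses has.\<close>
  define xx where "xx s = ((3 * D - 1) * s + (2 * D - 1)) div (2 * D)" for s
  have xx1: "(3 * D - 1) * s \<le> 2 * D * xx s" for s
  proof -
    have "(3 * D - 1) * s + (2 * D - 1) < 2 * D * xx s + 2 * D"
      unfolding xx_def using D by (metis add.commute add_less_cancel_left mult_div_mod_eq mod_less_divisor mult_pos_pos zero_less_numeral Suc_le_eq One_nat_def)
    then show ?thesis using D by linarith
  qed
  have xx2: "2 * D * xx s < (3 * D - 1) * s + 2 * D" for s
  proof -
    have "2 * D * xx s \<le> (3 * D - 1) * s + (2 * D - 1)" unfolding xx_def by (rule times_div_less_eq_dividend)
    then show ?thesis using D by linarith
  qed
  let ?H = "hypergraphs M K N"
  define C where "C Q w = {h \<in> ?H. \<forall>p\<in>Q. w p < fst p \<and> h p = h (w p, snd p)}" for Q :: "(nat \<times> nat) set" and w :: "nat \<times> nat \<Rightarrow> nat"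
  define As where "As s = {A. A \<subseteq> {..<M} \<and> card A = s}" for s :: nat
  define Qs where "Qs A = {Q. Q \<subseteq> A \<times> {..<K} \<and> card Q = xx (card A)}" for A :: "nat set"
  define ws where "ws A Q = PiE Q (\<lambda>_. A)" for A :: "nat set" and Q :: "(nat \<times> nat) set"
  have finA: "finite A" if "A \<in> As s" for A s using that finite_subset by (auto simp: As_def)
  have finAs: "finite (As s)" for s by (simp add: As_def)
  have finQs: "finite (Qs A)" if "finite A" for A using that by (simp add: Qs_def)
  have finQ: "finite Q" if "Q \<in> Qs A" "finite A" for A Q using that finite_subset[of Q "A \<times> {..<K}"] by (auto simp: Qs_def)
  have finws: "finite (ws A Q)" if "finite A" "finite Q" for A Q using that by (auto simp: ws_def intro!: finite_PiE)
  have finC: "finite (C Q w)" for Q w using card_hypergraphs(2) by (simp add: C_def)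
  have cardC: "card (C Q w) * N ^ xx s \<le> N ^ (M * K)" if "A \<in> As s" "Q \<in> Qs A" "w \<in> ws A Q" for A s Q w
  proof (cases "\<forall>p\<in>Q. w p < fst p")
    case True
    have sub: "A \<subseteq> {..<M}" "card A = s" "Q \<subseteq> A \<times> {..<K}" "card Q = xx s" using that by (auto simp: As_def Qs_def)
    have wA: "w p \<in> A" if "p \<in> Q" for p using \<open>w \<in> ws A Q\<close> that by (auto simp: ws_def)
    have wM: "w p < M" if "p \<in> Q" for p using wA[OF that] sub(1) by auto
    have "C Q w = {h \<in> PiE ({..<M} \<times> {..<K}) (\<lambda>_. {..<N}). \<forall>p\<in>Q. h (id p) = h (w p, snd p)}"
      using True by (auto simp: C_def hypergraphs_def)
    moreover have "card {h \<in> PiE ({..<M} \<times> {..<K}) (\<lambda>_. {..<N}). \<forall>p\<in>Q. h (id p) = h (w p, snd p)} * card {..<N} ^ card Q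
        \<le> card {..<N} ^ card ({..<M} \<times> {..<K})"
      by (rule card_identified[where rk = fst]) (use sub True wM finQ[OF that(2) finA[OF that(1)]] in auto)
    ultimately show ?thesis using sub by (simp add: card_cartesian_product)
  next
    case False
    then have "C Q w = {}" by (auto simp: C_def)
    then show ?thesis by simp
  qed
  have Z1: "Z \<ge> 1"
  proof (rule ccontr)
    assume "\<not> Z \<ge> 1"
    then have "Z ^ (3 * D - 1) = 0" using D by (simp add: power_0_left)
    then have "(8 * M) ^ (2 * D) \<le> 0" using Z(2) by (simp only:)
    then show False using M by simp
  qed
  \<comment> \<open>Both sides are compared after raising to the power \<open>2 * D\<close>, which
    clears the fractional exponent.\<close>
  have Zx: "(8 * M) ^ s \<le> Z ^ xx s" for s
  proof -
    have "((8 * M) ^ s) ^ (2 * D) = ((8 * M) ^ (2 * D)) ^ s" by (simp only: power_mult[symmetric] mult.commute)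
    also have "\<dots> \<le> (Z ^ (3 * D - 1)) ^ s" using Z(2) by (rule power_mono) simp
    also have "\<dots> = Z ^ ((3 * D - 1) * s)" by (simp only: power_mult)
    also have "\<dots> \<le> Z ^ (2 * D * xx s)" using xx1 Z1 by (rule power_increasing)
    also have "\<dots> = (Z ^ xx s) ^ (2 * D)" by (simp only: power_mult[symmetric] mult.commute)
    finally have "((8 * M) ^ s) ^ (2 * D) \<le> (Z ^ xx s) ^ (2 * D)" .
    moreover have "2 * D = Suc (2 * D - 1)" using D by simp
    ultimately show ?thesis by (metis power_le_imp_le_base zero_le)
  qed
  have "term": "real (card (\<Union>A\<in>As s. \<Union>Q\<in>Qs A. \<Union>w\<in>ws A Q. C Q w)) \<le> real (N ^ (M * K)) * (1 / 8) ^ s" if s: "s \<le> W" for s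
  proof -
    let ?b = "real (N ^ (M * K)) / real N ^ xx s"
    have b0: "?b \<ge> 0" by simp
    have 1: "real (card (C Q w)) \<le> ?b" if "A \<in> As s" "Q \<in> Qs A" "w \<in> ws A Q" for A Q w
    proof -
      have "real (card (C Q w) * N ^ xx s) \<le> real (N ^ (M * K))" using cardC[OF that] by (simp only: of_nat_le_iff)
      then have "real (card (C Q w)) * real N ^ xx s \<le> real (N ^ (M * K))" by (simp only: of_nat_mult of_nat_power)
      moreover have "0 < real N ^ xx s" using N by simp
      ultimately show ?thesis by (simp only: pos_le_divide_eq)
    qed
    have 2: "real (card (\<Union>w\<in>ws A Q. C Q w)) \<le> real s ^ xx s * ?b" if "A \<in> As s" "Q \<in> Qs A" for A Q
    proof -
      have f: "finite A" "finite Q" "card A = s" "card Q = xx s"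
        using finA[OF that(1)] finQ[OF that(2) finA[OF that(1)]] that by (simp_all add: As_def Qs_def)
      have "real (card (\<Union>w\<in>ws A Q. C Q w)) \<le> real (card (ws A Q)) * ?b"
        by (rule card_UN_le_const[OF finws[OF f(1,2)] 1[OF that]])
      moreover have "card (ws A Q) = s ^ xx s" using f by (simp add: ws_def card_PiE)
      ultimately show ?thesis by simp
    qed
    have 3: "real (card (\<Union>Q\<in>Qs A. \<Union>w\<in>ws A Q. C Q w)) \<le> real (s * K) ^ xx s * (real s ^ xx s * ?b)" if "A \<in> As s" for A
    proof -
      have f: "finite A" "card A = s" using finA[OF that] that by (simp_all add: As_def)
      have "real (card (\<Union>Q\<in>Qs A. \<Union>w\<in>ws A Q. C Q w)) \<le> real (card (Qs A)) * (real s ^ xx s * ?b)"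
        by (rule card_UN_le_const[OF finQs[OF f(1)] 2[OF that]])
      also have "\<dots> \<le> real ((s * K) ^ xx s) * (real s ^ xx s * ?b)"
      proof -
        have "card (Qs A) = (s * K) choose xx s" using f n_subsets[of "A \<times> {..<K}" "xx s"]
          by (simp add: Qs_def card_cartesian_product)
        also have "\<dots> \<le> (s * K) ^ xx s"
          by (cases "xx s \<le> s * K") (auto simp: binomial_le_pow binomial_eq_0)
        finally have "real (card (Qs A)) \<le> real ((s * K) ^ xx s)" by (simp only: of_nat_le_iff)
        then show ?thesis by (rule mult_right_mono) simp
      qed
      finally show ?thesis by simp
    qed
    have "real (card (\<Union>A\<in>As s. \<Union>Q\<in>Qs A. \<Union>w\<in>ws A Q. C Q w)) \<le> real (card (As s)) * (real (s * K) ^ xx s * (real s ^ xx s * ?b))"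
      by (rule card_UN_le_const[OF finAs 3])
    also have "\<dots> \<le> real (M ^ s) * (real (s * K) ^ xx s * (real s ^ xx s * ?b))"
    proof -
      have "card (As s) = M choose s" using n_subsets[of "{..<M}" s] by (simp add: As_def)
      also have "\<dots> \<le> M ^ s" by (cases "s \<le> M") (auto simp: binomial_le_pow binomial_eq_0)
      finally have "real (card (As s)) \<le> real (M ^ s)" by (simp only: of_nat_le_iff)
      then show ?thesis by (rule mult_right_mono) simp
    qed
    also have "\<dots> = real (N ^ (M * K)) * (real (M ^ s * (s\<^sup>2 * K) ^ xx s) / real (N ^ xx s))"
      by (simp add: power_mult_distrib power2_eq_square)
    also have "\<dots> \<le> real (N ^ (M * K)) * (1 / 8) ^ s"
    proof (rule mult_left_mono)
      have "8 ^ s * (M ^ s * (s\<^sup>2 * K) ^ xx s) = (8 * M) ^ s * (s\<^sup>2 * K) ^ xx s" by (simp add: power_mult_distrib)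
      also have "\<dots> \<le> Z ^ xx s * (s\<^sup>2 * K) ^ xx s" using Zx by (rule mult_right_mono) simp
      also have "\<dots> = (s\<^sup>2 * K * Z) ^ xx s" by (simp add: power_mult_distrib)
      also have "\<dots> \<le> N ^ xx s"
      proof (rule power_mono)
        have "s\<^sup>2 * K * Z \<le> W\<^sup>2 * K * Z" using s by (intro mult_right_mono power_mono) auto
        then show "s\<^sup>2 * K * Z \<le> N" using Z(1) by linarith
      qed simp
      finally have "real (8 ^ s * (M ^ s * (s\<^sup>2 * K) ^ xx s)) \<le> real (N ^ xx s)" by (simp only: of_nat_le_iff)
      then show "real (M ^ s * (s\<^sup>2 * K) ^ xx s) / real (N ^ xx s) \<le> (1 / 8) ^ s"
        using N by (simp add: divide_simps mult.commute)
    qed simp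
    finally show ?thesis .
  qed
  have "{h \<in> ?H. \<not> expands M K W D h} \<subseteq> (\<Union>s\<in>{1..W}. \<Union>A\<in>As s. \<Union>Q\<in>Qs A. \<Union>w\<in>ws A Q. C Q w)"
  proof
    fix h assume "h \<in> {h \<in> ?H. \<not> expands M K W D h}"
    then obtain A where A: "h \<in> ?H" "A \<subseteq> {..<M}" "A \<noteq> {}" "card A \<le> W"
      and ne: "3 * D * card A + 2 * D * card ((\<lambda>(a, i). (i, h (a, i))) ` (A \<times> {..<K})) \<le> 2 * D * K * card A + card A"
      by (auto simp: expands_def not_less)
    have fin: "finite A" using A(2) finite_subset by blast
    obtain Q w where Qw: "Q \<subseteq> A \<times> {..<K}" "card Q = xx (card A)" "w \<in> PiE Q (\<lambda>_. A)"
       "\<forall>p\<in>Q. w p < fst p \<and> h p = h (w p, snd p)"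
      using repeats_of_non_expanding[OF fin D ne xx2] by blast
    have "card A \<in> {1..W}" using A fin by (simp add: Suc_le_eq card_gt_0_iff)
    moreover have "A \<in> As (card A)" "Q \<in> Qs A" "w \<in> ws A Q" "h \<in> C Q w"
      using A Qw by (auto simp: As_def Qs_def ws_def C_def)
    ultimately show "h \<in> (\<Union>s\<in>{1..W}. \<Union>A\<in>As s. \<Union>Q\<in>Qs A. \<Union>w\<in>ws A Q. C Q w)" by blast
  qed
  then have "card {h \<in> ?H. \<not> expands M K W D h} \<le> card (\<Union>s\<in>{1..W}. \<Union>A\<in>As s. \<Union>Q\<in>Qs A. \<Union>w\<in>ws A Q. C Q w)"
    using finC finAs finQs[OF finA] finws[OF finA finQ[OF _ finA]] by (intro card_mono finite_UN_I) blast+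
  also have "\<dots> \<le> (\<Sum>s\<in>{1..W}. card (\<Union>A\<in>As s. \<Union>Q\<in>Qs A. \<Union>w\<in>ws A Q. C Q w))"
    by (rule card_UN_le) simp
  finally have "real (card {h \<in> ?H. \<not> expands M K W D h}) \<le> (\<Sum>s\<in>{1..W}. real (card (\<Union>A\<in>As s. \<Union>Q\<in>Qs A. \<Union>w\<in>ws A Q. C Q w)))"
    by (simp only: of_nat_sum[symmetric] of_nat_le_iff)
  also have "\<dots> \<le> (\<Sum>s\<in>{1..W}. real (N ^ (M * K)) * (1 / 8) ^ s)" by (rule sum_mono, rule "term") simp
  also have "\<dots> = real (N ^ (M * K)) * (\<Sum>s\<in>{1..W}. (1 / 8) ^ s)" by (simp add: sum_distrib_left)
  also have "(\<Sum>s\<in>{1..W}. (1 / 8 :: real) ^ s) = (1 - (1 / 8) ^ W) / 7"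
  proof (induction W)
    case (Suc W)
    have "(\<Sum>s\<in>{1..Suc W}. (1 / 8 :: real) ^ s) = (\<Sum>s\<in>{1..W}. (1 / 8) ^ s) + 1 / 8 * (1 / 8) ^ W"
      by (simp only: sum.cl_ivl_Suc power_Suc) simp
    moreover have "(1 - p) / 7 + 1 / 8 * p = (1 - 1 / 8 * p) / 7" for p :: real by (simp add: field_simps)
    ultimately show ?case unfolding Suc power_Suc by (simp only:)
  qed simp
  also have "real (N ^ (M * K)) * ((1 - (1 / 8) ^ W) / 7) \<le> real (N ^ (M * K)) * (1 / 7)"
    by (intro mult_left_mono) auto
  finally show ?thesis by simp
qed

section \<open>Short cycles and variables of high degree\<close>

definition closed_cycle :: "(nat \<times> nat \<Rightarrow> nat) \<Rightarrow> nat list \<Rightarrow> nat list \<Rightarrow> bool" where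
  "closed_cycle h as is \<longleftrightarrow> (\<forall>j<length as. h (as ! j, is ! j) = h (as ! (Suc j mod length as), is ! j))"

text \<open>Two different variables of one clause lie in different blocks, so consecutive positions
  along a cycle must differ.\<close>

definition cycle_shapes :: "nat \<Rightarrow> nat \<Rightarrow> nat \<Rightarrow> (nat list \<times> nat list) set" where
  "cycle_shapes M K l = {(as, is). length as = l \<and> length is = l \<and> set as \<subseteq> {..<M} \<and> set is \<subseteq> {..<K} \<and> distinct as \<and>
     (\<forall>j<l. is ! j \<noteq> is ! (Suc j mod l))}"

text \<open>Recording only the edge that closes the cycle suffices, since every edge of a cycle
  closes one of its rotations, possibly after reversal.\<close>

definition cycle_edges :: "nat \<Rightarrow> nat \<Rightarrow> nat \<Rightarrow> (nat \<times> nat \<Rightarrow> nat) \<Rightarrow> (nat \<times> nat) set" where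
  "cycle_edges M K k h = {(hd as, last is) | as is l. 2 \<le> l \<and> l \<le> k \<and> (as, is) \<in> cycle_shapes M K l \<and> closed_cycle h as is}"

definition heavy_edges :: "nat \<Rightarrow> nat \<Rightarrow> nat \<Rightarrow> (nat \<times> nat \<Rightarrow> nat) \<Rightarrow> (nat \<times> nat) set" where
  "heavy_edges M K \<Delta> h = {(a, i) \<in> {..<M} \<times> {..<K}. \<Delta> < card {a'. a' < M \<and> h (a', i) = h (a, i)}}"

lemma finite_cycle_shapes: "finite (cycle_shapes M K l)"
  and card_cycle_shapes: "card (cycle_shapes M K l) \<le> (M * K) ^ l"
proof -
  let ?S = "{as. set as \<subseteq> {..<M} \<and> length as = l} \<times> {is. set is \<subseteq> {..<K} \<and> length is = l}"
  have sub: "cycle_shapes M K l \<subseteq> ?S" by (auto simp: cycle_shapes_def)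
  have fin: "finite ?S" by (simp add: finite_lists_length_eq)
  show "finite (cycle_shapes M K l)" using sub fin by (rule finite_subset)
  have "card ?S = (M * K) ^ l" by (simp add: card_cartesian_product card_lists_length_eq power_mult_distrib)
  then show "card (cycle_shapes M K l) \<le> (M * K) ^ l" using card_mono[OF fin sub] by simp
qed

text \<open>The \<open>l\<close> equations determine \<open>l\<close> distinct incidences. None of
  these serves as a source, because consecutive positions differ, so a rank with two values excludes
  circularity.\<close>

lemma card_closed_cycle:
  assumes l: "l \<ge> 2" and s: "(as, is) \<in> cycle_shapes M K l"
  shows "card {h \<in> hypergraphs M K N. closed_cycle h as is} * N ^ l \<le> N ^ (M * K)"
proof -
  have len: "length as = l" "length is = l" "set as \<subseteq> {..<M}" "set is \<subseteq> {..<K}" "distinct as"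
    "\<And>j. j < l \<Longrightarrow> is ! j \<noteq> is ! (Suc j mod l)" using s by (simp_all add: cycle_shapes_def)
  let ?f = "\<lambda>j. (as ! (Suc j mod l), is ! j)" and ?g = "\<lambda>j. (as ! j, is ! j)"
  have modl: "j mod l < l" for j using l by simp
  have inA: "as ! j < M" "is ! j < K" if "j < l" for j proof -
    have "as ! j \<in> set as" "is ! j \<in> set is" using len(1,2) that by simp_all
    then show "as ! j < M" "is ! j < K" using len(3,4) by blast+
  qed
  have mod_inj: "j = j'" if "j < l" "j' < l" "Suc j mod l = Suc j' mod l" for j j'
    using that by (auto simp: mod_Suc split: if_splits)
  have as_inj: "x = y" if "x < l" "y < l" "as ! x = as ! y" for x y
    using that len(1,5) nth_eq_iff_index_eq[of as x y] by simp
  have "card {h \<in> PiE ({..<M} \<times> {..<K}) (\<lambda>_. {..<N}). \<forall>j\<in>{..<l}. h (?f j) = h (?g j)} * card {..<N} ^ card {..<l}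
      \<le> card {..<N} ^ card ({..<M} \<times> {..<K})"
  proof (rule card_identified[where rk = "\<lambda>p. if p \<in> ?f ` {..<l} then 1 else 0"])
    show "inj_on ?f {..<l}"
    proof (rule inj_onI)
      fix x y assume xy: "x \<in> {..<l}" "y \<in> {..<l}" "?f x = ?f y"
      then have "Suc x mod l = Suc y mod l" by (intro as_inj[OF modl modl]) simp
      then show "x = y" using mod_inj[of x y] xy(1,2) by simp
    qed
    show "?f ` {..<l} \<subseteq> {..<M} \<times> {..<K}" "?g ` {..<l} \<subseteq> {..<M} \<times> {..<K}" using inA modl by auto
    fix j assume j: "j \<in> {..<l}"
    have "?g j \<notin> ?f ` {..<l}"
    proof
      assume "?g j \<in> ?f ` {..<l}"
      then obtain j' where j': "j' < l" "as ! j = as ! (Suc j' mod l)" "is ! j = is ! j'" by auto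
      then have "j = Suc j' mod l" using as_inj[of j "Suc j' mod l"] j modl by auto
      then show False using len(6)[OF j'(1)] j' by simp
    qed
    then show "(if ?g j \<in> ?f ` {..<l} then 1 else 0) < (if ?f j \<in> ?f ` {..<l} then 1 else (0 :: nat))" using j by auto
  qed auto
  moreover have "{h \<in> hypergraphs M K N. closed_cycle h as is} =
      {h \<in> PiE ({..<M} \<times> {..<K}) (\<lambda>_. {..<N}). \<forall>j\<in>{..<l}. h (?f j) = h (?g j)}"
    by (auto simp: hypergraphs_def closed_cycle_def len)
  ultimately show ?thesis by (simp add: card_cartesian_product)
qed

lemma markov_count:
  assumes "finite H" and "(\<Sum>h\<in>H. real (\<xi> h)) \<le> t * b" "b > 0"
  shows "real (card {h \<in> H. b < real (\<xi> h)}) \<le> t"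
proof -
  have "real (card {h \<in> H. b < real (\<xi> h)}) * b = (\<Sum>h\<in>{h \<in> H. b < real (\<xi> h)}. b)" by simp
  also have "\<dots> \<le> (\<Sum>h\<in>{h \<in> H. b < real (\<xi> h)}. real (\<xi> h))" by (rule sum_mono) simp
  also have "\<dots> \<le> (\<Sum>h\<in>H. real (\<xi> h))" using assms(1) by (intro sum_mono2) auto
  finally have "real (card {h \<in> H. b < real (\<xi> h)}) * b \<le> t * b" using assms(2) by simp
  then show ?thesis using assms(3) by simp
qed

text \<open>Markov's inequality: a shape of length \<open>l\<close> closes with probability at most
  \<open>1 / N ^ l\<close>, so the mean is at most the sum of the powers
  \<open>(M * K / N) ^ l\<close>. As \<open>N \<le> M * K\<close>, each of them is at most the one
  for \<open>l = k\<close>.\<close>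

lemma card_many_cycle_edges:
  assumes N: "N \<ge> 1" "N \<le> M * K" and small: "64 * k * (M * K) ^ k \<le> N ^ k * (M * K)" and MK: "M * K \<ge> 1"
  shows "real (card {h \<in> hypergraphs M K N. real (M * K) / 8 < real (card (cycle_edges M K k h))}) \<le> real (N ^ (M * K)) / 8"
proof (rule markov_count[OF card_hypergraphs(2)])
  let ?H = "hypergraphs M K N"
  define Sh where "Sh = (SIGMA l:{2..k}. cycle_shapes M K l)"
  have finSh: "finite Sh" by (simp add: Sh_def finite_cycle_shapes)
  have le: "card (cycle_edges M K k h) \<le> (\<Sum>(l, as, is)\<in>Sh. of_bool (closed_cycle h as is))" for h
  proof -
    have "cycle_edges M K k h \<subseteq> (\<lambda>(l, as, is). (hd as, last is)) ` {(l, as, is) \<in> Sh. closed_cycle h as is}"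
      by (force simp: cycle_edges_def Sh_def)
    moreover have f: "finite {(l, as, is) \<in> Sh. closed_cycle h as is}" by (rule finite_subset[OF _ finSh]) auto
    ultimately have "card (cycle_edges M K k h) \<le> card {(l, as, is) \<in> Sh. closed_cycle h as is}"
      by (meson card_image_le card_mono finite_imageI order_trans)
    also have "\<dots> = (\<Sum>x\<in>{(l, as, is) \<in> Sh. closed_cycle h as is}. 1)" by simp
    also have "\<dots> = (\<Sum>(l, as, is)\<in>Sh. of_bool (closed_cycle h as is))"
      by (rule sum.mono_neutral_cong_left) (use finSh in auto)
    finally show ?thesis .
  qed
  have "(\<Sum>h\<in>?H. real (card (cycle_edges M K k h))) \<le> (\<Sum>h\<in>?H. real (\<Sum>(l, as, is)\<in>Sh. of_bool (closed_cycle h as is)))"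
    by (intro sum_mono) (simp only: of_nat_le_iff le)
  also have "\<dots> = (\<Sum>h\<in>?H. \<Sum>(l, as, is)\<in>Sh. of_bool (closed_cycle h as is))"
    by (simp add: case_prod_unfold)
  also have "\<dots> = (\<Sum>(l, as, is)\<in>Sh. \<Sum>h\<in>?H. of_bool (closed_cycle h as is))"
    unfolding case_prod_unfold by (rule sum.swap)
  also have "\<dots> = (\<Sum>(l, as, is)\<in>Sh. real (card {h \<in> ?H. closed_cycle h as is}))"
    using card_hypergraphs(2) by (simp add: sum.If_cases of_bool_def Int_def)
  also have "\<dots> \<le> (\<Sum>(l, as, is)\<in>Sh. real (N ^ (M * K)) / real N ^ l)"
  proof (rule sum_mono, clarify)
    fix l as "is" assume "(l, as, is) \<in> Sh"
    then have "card {h \<in> ?H. closed_cycle h as is} * N ^ l \<le> N ^ (M * K)" using card_closed_cycle by (auto simp: Sh_def)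
    then have "real (card {h \<in> ?H. closed_cycle h as is} * N ^ l) \<le> real (N ^ (M * K))" by (simp only: of_nat_le_iff)
    then show "real (card {h \<in> ?H. closed_cycle h as is}) \<le> real (N ^ (M * K)) / real N ^ l"
      using N by (simp add: pos_le_divide_eq)
  qed
  also have "\<dots> = (\<Sum>l\<in>{2..k}. \<Sum>x\<in>cycle_shapes M K l. real (N ^ (M * K)) / real N ^ l)"
    unfolding Sh_def using finite_cycle_shapes by (subst sum.Sigma) (auto simp: case_prod_unfold)
  also have "\<dots> \<le> (\<Sum>l\<in>{2..k}. real (N ^ (M * K)) * (real (M * K) / real N) ^ k)"
  proof (rule sum_mono)
    fix l assume l: "l \<in> {2..k}"
    have "(\<Sum>x\<in>cycle_shapes M K l. real (N ^ (M * K)) / real N ^ l) = real (card (cycle_shapes M K l)) * (real (N ^ (M * K)) / real N ^ l)"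
      by simp
    also have "\<dots> \<le> real ((M * K) ^ l) * (real (N ^ (M * K)) / real N ^ l)"
      using card_cycle_shapes[of M K l] by (intro mult_right_mono) (simp_all only: of_nat_le_iff, simp)
    also have "\<dots> = real (N ^ (M * K)) * (real (M * K) / real N) ^ l" by (simp add: power_divide)
    also have "\<dots> \<le> real (N ^ (M * K)) * (real (M * K) / real N) ^ k"
    proof (rule mult_left_mono, rule power_increasing)
      have "real N \<le> real (M * K)" using N(2) by (simp only: of_nat_le_iff)
      then show "1 \<le> real (M * K) / real N" using N(1) by (simp add: pos_le_divide_eq)
    qed (use l in auto)
    finally show "(\<Sum>x\<in>cycle_shapes M K l. real (N ^ (M * K)) / real N ^ l) \<le> real (N ^ (M * K)) * (real (M * K) / real N) ^ k" .
  qed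
  also have "\<dots> \<le> real k * (real (N ^ (M * K)) * (real (M * K) / real N) ^ k)"
    by (simp del: of_nat_mult of_nat_power) (intro mult_right_mono, auto)
  also have "\<dots> \<le> real (N ^ (M * K)) / 8 * (real (M * K) / 8)"
  proof -
    have "real (64 * k * (M * K) ^ k) \<le> real (N ^ k * (M * K))" using small by (simp only: of_nat_le_iff)
    then have "real k * (real (M * K) / real N) ^ k \<le> real (M * K) / 64"
      using N(1) by (simp add: power_divide pos_divide_le_eq mult.commute mult.left_commute)
    then have "real (N ^ (M * K)) * (real k * (real (M * K) / real N) ^ k) \<le> real (N ^ (M * K)) * (real (M * K) / 64)"
      by (rule mult_left_mono) simp
    then show ?thesis by (simp add: mult_ac)
  qed
  finally show "(\<Sum>h\<in>?H. real (card (cycle_edges M K k h))) \<le> real (N ^ (M * K)) / 8 * (real (M * K) / 8)" .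
  show "0 < real (M * K) / 8" using MK by simp
qed

text \<open>A heavy edge shares its variable with at least \<open>\<Delta>\<close> other clauses,
  and the mean number of ordered coincidences is at most \<open>M * M * K / N\<close>; Markov's
  inequality does the rest.\<close>

lemma card_many_heavy_edges:
  assumes N: "N \<ge> 1" and small: "64 * M \<le> N * \<Delta>" and MK: "M * K \<ge> 1"
  shows "real (card {h \<in> hypergraphs M K N. real (M * K) / 8 < real (card (heavy_edges M K \<Delta> h))}) \<le> real (N ^ (M * K)) / 8"
proof (rule markov_count[OF card_hypergraphs(2)])
  let ?H = "hypergraphs M K N"
  define Sh where "Sh = {(a, a', i). a < M \<and> a' < M \<and> i < K \<and> a \<noteq> a'}"
  have Shsub: "Sh \<subseteq> {..<M} \<times> {..<M} \<times> {..<K}" by (auto simp: Sh_def)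
  then have finSh: "finite Sh" using finite_subset by blast
  have cardSh: "card Sh \<le> M * M * K" using card_mono[OF _ Shsub] by (simp add: card_cartesian_product mult.assoc)
  have D0: "\<Delta> > 0" using small MK by (cases \<Delta>) auto
  have le: "card (heavy_edges M K \<Delta> h) * \<Delta> \<le> (\<Sum>(a, a', i)\<in>Sh. of_bool (h (a', i) = h (a, i)))" for h
  proof -
    let ?E = "heavy_edges M K \<Delta> h"
    have fE: "finite ?E" by (rule finite_subset[of _ "{..<M} \<times> {..<K}"]) (auto simp: heavy_edges_def)
    let ?B = "\<lambda>(a, i). {a'. a' < M \<and> a' \<noteq> a \<and> h (a', i) = h (a, i)}"
    have "card ?E * \<Delta> = (\<Sum>x\<in>?E. \<Delta>)" by simp
    also have "\<dots> \<le> (\<Sum>x\<in>?E. card (?B x))"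
    proof (rule sum_mono, clarify)
      fix a i assume ai: "(a, i) \<in> ?E"
      have "{a'. a' < M \<and> h (a', i) = h (a, i)} = insert a {a'. a' < M \<and> a' \<noteq> a \<and> h (a', i) = h (a, i)}"
        using ai by (auto simp: heavy_edges_def)
      then have "card {a'. a' < M \<and> h (a', i) = h (a, i)} = Suc (card {a'. a' < M \<and> a' \<noteq> a \<and> h (a', i) = h (a, i)})" by simp
      then show "\<Delta> \<le> card {a'. a' < M \<and> a' \<noteq> a \<and> h (a', i) = h (a, i)}" using ai by (auto simp: heavy_edges_def)
    qed
    also have "\<dots> = card (Sigma ?E ?B)" using fE by (subst card_SigmaI) (auto simp: case_prod_unfold)
    also have "\<dots> = card ((\<lambda>((a, i), a'). (a, a', i)) ` Sigma ?E ?B)" by (rule card_image[symmetric]) (auto simp: inj_on_def)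
    also have "\<dots> \<le> card {(a, a', i) \<in> Sh. h (a', i) = h (a, i)}"
      by (rule card_mono, rule finite_subset[OF _ finSh]) (auto simp: Sh_def heavy_edges_def)
    also have "\<dots> = (\<Sum>x\<in>{(a, a', i) \<in> Sh. h (a', i) = h (a, i)}. 1)" by simp
    also have "\<dots> = (\<Sum>(a, a', i)\<in>Sh. of_bool (h (a', i) = h (a, i)))"
      by (rule sum.mono_neutral_cong_left) (use finSh in auto)
    finally show ?thesis .
  qed
  have "(\<Sum>h\<in>?H. real (card (heavy_edges M K \<Delta> h))) * real \<Delta> \<le> (\<Sum>h\<in>?H. real (\<Sum>(a, a', i)\<in>Sh. of_bool (h (a', i) = h (a, i))))"
    unfolding sum_distrib_right of_nat_mult[symmetric] by (intro sum_mono) (simp only: of_nat_le_iff le)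
  also have "\<dots> = (\<Sum>h\<in>?H. \<Sum>(a, a', i)\<in>Sh. of_bool (h (a', i) = h (a, i)))"
    by (simp add: case_prod_unfold)
  also have "\<dots> = (\<Sum>(a, a', i)\<in>Sh. \<Sum>h\<in>?H. of_bool (h (a', i) = h (a, i)))"
    unfolding case_prod_unfold by (rule sum.swap)
  also have "\<dots> = (\<Sum>(a, a', i)\<in>Sh. real (card {h \<in> ?H. h (a', i) = h (a, i)}))"
    using card_hypergraphs(2) by (simp add: sum.If_cases of_bool_def Int_def)
  also have "\<dots> \<le> (\<Sum>(a, a', i)\<in>Sh. real (N ^ (M * K)) / real N)"
  proof (rule sum_mono, clarify)
    fix a a' i assume s: "(a, a', i) \<in> Sh"
    have "card {h \<in> PiE ({..<M} \<times> {..<K}) (\<lambda>_. {..<N}). \<forall>j\<in>{0 :: nat}. h ((\<lambda>_. (a', i)) j) = h ((\<lambda>_. (a, i)) j)} * card {..<N} ^ card {0 :: nat}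
      \<le> card {..<N} ^ card ({..<M} \<times> {..<K})"
      by (rule card_identified[where rk = "\<lambda>p. if p = (a', i) then 1 else 0"]) (use s in \<open>auto simp: Sh_def\<close>)
    then have "card {h \<in> ?H. h (a', i) = h (a, i)} * N \<le> N ^ (M * K)" by (simp add: hypergraphs_def card_cartesian_product)
    then have "real (card {h \<in> ?H. h (a', i) = h (a, i)} * N) \<le> real (N ^ (M * K))" by (simp only: of_nat_le_iff)
    then show "real (card {h \<in> ?H. h (a', i) = h (a, i)}) \<le> real (N ^ (M * K)) / real N"
      using N by (simp add: pos_le_divide_eq)
  qed
  also have "\<dots> = real (card Sh) * (real (N ^ (M * K)) / real N)" by (simp add: case_prod_unfold)
  also have "\<dots> \<le> real (M * M * K) * (real (N ^ (M * K)) / real N)"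
    using cardSh by (intro mult_right_mono) (simp_all only: of_nat_le_iff, simp)
  also have "\<dots> \<le> (real (N ^ (M * K)) / 8 * (real (M * K) / 8)) * real \<Delta>"
  proof -
    have "real (64 * M) \<le> real (N * \<Delta>)" using small by (simp only: of_nat_le_iff)
    then have "real M / real N \<le> real \<Delta> / 64" using N by (simp add: field_simps)
    then have "(real (M * K) * real (N ^ (M * K))) * (real M / real N) \<le> (real (M * K) * real (N ^ (M * K))) * (real \<Delta> / 64)"
      by (rule mult_left_mono) simp
    then show ?thesis by (simp add: mult_ac)
  qed
  finally show "(\<Sum>h\<in>?H. real (card (heavy_edges M K \<Delta> h))) \<le> real (N ^ (M * K)) / 8 * (real (M * K) / 8)"
    using D0 by simp
  show "0 < real (M * K) / 8" using MK by simp
qed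

text \<open>The three bad events take fractions of at most \<open>1/7\<close>, \<open>1/8\<close>
  and \<open>1/8\<close>, less than 1 together.\<close>

lemma good_hypergraph_exists:
  assumes "D \<ge> 1" "M \<ge> 1" "K \<ge> 1" "N \<ge> 1" "N \<le> M * K"
    and "W\<^sup>2 * K * Z \<le> N" "(8 * M) ^ (2 * D) \<le> Z ^ (3 * D - 1)"
    and "64 * k * (M * K) ^ k \<le> N ^ k * (M * K)" "64 * M \<le> N * \<Delta>"
  shows "\<exists>h. h \<in> hypergraphs M K N \<and> expands M K W D h \<and>
     real (card (cycle_edges M K k h)) \<le> real (M * K) / 8 \<and> real (card (heavy_edges M K \<Delta> h)) \<le> real (M * K) / 8"
proof (rule ccontr)
  let ?H = "hypergraphs M K N" and ?T = "real (N ^ (M * K))"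
  let ?A = "{h \<in> ?H. \<not> expands M K W D h}" and ?B = "{h \<in> ?H. real (M * K) / 8 < real (card (cycle_edges M K k h))}"
    and ?C = "{h \<in> ?H. real (M * K) / 8 < real (card (heavy_edges M K \<Delta> h))}"
  assume n: "\<not> ?thesis"
  have "?H \<subseteq> ?A \<union> ?B \<union> ?C"
  proof
    fix h assume "h \<in> ?H"
    then show "h \<in> ?A \<union> ?B \<union> ?C" using n by (auto simp: not_le)
  qed
  then have "card ?H \<le> card (?A \<union> ?B \<union> ?C)" using card_hypergraphs(2) by (intro card_mono) auto
  also have "\<dots> \<le> card ?A + card ?B + card ?C" by (meson add_le_mono1 card_Un_le order_trans)
  finally have "?T \<le> real (card ?A) + real (card ?B) + real (card ?C)" by (simp only: card_hypergraphs of_nat_add[symmetric] of_nat_le_iff)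
  moreover have MK: "M * K \<ge> 1" using assms(2,3) by simp
  moreover have "real (card ?A) \<le> ?T / 7" using assms by (intro card_non_expanding)
  moreover have "real (card ?B) \<le> ?T / 8" using assms MK by (intro card_many_cycle_edges)
  moreover have "real (card ?C) \<le> ?T / 8" using assms MK by (intro card_many_heavy_edges)
  moreover have "?T > 0" using assms by simp
  ultimately show False by linarith
qed

section \<open>Random shifts\<close>

text \<open>The label sets of the variables are given as lists of length \<open>\<tau>\<close>
  inside \<open>T\<close>, so that their number in the union bound is a power of the field
  size.\<close>

definition hit_set :: "nat \<Rightarrow> nat \<Rightarrow> nat \<Rightarrow> (nat \<times> nat \<Rightarrow> nat) \<Rightarrow> (nat \<Rightarrow> 'f :: field) \<Rightarrow> (nat \<times> nat \<Rightarrow> 'f) \<Rightarrow>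
    (nat \<Rightarrow> 'f \<times> 'f) \<Rightarrow> (nat \<times> nat \<times> nat \<Rightarrow> 'f) \<Rightarrow> (nat \<times> nat) set" where
  "hit_set M K \<tau> h \<theta> c \<alpha> T = {(a, i) \<in> {..<M} \<times> {..<K}.
     fst (\<alpha> a) + \<theta> i * snd (\<alpha> a) + c (a, i) \<in> (\<lambda>m. T (i, h (a, i), m)) ` {..<\<tau>}}"

text \<open>An exponential moment with base \<open>6\<close>; the loss \<open>(1 + 1/z)\<^sup>z \<le> 3\<close> per expected hit leaves a factor \<open>2\<close>.\<close>

lemma card_many_hits:
  fixes F :: "'f :: field set"
  assumes F: "finite F" "card F = q" "q \<ge> 1" and z: "6 * \<tau> * z \<le> q" "z \<ge> 1" and H: "M * K = z * H"
  shows "real (card {c \<in> PiE ({..<M} \<times> {..<K}) (\<lambda>_. F). H \<le> card (hit_set M K \<tau> h \<theta> c \<alpha> T)}) \<le> real q ^ (M * K) / 2 ^ H"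
proof -
  let ?P = "{..<M} \<times> {..<K}"
  let ?C = "PiE ?P (\<lambda>_. F)"
  define hit where "hit = (\<lambda>(a, i) x. fst (\<alpha> a) + \<theta> i * snd (\<alpha> a) + x \<in> (\<lambda>m. T (i, h (a, i), m)) ` {..<\<tau>})"
  have hs: "hit_set M K \<tau> h \<theta> c \<alpha> T = {p \<in> ?P. hit p (c p)}" for c by (auto simp: hit_set_def hit_def)
  have fC: "finite ?C" using F by (auto intro!: finite_PiE)
  have few: "card {x \<in> F. hit p x} \<le> \<tau>" for p
  proof -
    obtain a i where p: "p = (a, i)" by (cases p)
    let ?T = "(\<lambda>m. T (i, h (a, i), m)) ` {..<\<tau>}"
    have "card {x \<in> F. hit p x} \<le> card ?T"
      by (rule card_inj_on_le[where f = "\<lambda>x. fst (\<alpha> a) + \<theta> i * snd (\<alpha> a) + x"]) (auto simp: inj_on_def hit_def p)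
    also have "\<dots> \<le> \<tau>" using card_image_le[of "{..<\<tau>}" "\<lambda>m. T (i, h (a, i), m)"] by simp
    finally show ?thesis .
  qed
  have "real (card {c \<in> ?C. H \<le> card (hit_set M K \<tau> h \<theta> c \<alpha> T)}) * 6 ^ H = (\<Sum>c\<in>{c \<in> ?C. H \<le> card {p \<in> ?P. hit p (c p)}}. 6 ^ H)"
    by (simp add: hs)
  also have "\<dots> \<le> (\<Sum>c\<in>{c \<in> ?C. H \<le> card {p \<in> ?P. hit p (c p)}}. 6 ^ card {p \<in> ?P. hit p (c p)})"
    by (intro sum_mono power_increasing) auto
  also have "\<dots> \<le> (\<Sum>c\<in>?C. 6 ^ card {p \<in> ?P. hit p (c p)})"
    using fC by (intro sum_mono2) auto
  also have "\<dots> = (\<Sum>c\<in>?C. \<Prod>p\<in>?P. if hit p (c p) then 6 else (1 :: real))"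
    by (intro sum.cong refl) (simp add: prod.If_cases Int_def)
  also have "\<dots> = (\<Prod>p\<in>?P. \<Sum>x\<in>F. if hit p x then 6 else 1)"
    using F by (intro prod_sum_PiE[symmetric]) auto
  also have "\<dots> \<le> (\<Prod>p\<in>?P. real q * (1 + 1 / real z))"
  proof (rule prod_mono, intro conjI)
    fix p
    show "0 \<le> (\<Sum>x\<in>F. if hit p x then 6 else 1 :: real)" by (intro sum_nonneg) auto
    have "(\<Sum>x\<in>F. if hit p x then 6 else 1 :: real) = (\<Sum>x\<in>F. 1 + (if hit p x then 5 else 0))"
      by (intro sum.cong) auto
    also have "\<dots> = real q + 5 * real (card {x \<in> F. hit p x})"
      using F by (simp add: sum.distrib sum.If_cases Int_def)
    also have "\<dots> \<le> real q + 6 * real \<tau>" using few[of p] by simp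
    also have "\<dots> \<le> real q * (1 + 1 / real z)"
    proof -
      have "real (6 * \<tau> * z) \<le> real q" using z(1) by (simp only: of_nat_le_iff)
      then have "6 * real \<tau> \<le> real q / real z" using z(2) by (simp add: pos_le_divide_eq)
      then show ?thesis by (simp add: distrib_left)
    qed
    finally show "(\<Sum>x\<in>F. if hit p x then 6 else 1 :: real) \<le> real q * (1 + 1 / real z)" .
  qed
  also have "\<dots> = real q ^ (M * K) * ((1 + 1 / real z) ^ z) ^ H"
    by (simp add: card_cartesian_product power_mult_distrib H power_mult)
  also have "\<dots> \<le> real q ^ (M * K) * 3 ^ H"
  proof -
    have "(1 + 1 / real z) ^ z \<le> exp (1 / real z) ^ z" by (intro power_mono) (auto simp: exp_ge_add_one_self)
    also have "\<dots> = exp 1" using z(2) by (simp add: exp_of_nat_mult[symmetric])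
    also have "\<dots> \<le> 3" by (rule exp_le)
    finally show ?thesis by (intro mult_left_mono power_mono) auto
  qed
  finally have "real (card {c \<in> ?C. H \<le> card (hit_set M K \<tau> h \<theta> c \<alpha> T)}) * 6 ^ H \<le> real q ^ (M * K) * 3 ^ H" .
  moreover have "(6 :: real) ^ H = 2 ^ H * 3 ^ H" by (simp add: power_mult_distrib[symmetric])
  ultimately have "(real (card {c \<in> ?C. H \<le> card (hit_set M K \<tau> h \<theta> c \<alpha> T)}) * 2 ^ H) * 3 ^ H \<le> real q ^ (M * K) * 3 ^ H"
    by (simp add: mult.assoc)
  then have "real (card {c \<in> ?C. H \<le> card (hit_set M K \<tau> h \<theta> c \<alpha> T)}) * 2 ^ H \<le> real q ^ (M * K)"
    by (rule mult_right_le_imp_le) simp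
  then show ?thesis by (simp add: pos_le_divide_eq)
qed

text \<open>Union bound: with \<open>q = 2 ^ m\<close> there are \<open>q ^ (2 * M)\<close> choices
  of \<open>\<alpha>\<close> and \<open>q ^ (K * N * \<tau>)\<close> of \<open>T\<close>, each bad
  for a fraction of at most \<open>1 / 2 ^ H\<close> of the shifts.\<close>

lemma sound_shift_exists:
  fixes F :: "'f :: field set"
  assumes F: "finite F" "card F = 2 ^ m" and z: "6 * \<tau> * z \<le> 2 ^ m" "z \<ge> 1" and H: "M * K = z * H"
    and big: "m * (K * N * \<tau> + 2 * M) < H"
  shows "\<exists>c \<in> PiE ({..<M} \<times> {..<K}) (\<lambda>_. F). \<forall>\<alpha> \<in> PiE {..<M} (\<lambda>_. F \<times> F).
     \<forall>T \<in> PiE ({..<K} \<times> {..<N} \<times> {..<\<tau>}) (\<lambda>_. F). card (hit_set M K \<tau> h \<theta> c \<alpha> T) < H"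
proof (rule ccontr)
  assume n: "\<not> ?thesis"
  let ?C = "PiE ({..<M} \<times> {..<K}) (\<lambda>_. F)"
  let ?A = "PiE {..<M} (\<lambda>_. F \<times> F)" and ?T = "PiE ({..<K} \<times> {..<N} \<times> {..<\<tau>}) (\<lambda>_. F)"
  let ?B = "\<lambda>\<alpha> T. {c \<in> ?C. H \<le> card (hit_set M K \<tau> h \<theta> c \<alpha> T)}"
  let ?q = "2 ^ m :: nat"
  have fin: "finite ?A" "finite ?T" "finite ?C" using F by (auto intro!: finite_PiE)
  have cA: "card ?A = ?q ^ (2 * M)" using F by (simp add: card_PiE card_cartesian_product power_mult power2_eq_square)
  have cT: "card ?T = ?q ^ (K * N * \<tau>)" using F by (simp add: card_PiE card_cartesian_product mult.assoc)
  have cC: "card ?C = ?q ^ (M * K)" using F by (simp add: card_PiE card_cartesian_product)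
  have q1: "?q \<ge> 1" by simp
  have 1: "real (card (?B \<alpha> T)) \<le> real ?q ^ (M * K) / 2 ^ H" for \<alpha> T
    by (rule card_many_hits[OF F q1 z H])
  have "?C \<subseteq> (\<Union>\<alpha>\<in>?A. \<Union>T\<in>?T. ?B \<alpha> T)"
  proof
    fix c assume "c \<in> ?C"
    then show "c \<in> (\<Union>\<alpha>\<in>?A. \<Union>T\<in>?T. ?B \<alpha> T)" using n by (auto simp: not_less)
  qed
  then have "card ?C \<le> card (\<Union>\<alpha>\<in>?A. \<Union>T\<in>?T. ?B \<alpha> T)" using fin by (intro card_mono) auto
  then have "real (card ?C) \<le> real (card (\<Union>\<alpha>\<in>?A. \<Union>T\<in>?T. ?B \<alpha> T))" by (simp only: of_nat_le_iff)
  also have "\<dots> \<le> real (card ?A) * (real (card ?T) * (real ?q ^ (M * K) / 2 ^ H))"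
    by (intro card_UN_le_const fin 1)
  also have "real (card ?A) * (real (card ?T) * (real ?q ^ (M * K) / 2 ^ H)) = real ?q ^ (M * K) * (real (card ?A * card ?T) / 2 ^ H)"
    by (simp only: of_nat_mult times_divide_eq_right mult_ac)
  also have "card ?A * card ?T = 2 ^ (m * (K * N * \<tau> + 2 * M))"
    by (simp only: cA cT power_mult[symmetric] power_add distrib_left mult.commute)
  also have "real ?q ^ (M * K) * (real (2 ^ (m * (K * N * \<tau> + 2 * M))) / 2 ^ H) < real ?q ^ (M * K) * 1"
  proof (rule mult_strict_left_mono)
    have "(2 :: real) ^ (m * (K * N * \<tau> + 2 * M)) < 2 ^ H" by (rule power_strict_increasing[OF big]) simp
    then show "real (2 ^ (m * (K * N * \<tau> + 2 * M))) / 2 ^ H < 1" by simp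
  qed simp
  finally show False by (simp add: cC)
qed

lemma cover_by_function:
  assumes "finite A" "A \<subseteq> F" "card A \<le> \<tau>" "f0 \<in> F"
  shows "\<exists>t. (\<forall>m<\<tau>. t m \<in> F) \<and> A \<subseteq> t ` {..<\<tau> :: nat}"
proof -
  obtain b where b: "bij_betw b {..<card A} A" using ex_bij_betw_nat_finite[OF assms(1)] by (auto simp: lessThan_atLeast0)
  let ?t = "\<lambda>m. if m < card A then b m else f0"
  have "?t m \<in> F" for m using bij_betwE[OF b] assms(2,4) by auto
  moreover have "A \<subseteq> ?t ` {..<\<tau>}"
  proof
    fix x assume "x \<in> A"
    then obtain m where "m < card A" "x = b m" using bij_betw_imp_surj_on[OF b] by auto
    then show "x \<in> ?t ` {..<\<tau>}" using assms(3) by (intro image_eqI[of _ _ m]) auto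
  qed
  ultimately show ?thesis by (intro exI[of _ ?t]) simp
qed

text \<open>Suppose the total is smaller. By averaging, clauses with more than \<open>32 * g\<close>
  labels carry at most \<open>1/16\<close> of the \<open>M * K\<close> edges. Variables with more
  than \<open>2048 * g\<close> labels carry at most \<open>1/16\<close> within \<open>Good\<close>,
  where degrees are at most \<open>64 * K\<close>. At the remaining clauses short lists cover at
  most \<open>32 * g * H\<close> edges, which is \<open>1/8\<close>. So at least half of all edges
  are in \<open>Good\<close> and uncovered, and \<open>4 * g \<le> K\<close> turns this half into
  \<open>2 * g * M\<close>.\<close>

lemma soundness:
  fixes F :: "'f :: field set"
  assumes F: "finite F" "0 \<in> F" and hH: "h \<in> hypergraphs M K N"
    and few_hits: "\<And>\<alpha> T. \<alpha> \<in> PiE {..<M} (\<lambda>_. F \<times> F) \<Longrightarrow> T \<in> PiE ({..<K} \<times> {..<N} \<times> {..<2048 * g}) (\<lambda>_. F) \<Longrightarrow>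
        card (hit_set M K (2048 * g) h \<theta> c \<alpha> T) < H"
    and H: "M * K = 256 * g * H" and g: "g \<ge> 1" "4 * g \<le> K"
    and Good: "Good \<subseteq> {..<M} \<times> {..<K}" "3 * (M * K) \<le> 4 * card Good" "Good \<inter> heavy_edges M K (64 * K) h = {}"
    and SA: "\<And>a. a < M \<Longrightarrow> SA a \<subseteq> F \<times> F" and SV: "\<And>i j. i < K \<Longrightarrow> j < N \<Longrightarrow> SV i j \<subseteq> F"
  shows "2 * g * M \<le> (\<Sum>a<M. card (SA a)) + (\<Sum>(i, j)\<in>{..<K} \<times> {..<N}. card (SV i j)) +
     card {(a, i) \<in> Good. \<not> (\<exists>\<beta>\<in>SA a. fst \<beta> + \<theta> i * snd \<beta> + c (a, i) \<in> SV i (h (a, i)))}"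
proof (rule ccontr)
  let ?U = "{(a, i) \<in> Good. \<not> (\<exists>\<beta>\<in>SA a. fst \<beta> + \<theta> i * snd \<beta> + c (a, i) \<in> SV i (h (a, i)))}"
  let ?\<tau> = "2048 * g"
  assume "\<not> ?thesis"
  then have sA: "(\<Sum>a<M. card (SA a)) \<le> 2 * g * M" and sV: "(\<Sum>(i, j)\<in>{..<K} \<times> {..<N}. card (SV i j)) \<le> 2 * g * M"
    and sU: "card ?U < 2 * g * M" by linarith+
  have hN: "h (a, i) < N" if "a < M" "i < K" for a i using hH that by (auto simp: hypergraphs_def)
  have finA: "finite (SA a)" if "a < M" for a using SA[OF that] F finite_subset by blast
  have finV: "finite (SV i j)" if "i < K" "j < N" for i j using SV[OF that] F finite_subset by blast
  define C1 where "C1 = {a \<in> {..<M}. 32 * g < card (SA a)} \<times> {..<K}"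
  define HV where "HV = {(i, j) \<in> {..<K} \<times> {..<N}. ?\<tau> < card (SV i j)}"
  define C2 where "C2 = {(a, i) \<in> Good. (i, h (a, i)) \<in> HV}"
  have c1: "16 * card C1 \<le> M * K"
  proof -
    have "card {a \<in> {..<M}. 32 * g < card (SA a)} * (32 * g) = (\<Sum>a\<in>{a \<in> {..<M}. 32 * g < card (SA a)}. 32 * g)" by simp
    also have "\<dots> \<le> (\<Sum>a\<in>{a \<in> {..<M}. 32 * g < card (SA a)}. card (SA a))" by (intro sum_mono) auto
    also have "\<dots> \<le> (\<Sum>a<M. card (SA a))" by (intro sum_mono2) auto
    also have "\<dots> \<le> 2 * g * M" by (rule sA)
    finally have "16 * card {a \<in> {..<M}. 32 * g < card (SA a)} \<le> M" using g by simp
    then have "(16 * card {a \<in> {..<M}. 32 * g < card (SA a)}) * K \<le> M * K" by (rule mult_right_mono) simp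
    then show ?thesis by (simp add: C1_def card_cartesian_product)
  qed
  have c2: "16 * card C2 \<le> M * K"
  proof -
    have HVsub: "HV \<subseteq> {..<K} \<times> {..<N}" by (auto simp: HV_def)
    have finHV: "finite HV" using HVsub finite_subset by blast
    have "card HV * ?\<tau> = (\<Sum>v\<in>HV. ?\<tau>)" by simp
    also have "\<dots> \<le> (\<Sum>(i, j)\<in>HV. card (SV i j))" by (intro sum_mono) (auto simp: HV_def)
    also have "\<dots> \<le> (\<Sum>(i, j)\<in>{..<K} \<times> {..<N}. card (SV i j))" using HVsub by (intro sum_mono2) auto
    also have "\<dots> \<le> 2 * g * M" by (rule sV)
    finally have hv: "1024 * card HV \<le> M" using g by simp
    have "C2 \<subseteq> (\<Union>v\<in>HV. {(a, i) \<in> Good. (i, h (a, i)) = v})" by (auto simp: C2_def)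
    moreover have finGood: "finite Good" using Good(1) finite_subset by blast
    ultimately have "card C2 \<le> card (\<Union>v\<in>HV. {(a, i) \<in> Good. (i, h (a, i)) = v})"
      using finHV by (intro card_mono finite_UN_I) (auto intro: finite_subset[OF _ finGood])
    also have "\<dots> \<le> (\<Sum>v\<in>HV. card {(a, i) \<in> Good. (i, h (a, i)) = v})" by (rule card_UN_le[OF finHV])
    also have "\<dots> \<le> (\<Sum>v\<in>HV. 64 * K)"
    proof (rule sum_mono)
      fix v
      show "card {(a, i) \<in> Good. (i, h (a, i)) = v} \<le> 64 * K"
      proof (cases "{(a, i) \<in> Good. (i, h (a, i)) = v} = {}")
        case False
        then obtain a i where ai: "(a, i) \<in> Good" "v = (i, h (a, i))" by auto
        then have "card {a'. a' < M \<and> h (a', i) = h (a, i)} \<le> 64 * K"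
          using Good(1,3) by (auto simp: heavy_edges_def not_less)
        moreover have "card {(a', i') \<in> Good. (i', h (a', i')) = v} \<le> card {a'. a' < M \<and> h (a', i) = h (a, i)}"
          using Good(1) by (intro card_inj_on_le[where f = fst]) (auto simp: inj_on_def ai)
        ultimately show ?thesis by simp
      next
        case True
        show ?thesis unfolding True by simp
      qed
    qed
    finally have "16 * card C2 \<le> (1024 * card HV) * K" by (simp add: mult_ac)
    also have "\<dots> \<le> M * K" using hv by (rule mult_right_mono) simp
    finally show ?thesis .
  qed
  \<comment> \<open>Variables with too many labels get the constant list \<open>0\<close>; their
    edges in \<open>Good\<close> are charged to \<open>C2\<close>.\<close>
  have "\<forall>i j. \<exists>t. (\<forall>m<?\<tau>. t m \<in> F) \<and> (i < K \<longrightarrow> j < N \<longrightarrow> card (SV i j) \<le> ?\<tau> \<longrightarrow> SV i j \<subseteq> t ` {..<?\<tau>})"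
  proof (intro allI)
    fix i j
    show "\<exists>t. (\<forall>m<?\<tau>. t m \<in> F) \<and> (i < K \<longrightarrow> j < N \<longrightarrow> card (SV i j) \<le> ?\<tau> \<longrightarrow> SV i j \<subseteq> t ` {..<?\<tau>})"
    proof (cases "i < K \<and> j < N \<and> card (SV i j) \<le> ?\<tau>")
      case True
      then show ?thesis using cover_by_function[OF finV SV, of i j ?\<tau> 0] F(2) by auto
    next
      case False
      then show ?thesis using F(2) by (intro exI[of _ "\<lambda>_. 0"]) auto
    qed
  qed
  then obtain t where t: "\<And>i j m. m < ?\<tau> \<Longrightarrow> t i j m \<in> F"
     "\<And>i j. i < K \<Longrightarrow> j < N \<Longrightarrow> card (SV i j) \<le> ?\<tau> \<Longrightarrow> SV i j \<subseteq> t i j ` {..<?\<tau>}" by metis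
  define T where "T = restrict (\<lambda>(i, j, m). t i j m) ({..<K} \<times> {..<N} \<times> {..<?\<tau>})"
  have T: "T \<in> PiE ({..<K} \<times> {..<N} \<times> {..<?\<tau>}) (\<lambda>_. F)" using t(1) by (auto simp: T_def)
  have Teq: "(\<lambda>m. T (i, j, m)) ` {..<?\<tau>} = t i j ` {..<?\<tau>}" if "i < K" "j < N" for i j
    using that by (intro image_cong) (auto simp: T_def)
  define cov where "cov a \<beta> = {i \<in> {..<K}. fst \<beta> + \<theta> i * snd \<beta> + c (a, i) \<in> t i (h (a, i)) ` {..<?\<tau>}}" for a and \<beta> :: "'f \<times> 'f"
  \<comment> \<open>The shifts control only one label per clause, so the label covering most
    variables stands for all of \<open>SA a\<close>; an empty \<open>SA a\<close> gets the default
    \<open>(0, 0)\<close>.\<close>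
  have "\<forall>a. \<exists>b. a < M \<longrightarrow> b \<in> F \<times> F \<and> (\<forall>\<beta>\<in>SA a. card (cov a \<beta>) \<le> card (cov a b))"
  proof
    fix a
    show "\<exists>b. a < M \<longrightarrow> b \<in> F \<times> F \<and> (\<forall>\<beta>\<in>SA a. card (cov a \<beta>) \<le> card (cov a b))"
    proof (cases "a < M \<and> SA a \<noteq> {}")
      case True
      then have f: "finite ((\<lambda>\<beta>. card (cov a \<beta>)) ` SA a)" using finA by simp
      have "Max ((\<lambda>\<beta>. card (cov a \<beta>)) ` SA a) \<in> (\<lambda>\<beta>. card (cov a \<beta>)) ` SA a"
        using f True by (intro Max_in) simp_all
      then obtain b where b: "b \<in> SA a" "Max ((\<lambda>\<beta>. card (cov a \<beta>)) ` SA a) = card (cov a b)" by (rule imageE) simp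
      have "card (cov a \<beta>) \<le> card (cov a b)" if "\<beta> \<in> SA a" for \<beta>
        unfolding b(2)[symmetric] using that by (intro Max_ge[OF f] imageI)
      then have "\<forall>\<beta>\<in>SA a. card (cov a \<beta>) \<le> card (cov a b)" by blast
      then show ?thesis using b SA True by blast
    next
      case False
      then show ?thesis using F(2) by (intro exI[of _ "(0, 0)"]) auto
    qed
  qed
  then obtain al where al: "\<And>a. a < M \<Longrightarrow> al a \<in> F \<times> F" "\<And>a \<beta>. a < M \<Longrightarrow> \<beta> \<in> SA a \<Longrightarrow> card (cov a \<beta>) \<le> card (cov a (al a))"
    by metis
  define \<alpha> where "\<alpha> = restrict al {..<M}"
  have \<alpha>: "\<alpha> \<in> PiE {..<M} (\<lambda>_. F \<times> F)" using al(1) by (auto simp: \<alpha>_def)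
  have hits: "(\<Sum>a<M. card (cov a (al a))) < H"
  proof -
    have "hit_set M K ?\<tau> h \<theta> c \<alpha> T = (SIGMA a:{..<M}. cov a (al a))"
    proof (rule Set.set_eqI)
      fix x :: "nat \<times> nat"
      obtain a i where x: "x = (a, i)" by (cases x)
      show "x \<in> hit_set M K ?\<tau> h \<theta> c \<alpha> T \<longleftrightarrow> x \<in> (SIGMA a:{..<M}. cov a (al a))"
      proof (cases "a < M \<and> i < K")
        case True
        then show ?thesis using Teq[of i "h (a, i)"] hN[of a i] by (simp add: x hit_set_def cov_def \<alpha>_def)
      qed (auto simp: x hit_set_def cov_def)
    qed
    moreover have "card (SIGMA a:{..<M}. cov a (al a)) = (\<Sum>a<M. card (cov a (al a)))" by (simp add: cov_def)
    ultimately show ?thesis using few_hits[OF \<alpha> T] by simp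
  qed
  define C3 where "C3 = (SIGMA a:{a \<in> {..<M}. card (SA a) \<le> 32 * g}. \<Union>\<beta>\<in>SA a. cov a \<beta>)"
  have finc: "finite (cov a \<beta>)" for a \<beta> by (simp add: cov_def)
  have c3: "8 * card C3 \<le> M * K"
  proof -
    have "card C3 = (\<Sum>a\<in>{a \<in> {..<M}. card (SA a) \<le> 32 * g}. card (\<Union>\<beta>\<in>SA a. cov a \<beta>))"
      unfolding C3_def using finA finc by (intro card_SigmaI) auto
    also have "\<dots> \<le> (\<Sum>a\<in>{a \<in> {..<M}. card (SA a) \<le> 32 * g}. 32 * g * card (cov a (al a)))"
    proof (rule sum_mono)
      fix a assume a: "a \<in> {a \<in> {..<M}. card (SA a) \<le> 32 * g}"
      have "card (\<Union>\<beta>\<in>SA a. cov a \<beta>) \<le> (\<Sum>\<beta>\<in>SA a. card (cov a \<beta>))" using a finA by (intro card_UN_le) auto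
      also have "\<dots> \<le> card (SA a) * card (cov a (al a))" using sum_bounded_above[of "SA a" "\<lambda>\<beta>. card (cov a \<beta>)" "card (cov a (al a))"] al(2) a by auto
      also have "\<dots> \<le> 32 * g * card (cov a (al a))" using a by (intro mult_right_mono) auto
      finally show "card (\<Union>\<beta>\<in>SA a. cov a \<beta>) \<le> 32 * g * card (cov a (al a))" .
    qed
    also have "\<dots> \<le> (\<Sum>a<M. 32 * g * card (cov a (al a)))" by (intro sum_mono2) auto
    also have "\<dots> = 32 * g * (\<Sum>a<M. card (cov a (al a)))" by (simp add: sum_distrib_left)
    also have "\<dots> \<le> 32 * g * H" using hits by (intro mult_left_mono) auto
    finally have "8 * card C3 \<le> 256 * g * H" by linarith
    then show ?thesis unfolding H .
  qed
  have "C1 \<subseteq> {..<M} \<times> {..<K}" "C2 \<subseteq> {..<M} \<times> {..<K}" "C3 \<subseteq> {..<M} \<times> {..<K}" "?U \<subseteq> {..<M} \<times> {..<K}"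
    using Good(1) by (auto simp: C1_def C2_def C3_def cov_def)
  then have fin: "finite C1" "finite C2" "finite C3" "finite ?U" by (auto intro: finite_subset)
  have "Good \<subseteq> ?U \<union> C1 \<union> C2 \<union> C3"
  proof
    fix x assume x: "x \<in> Good"
    obtain a i where ai: "x = (a, i)" by (cases x)
    have aM: "a < M" "i < K" "h (a, i) < N" using x ai Good(1) hN by auto
    show "x \<in> ?U \<union> C1 \<union> C2 \<union> C3"
    proof (rule ccontr)
      assume n: "x \<notin> ?U \<union> C1 \<union> C2 \<union> C3"
      then obtain \<beta> where b: "\<beta> \<in> SA a" "fst \<beta> + \<theta> i * snd \<beta> + c (a, i) \<in> SV i (h (a, i))" using x ai by auto
      have "card (SA a) \<le> 32 * g" using n ai aM by (auto simp: C1_def)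
      moreover have "card (SV i (h (a, i))) \<le> ?\<tau>" using n ai aM x by (auto simp: C2_def HV_def)
      then have "i \<in> cov a \<beta>" using t(2)[OF aM(2,3)] b aM by (auto simp: cov_def)
      ultimately have "x \<in> C3" using ai aM b by (auto simp: C3_def)
      then show False using n by simp
    qed
  qed
  then have "card Good \<le> card (?U \<union> C1 \<union> C2 \<union> C3)" using fin by (intro card_mono) auto
  also have "\<dots> \<le> card ?U + card C1 + card C2 + card C3" by (meson add_le_mono1 card_Un_le order_trans)
  finally have "M * K \<le> 2 * card ?U" using Good(2) c1 c2 c3 by linarith
  moreover have "4 * g * M \<le> M * K" using g(2) by (simp add: mult.commute)
  ultimately show False using sU by linarith
qed

section \<open>The instance for given parameters\<close>

text \<open>A shortest walk repeats no vertex, since the part between two visits could be cut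
  out.\<close>

lemma relpow_shortest:
  assumes "(x, y) \<in> R ^^ n"
  shows "\<exists>m f. m \<le> n \<and> f 0 = x \<and> f m = y \<and> (\<forall>j<m. (f j, f (Suc j)) \<in> R) \<and> inj_on f {..m}"
proof -
  define m where "m = (LEAST m. (x, y) \<in> R ^^ m)"
  have m: "(x, y) \<in> R ^^ m" unfolding m_def using assms by (rule LeastI)
  have mn: "m \<le> n" unfolding m_def using assms by (rule Least_le)
  have least: "m \<le> m'" if "(x, y) \<in> R ^^ m'" for m' unfolding m_def using that by (rule Least_le)
  obtain f where f: "f 0 = x" "f m = y" "\<And>j. j < m \<Longrightarrow> (f j, f (Suc j)) \<in> R"
    using m unfolding relpow_fun_conv by auto
  have ne: "f p \<noteq> f q" if "p < q" "q \<le> m" for p q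
  proof
    assume eq: "f p = f q"
    have "(x, f p) \<in> R ^^ p" unfolding relpow_fun_conv using f that by (intro exI[of _ f]) auto
    moreover have "(f q, y) \<in> R ^^ (m - q)" unfolding relpow_fun_conv
      using f that by (intro exI[of _ "\<lambda>j. f (q + j)"]) auto
    ultimately have "(x, y) \<in> R ^^ (p + (m - q))" using eq by (metis relcompI relpow_add)
    then show False using least that by fastforce
  qed
  have "inj_on f {..m}"
  proof (rule inj_onI)
    fix p q assume "p \<in> {..m}" "q \<in> {..m}" "f p = f q"
    then show "p = q" using ne[of p q] ne[of q p] by (cases p q rule: linorder_cases) auto
  qed
  then show ?thesis using mn f by blast
qed

text \<open>A shortest such walk alternates between clauses and variables, so its length is odd, and
  the missing edge closes it to a cycle with at most \<open>k\<close> clauses. Length one is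
  impossible, as that single step would be the removed edge.\<close>

lemma short_walk_gives_cycle:
  fixes h :: "nat \<times> nat \<Rightarrow> nat"
  defines "edge \<equiv> \<lambda>(a, i). (Cl a, Va i (h (a, i)))"
  assumes Good: "Good \<subseteq> {..<M} \<times> {..<K}" and ai: "(a, i) \<in> Good"
    and walk: "(Cl a, Va i (h (a, i))) \<in>
      ((edge ` Good \<union> (edge ` Good)\<inverse>) - {(Cl a, Va i (h (a, i))), (Va i (h (a, i)), Cl a)}) ^^ w" and w: "w \<le> 2 * k - 1"
  shows "(a, i) \<in> cycle_edges M K k h"
proof -
  let ?R = "(edge ` Good \<union> (edge ` Good)\<inverse>) - {(Cl a, Va i (h (a, i))), (Va i (h (a, i)), Cl a)}"
  obtain m f where f: "m \<le> w" "f 0 = Cl a" "f m = Va i (h (a, i))" "\<And>j. j < m \<Longrightarrow> (f j, f (Suc j)) \<in> ?R"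
    and inj: "inj_on f {..m}" using relpow_shortest[OF walk] by blast
  have Cl_step: "\<exists>j. (b, j) \<in> Good \<and> v = Va j (h (b, j))" if "(Cl b, v) \<in> ?R" for b v
    using that by (auto simp: edge_def)
  have Va_step: "\<exists>b. (b, j) \<in> Good \<and> v = Cl b \<and> x = h (b, j)" if "(Va j x, v) \<in> ?R" for j x v
    using that by (auto simp: edge_def)
  have shape: "(even j \<longrightarrow> (\<exists>b. f j = Cl b)) \<and> (odd j \<longrightarrow> (\<exists>i x. f j = Va i x))" if "j \<le> m" for j
    using that
  proof (induction j)
    case 0
    then show ?case using f(2) by simp
  next
    case (Suc j)
    have step: "(f j, f (Suc j)) \<in> ?R" using f(4)[of j] Suc.prems by simp
    have IH: "(even j \<longrightarrow> (\<exists>b. f j = Cl b)) \<and> (odd j \<longrightarrow> (\<exists>i x. f j = Va i x))" using Suc by simp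
    show ?case
    proof (cases "even j")
      case True
      then obtain b where "f j = Cl b" using IH by blast
      then show ?thesis using Cl_step[of b "f (Suc j)"] step True by auto
    next
      case False
      then obtain i x where "f j = Va i x" using IH by blast
      then show ?thesis using Va_step[of i x "f (Suc j)"] step False by auto
    qed
  qed
  have "odd m" using shape[of m] f(3) by auto
  then obtain l' where l': "m = 2 * l' + 1" by (rule oddE)
  define l where "l = Suc l'"
  have m: "m = 2 * l - 1" "l \<ge> 1" using l' by (auto simp: l_def)
  have "m \<noteq> 1" using f(2,3) f(4)[of 0] by auto
  then have l2: "2 \<le> l" using m by auto
  have lk: "l \<le> k" using f(1) w m by linarith
  have "\<forall>j. \<exists>x. j < l \<longrightarrow> f (2 * j) = Cl x"
  proof
    fix j
    show "\<exists>x. j < l \<longrightarrow> f (2 * j) = Cl x" using shape[of "2 * j"] m by (cases "j < l") auto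
  qed
  then obtain b where b: "\<And>j. j < l \<Longrightarrow> f (2 * j) = Cl (b j)" by metis
  have "\<exists>v. (b j, v) \<in> Good \<and> f (Suc (2 * j)) = Va v (h (b j, v))" if "j < l" for j
    using f(4)[of "2 * j"] b[OF that] Cl_step that m by auto
  then obtain v where v: "\<And>j. j < l \<Longrightarrow> (b j, v j) \<in> Good" "\<And>j. j < l \<Longrightarrow> f (Suc (2 * j)) = Va (v j) (h (b j, v j))" by metis
  have nxt: "h (b j, v j) = h (b (Suc j), v j)" if "Suc j < l" for j
  proof -
    have "(f (Suc (2 * j)), f (Suc (Suc (2 * j)))) \<in> ?R" using f(4)[of "Suc (2 * j)"] that m by simp
    moreover have "f (Suc (Suc (2 * j))) = Cl (b (Suc j))" using b[OF that] by simp
    ultimately show ?thesis using v(2)[of j] Va_step that by fastforce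
  qed
  have b0: "b 0 = a" using b[of 0] f(2) l2 by simp
  have lst: "v (l - 1) = i" "h (b (l - 1), i) = h (a, i)"
  proof -
    have "Suc (2 * (l - 1)) = m" using m l2 by simp
    then have "f (Suc (2 * (l - 1))) = Va i (h (a, i))" using f(3) by simp
    then show "v (l - 1) = i" "h (b (l - 1), i) = h (a, i)" using v(2)[of "l - 1"] l2 by auto
  qed
  have fne: "f p \<noteq> f q" if "p \<le> m" "q \<le> m" "p \<noteq> q" for p q using inj that by (auto dest: inj_onD)
  define as where "as = map b [0..<l]"
  define vs where "vs = map v [0..<l]"
  have "(as, vs) \<in> cycle_shapes M K l"
  proof -
    have "inj_on b {..<l}"
    proof (rule inj_onI)
      fix x y assume xy: "x \<in> {..<l}" "y \<in> {..<l}" "b x = b y"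
      then have "f (2 * x) = f (2 * y)" "2 * x \<le> m" "2 * y \<le> m" using b m by auto
      then show "x = y" using fne[of "2 * x" "2 * y"] by auto
    qed
    then have "distinct as" by (simp add: as_def distinct_map lessThan_atLeast0)
    moreover have "b j < M \<and> v j < K" if "j < l" for j using subsetD[OF Good v(1)[OF that]] by simp
    then have "set as \<subseteq> {..<M}" "set vs \<subseteq> {..<K}" by (auto simp: as_def vs_def)
    moreover have "vs ! j \<noteq> vs ! (Suc j mod l)" if j: "j < l" for j
    proof (cases "Suc j = l")
      case True
      have "f 1 \<noteq> f m" using fne[of 1 m] m l2 by auto
      moreover have "f 1 = Va (v 0) (h (a, v 0))" using v(2)[of 0] l2 b0 by simp
      ultimately have "v 0 \<noteq> i" using f(3) by auto
      moreover have "j = l - 1" using True by simp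
      ultimately show ?thesis using True lst j l2 by (auto simp: vs_def)
    next
      case False
      then have sj: "Suc j < l" using j by simp
      have "f (Suc (2 * j)) \<noteq> f (Suc (2 * Suc j))" using fne[of "Suc (2 * j)" "Suc (2 * Suc j)"] sj m by auto
      then have "v j \<noteq> v (Suc j)" using v(2)[of j] v(2)[of "Suc j"] nxt[OF sj] sj by auto
      then show ?thesis using sj j by (simp add: vs_def)
    qed
    ultimately show ?thesis by (auto simp: cycle_shapes_def as_def vs_def)
  qed
  moreover have "closed_cycle h as vs"
    unfolding closed_cycle_def
  proof (intro allI impI)
    fix j assume "j < length as"
    then have j: "j < l" by (simp add: as_def)
    show "h (as ! j, vs ! j) = h (as ! (Suc j mod length as), vs ! j)"
    proof (cases "Suc j = l")
      case True
      then have "j = l - 1" by simp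
      then show ?thesis using lst b0 l2 by (simp add: as_def vs_def)
    next
      case False
      then have sj: "Suc j < l" using j by simp
      then show ?thesis using nxt[OF sj] j by (simp add: as_def vs_def)
    qed
  qed
  moreover have "hd as = a" "last vs = i" using b0 lst l2 by (auto simp: as_def vs_def hd_map last_map)
  ultimately show ?thesis unfolding cycle_edges_def using l2 lk by blast
qed

text \<open>Each numerical premise feeds one ingredient: those on \<open>Z\<close> the expansion,
  \<open>cyc\<close> the scarcity of short cycles, \<open>q\<close>, \<open>H\<close> and
  \<open>mH\<close> the soundness, \<open>W\<close> the length of derivations, and \<open>n\<close>
  the room for the vertices.\<close>

lemma gap_instance:
  fixes k g m r M K N W D Z H cc n :: nat
  assumes k: "k \<ge> 2" and g: "g \<ge> 1" "4 * g \<le> K" and m: "m \<ge> 1" and Km: "K \<le> 2 ^ m" and MKN: "M = K * N" and N: "N \<ge> 1" and D: "D \<ge> 1"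
    and Z: "W\<^sup>2 * K * Z \<le> N" "(8 * M) ^ (2 * D) \<le> Z ^ (3 * D - 1)"
    and cyc: "64 * k * (M * K) ^ k \<le> N ^ k * (M * K)"
    and q: "6 * (2048 * g) * (256 * g) \<le> 2 ^ m" and H: "M * K = 256 * g * H" and mH: "m * (K * N * (2048 * g) + 2 * M) < H"
    and W: "8 * D * (2 * r + 7) + 1 \<le> W" and cc: "cc \<ge> 1"
    and n: "cc * (2 * M) * (k - 1) + (M * (2 ^ m)\<^sup>2 + M * 2 ^ m) + 2 * M \<le> n"
  shows "\<exists>E. is_graph n E \<and>
     real (cc * (2 * g * M)) / real (cc * (2 * M) * (k - 1) + (M * (2 ^ m)\<^sup>2 + M * 2 ^ m) + M * K * (2 ^ m)\<^sup>2)
       \<le> integrality_gap E (2 * k - 1) r"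
proof -
  have K1: "K \<ge> 1" using g by linarith
  have M1: "M \<ge> 1" using MKN N K1 by simp
  obtain h where h: "h \<in> hypergraphs M K N" "expands M K W D h"
    "real (card (cycle_edges M K k h)) \<le> real (M * K) / 8" "real (card (heavy_edges M K (64 * K) h)) \<le> real (M * K) / 8"
  proof -
    have NMK: "N \<le> M * K" using MKN K1 by simp
    \<comment> \<open>A variable occurs in \<open>M / N = K\<close> clauses on average; heavy means
      more than 64 times that.\<close>
    have heavy: "64 * M \<le> N * (64 * K)" using MKN by simp
    show ?thesis using that good_hypergraph_exists[OF D M1 K1 N NMK Z cyc heavy] by blast
  qed
  obtain F :: "bit alg_closure set" and \<psi> where F: "binary_field F \<psi>" "card F = 2 ^ m" using binary_field_exists[OF m] by blast
  interpret binary_field F \<psi> by (rule F(1))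
  obtain \<theta> where \<theta>: "inj_on \<theta> {..<K}" "\<theta> ` {..<K} \<subseteq> F"
    using card_le_inj[of "{..<K}" F] finite_F F(2) Km by auto
  obtain c where c: "c \<in> PiE ({..<M} \<times> {..<K}) (\<lambda>_. F)"
    and few: "\<And>\<alpha> T. \<alpha> \<in> PiE {..<M} (\<lambda>_. F \<times> F) \<Longrightarrow> T \<in> PiE ({..<K} \<times> {..<N} \<times> {..<2048 * g}) (\<lambda>_. F) \<Longrightarrow>
        card (hit_set M K (2048 * g) h \<theta> c \<alpha> T) < H"
    using sound_shift_exists[OF finite_F F(2) q _ H mH, of h \<theta>] g by auto
  have hN: "h (a, i) < N" if "a < M" "i < K" for a i using h(1) that by (auto simp: hypergraphs_def)
  let ?P = "{..<M} \<times> {..<K}"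
  \<comment> \<open>Only these incidences become superedges. The SDP side does not suffer: the
    pseudo-distribution of the full system satisfies the remaining relations as well.\<close>
  define Good where "Good = ?P - (cycle_edges M K k h \<union> heavy_edges M K (64 * K) h)"
  have Good: "Good \<subseteq> ?P" "Good \<inter> heavy_edges M K (64 * K) h = {}" "Good \<inter> cycle_edges M K k h = {}" by (auto simp: Good_def)
  have cardGood: "3 * (M * K) \<le> 4 * card Good"
  proof -
    have hs: "heavy_edges M K (64 * K) h \<subseteq> ?P" by (auto simp: heavy_edges_def)
    have cs: "cycle_edges M K k h \<subseteq> ?P"
    proof
      fix x assume "x \<in> cycle_edges M K k h"
      then obtain as vs l where *: "x = (hd as, last vs)" "2 \<le> l" "(as, vs) \<in> cycle_shapes M K l" by (auto simp: cycle_edges_def)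
      then have "as \<noteq> []" "vs \<noteq> []" "set as \<subseteq> {..<M}" "set vs \<subseteq> {..<K}" by (auto simp: cycle_shapes_def)
      then have "hd as \<in> {..<M}" "last vs \<in> {..<K}" using hd_in_set last_in_set by blast+
      then show "x \<in> ?P" using * by simp
    qed
    have "card ?P \<le> card Good + card (cycle_edges M K k h \<union> heavy_edges M K (64 * K) h)"
    proof -
      have "?P = Good \<union> (cycle_edges M K k h \<union> heavy_edges M K (64 * K) h)" using hs cs by (auto simp: Good_def)
      then show ?thesis by (metis card_Un_le)
    qed
    also have "\<dots> \<le> card Good + (card (cycle_edges M K k h) + card (heavy_edges M K (64 * K) h))" by (simp add: card_Un_le)
    finally have "real (M * K) \<le> real (card Good) + (real (card (cycle_edges M K k h)) + real (card (heavy_edges M K (64 * K) h)))"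
      by (simp only: card_cartesian_product card_lessThan of_nat_add[symmetric] of_nat_le_iff)
    then have "real (3 * (M * K)) \<le> real (4 * card Good)" using h(3,4) by simp
    then show ?thesis by (simp only: of_nat_le_iff)
  qed
  define h' where "h' = (\<lambda>a i. h (a, i))"
  define c' where "c' = (\<lambda>a i. c (a, i))"
  \<comment> \<open>The degree \<open>2 * r + 6\<close> leaves room for the two indicators that
    \<open>constraint_kills\<close> multiplies onto functions of degree
    \<open>2 * r + 4\<close>.\<close>
  interpret P: linear_csp F \<psi> M K N h' \<theta> c' W D "2 * r + 6"
  proof
    show "h' a i < N" if "a < M" "i < K" for a i using hN that by (simp add: h'_def)
    show "\<theta> i \<in> F" if "i < K" for i using \<theta> that by auto
    show "inj_on \<theta> {..<K}" by (rule \<theta>(1))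
    show "c' a i \<in> F" if "a < M" "i < K" for a i using c that by (auto simp: c'_def)
    show "2 * D * K * card A + card A < 3 * D * card A + 2 * D * card ((\<lambda>(a, i). (i, h' a i)) ` (A \<times> {..<K}))"
      if "A \<subseteq> {..<M}" "A \<noteq> {}" "card A \<le> W" for A
      using h(2) that unfolding expands_def h'_def by blast
    show "8 * D * (2 * r + 6 + 1) + 1 \<le> W" using W by (simp add: add.commute)
  qed
  define SE where "SE = (\<lambda>(a, i). (Cl a, Va i (h (a, i)))) ` Good"
  have SE_iff: "e \<in> SE \<longleftrightarrow> (\<exists>a i. (a, i) \<in> Good \<and> e = (Cl a, Va i (h (a, i))))" for e by (auto simp: SE_def)
  interpret G: rep_game P.Sn P.Lb SE P.Rel k cc
  proof
    show "finite P.Sn" by (rule P.finite_Sn)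
    show "finite (P.Lb s)" if "s \<in> P.Sn" for s by (rule P.finite_Lb[OF that])
    show "SE \<subseteq> P.Sn \<times> P.Sn" proof
      fix e assume "e \<in> SE"
      then obtain a i where ai: "(a, i) \<in> Good" "e = (Cl a, Va i (h (a, i)))" by (auto simp: SE_iff)
      then have "a < M" "i < K" "h (a, i) < N" using Good(1) hN by auto
      then show "e \<in> P.Sn \<times> P.Sn" using ai by (auto simp: P.Sn_def)
    qed
    show "(s', s) \<notin> SE" if "(s, s') \<in> SE" for s s' using that by (auto simp: SE_iff)
    show "P.Rel s s' \<subseteq> P.Lb s \<times> P.Lb s'" if ss: "(s, s') \<in> SE" for s s'
    proof -
      obtain a i where ai: "(a, i) \<in> Good" "s = Cl a" "s' = Va i (h (a, i))" using ss by (auto simp: SE_iff)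
      then have "a < M" "i < K" using Good(1) by auto
      then show ?thesis using ai P.c_F P.\<theta>_F by (auto simp: P.Rel_def P.Lb_def intro!: F_add F_mult)
    qed
    show "2 \<le> k" by (rule k)
  qed
  have cardSn: "card P.Sn = 2 * M"
  proof -
    have "card P.Sn = card (Cl ` {..<M}) + card ((\<lambda>(i, j). Va i j) ` ({..<K} \<times> {..<N}))"
      unfolding P.Sn_def by (rule card_Un_disjoint) auto
    also have "card (Cl ` {..<M}) = M" by (simp add: card_image inj_on_def)
    also have "card ((\<lambda>(i, j). Va i j) ` ({..<K} \<times> {..<N})) = K * N"
      by (subst card_image) (auto simp: inj_on_def card_cartesian_product)
    finally show ?thesis using MKN by simp
  qed
  have sumSn: "(\<Sum>s\<in>P.Sn. f s) = (\<Sum>a<M. f (Cl a)) + (\<Sum>(i, j)\<in>{..<K} \<times> {..<N}. f (Va i j))" for f :: "node \<Rightarrow> nat"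
  proof -
    have "(\<Sum>s\<in>P.Sn. f s) = sum f (Cl ` {..<M}) + sum f ((\<lambda>(i, j). Va i j) ` ({..<K} \<times> {..<N}))"
      unfolding P.Sn_def by (rule sum.union_disjoint) auto
    also have "sum f (Cl ` {..<M}) = (\<Sum>a<M. f (Cl a))" by (subst sum.reindex) (auto simp: inj_on_def)
    also have "sum f ((\<lambda>(i, j). Va i j) ` ({..<K} \<times> {..<N})) = (\<Sum>(i, j)\<in>{..<K} \<times> {..<N}. f (Va i j))"
      by (subst sum.reindex) (auto simp: inj_on_def case_prod_unfold)
    finally show ?thesis .
  qed
  have sumLb: "(\<Sum>s\<in>P.Sn. card (P.Lb s)) = M * (2 ^ m)\<^sup>2 + M * 2 ^ m"
    unfolding sumSn using F(2) MKN by (simp add: P.Lb_def card_cartesian_product power2_eq_square)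
  have cardSE: "card SE \<le> M * K"
  proof -
    have "card SE \<le> card Good" unfolding SE_def using finite_subset[OF Good(1)] by (intro card_image_le) auto
    also have "\<dots> \<le> card ?P" using Good(1) by (intro card_mono) auto
    finally show ?thesis by (simp add: card_cartesian_product)
  qed
  have sumRel: "(\<Sum>e\<in>SE. card (P.Rel (fst e) (snd e))) \<le> M * K * (2 ^ m)\<^sup>2"
  proof -
    have "card (P.Rel (fst e) (snd e)) \<le> (2 ^ m)\<^sup>2" if e: "e \<in> SE" for e
    proof -
      obtain a i where "e = (Cl a, Va i (h (a, i)))" using e by (auto simp: SE_iff)
      then have "P.Rel (fst e) (snd e) = (\<lambda>(x, y). ((x, y), (x + \<theta> i * y + c' a i, 0))) ` (F \<times> F)" by (simp add: P.Rel_def)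
      moreover have "card ((\<lambda>(x, y). ((x, y), (x + \<theta> i * y + c' a i, 0 :: bit alg_closure))) ` (F \<times> F)) \<le> card (F \<times> F)"
        by (rule card_image_le) (simp add: finite_F)
      ultimately have "card (P.Rel (fst e) (snd e)) \<le> card (F \<times> F)" by (simp only:)
      then show ?thesis using F(2) by (simp add: card_cartesian_product power2_eq_square)
    qed
    then have "(\<Sum>e\<in>SE. card (P.Rel (fst e) (snd e))) \<le> card SE * (2 ^ m)\<^sup>2"
      using sum_bounded_above[of SE "\<lambda>e. card (P.Rel (fst e) (snd e))" "(2 ^ m)\<^sup>2"] by simp
    also have "\<dots> \<le> M * K * (2 ^ m)\<^sup>2" using cardSE by (rule mult_right_mono) simp
    finally show ?thesis .
  qed
  have "card G.verts \<le> card {..<n}" using G.card_verts(2) n unfolding cardSn sumLb by simp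
  then obtain nm where nm: "inj_on nm G.verts" "nm ` G.verts \<subseteq> {..<n}"
    using card_le_inj[OF G.card_verts(1) finite_lessThan[of n]] by blast
  interpret S: rep_sdp P.Sn P.Lb SE P.Rel k cc nm P.U P.\<mu> r
  proof
    show "inj_on nm G.verts" by (rule nm(1))
    show "\<omega> s \<in> P.Lb s" if "\<omega> \<in> P.U" "s \<in> P.Sn" for \<omega> s using that by (auto simp: P.U_def)
    show "(\<Sum>\<omega>\<in>P.U. P.\<mu> \<omega>) = 1" by (rule P.total_mass)
    show "0 \<le> (\<Sum>\<omega>\<in>P.U. P.\<mu> \<omega> * (f \<omega>)\<^sup>2)" if "local_fun P.Sn P.Lb (2 * r + 4) f" for f
    proof -
      have "local_fun P.Sn P.Lb (2 * r + 6) f" by (rule local_fun_mono[OF that]) simp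
      from P.L_square_nonneg[OF P.local_fun_spec[OF this]] show ?thesis by (simp only: P.L_def)
    qed
    show "(\<Sum>\<omega>\<in>P.U. P.\<mu> \<omega> * (of_bool (\<omega> s = l) * of_bool (\<omega> s' = l') * f \<omega>)) = 0"
      if ss: "(s, s') \<in> SE" and ll: "l \<in> P.Lb s" "l' \<in> P.Lb s'" "(l, l') \<notin> P.Rel s s'" "local_fun P.Sn P.Lb (2 * r + 4) f" for s s' l l' f
    proof -
      obtain a i where ai: "(a, i) \<in> Good" "s = Cl a" "s' = Va i (h' a i)" using ss by (auto simp: SE_iff h'_def)
      then have "a < M" "i < K" using Good(1) by auto
      from P.constraint_kills[OF this, of l l' "2 * r + 4" f] ll ai
      have "P.L (\<lambda>\<omega>. of_bool (\<omega> s = l) * of_bool (\<omega> s' = l') * f \<omega>) = 0" by simp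
      then show ?thesis by (simp only: P.L_def)
    qed
  qed
  have "G.arcs \<noteq> {}"
  proof -
    have "Cl 0 \<in> P.Sn" using M1 by (auto simp: P.Sn_def)
    moreover have "0 \<in> P.Lb (Cl 0)" using F_0 by (simp add: P.Lb_def zero_prod_def)
    ultimately show ?thesis using G.choice_arcI[of "Cl 0" 0 0] cc by (auto simp: G.arcs_def)
  qed
  note gap = S.gap[OF nm(2) this, where G = "2 * g * M"]
  have noshort: "(s, s') \<notin> (G.superadj - {(s, s'), (s', s)}) ^^ w" if ss: "(s, s') \<in> SE" and w: "w \<le> 2 * k - 1" for s s' w
  proof
    assume walk: "(s, s') \<in> (G.superadj - {(s, s'), (s', s)}) ^^ w"
    obtain a i where ai: "(a, i) \<in> Good" "s = Cl a" "s' = Va i (h (a, i))" using ss by (auto simp: SE_iff)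
    have "(a, i) \<in> cycle_edges M K k h"
      by (rule short_walk_gives_cycle[OF Good(1) ai(1) _ w]) (use walk in \<open>unfold G.superadj_def ai(2,3), unfold SE_def\<close>)
    then show False using ai Good(3) by blast
  qed
  have sound: "2 * g * M \<le> (\<Sum>s\<in>P.Sn. card (S s)) + card {(s, s') \<in> SE. \<not> (\<exists>(l, l')\<in>P.Rel s s'. l \<in> S s \<and> l' \<in> S s')}"
    if S: "\<And>s. s \<in> P.Sn \<Longrightarrow> S s \<subseteq> P.Lb s" for S
  proof -
    let ?SA = "\<lambda>a. S (Cl a)" and ?SV = "\<lambda>i j. fst ` S (Va i j)"
    have SA: "S (Cl a) \<subseteq> F \<times> F" if "a < M" for a using S[of "Cl a"] that by (auto simp: P.Sn_def P.Lb_def)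
    have SV0: "S (Va i j) \<subseteq> F \<times> {0}" if "i < K" "j < N" for i j using S[of "Va i j"] that by (auto simp: P.Sn_def P.Lb_def)
    have SV: "?SV i j \<subseteq> F" if "i < K" "j < N" for i j using SV0[OF that] by auto
    have cSV: "card (?SV i j) = card (S (Va i j))" if "i < K" "j < N" for i j
      using SV0[OF that] by (intro card_image) (auto simp: inj_on_def)
    let ?U = "{(a, i) \<in> Good. \<not> (\<exists>\<beta>\<in>?SA a. fst \<beta> + \<theta> i * snd \<beta> + c (a, i) \<in> ?SV i (h (a, i)))}"
    have "2 * g * M \<le> (\<Sum>a<M. card (?SA a)) + (\<Sum>(i, j)\<in>{..<K} \<times> {..<N}. card (?SV i j)) + card ?U"
      by (rule soundness[OF finite_F F_0 h(1) few H g Good(1) cardGood Good(2) SA SV])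
    also have "(\<Sum>(i, j)\<in>{..<K} \<times> {..<N}. card (?SV i j)) = (\<Sum>(i, j)\<in>{..<K} \<times> {..<N}. card (S (Va i j)))"
      using cSV by (intro sum.cong) auto
    also have "card ?U \<le> card {(s, s') \<in> SE. \<not> (\<exists>(l, l')\<in>P.Rel s s'. l \<in> S s \<and> l' \<in> S s')}"
    proof (rule card_inj_on_le[where f = "\<lambda>(a, i). (Cl a, Va i (h (a, i)))"])
      show "inj_on (\<lambda>(a, i). (Cl a, Va i (h (a, i)))) ?U" by (auto simp: inj_on_def)
      have "finite SE" unfolding SE_def using finite_subset[OF Good(1)] by auto
      then show "finite {(s, s') \<in> SE. \<not> (\<exists>(l, l')\<in>P.Rel s s'. l \<in> S s \<and> l' \<in> S s')}" by (rule rev_finite_subset) auto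
      show "(\<lambda>(a, i). (Cl a, Va i (h (a, i)))) ` ?U \<subseteq> {(s, s') \<in> SE. \<not> (\<exists>(l, l')\<in>P.Rel s s'. l \<in> S s \<and> l' \<in> S s')}"
      proof clarify
        fix a i assume ai: "(a, i) \<in> Good" and un: "\<not> (\<exists>\<beta>\<in>S (Cl a). fst \<beta> + \<theta> i * snd \<beta> + c (a, i) \<in> ?SV i (h (a, i)))"
        have "False" if ll: "(l, l') \<in> P.Rel (Cl a) (Va i (h (a, i)))" "l \<in> S (Cl a)" "l' \<in> S (Va i (h (a, i)))" for l l'
        proof -
          have "fst l' = fst l + \<theta> i * snd l + c' a i" using ll(1) by (auto simp: P.Rel_def)
          then have "fst l' = fst l + \<theta> i * snd l + c (a, i)" by (simp add: c'_def)
          then show False using un ll(2,3) by (metis image_eqI)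
        qed
        then show "(Cl a, Va i (h (a, i))) \<in> SE \<and> \<not> (\<exists>(l, l')\<in>P.Rel (Cl a) (Va i (h (a, i))). l \<in> S (Cl a) \<and> l' \<in> S (Va i (h (a, i))))"
          using ai by (auto simp: SE_iff)
      qed
    qed
    finally show ?thesis unfolding sumSn by simp
  qed
  have "is_graph n S.edges" using gap(1)[OF noshort sound] by blast
  moreover have "real (cc * (2 * g * M)) / real (cc * (2 * M) * (k - 1) + (M * (2 ^ m)\<^sup>2 + M * 2 ^ m) + M * K * (2 ^ m)\<^sup>2)
       \<le> integrality_gap S.edges (2 * k - 1) r"
  proof -
    let ?x = "cc * card P.Sn * (k - 1) + (\<Sum>s\<in>P.Sn. card (P.Lb s)) + (\<Sum>e\<in>SE. card (P.Rel (fst e) (snd e)))"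
    let ?y = "cc * (2 * M) * (k - 1) + (M * (2 ^ m)\<^sup>2 + M * 2 ^ m) + M * K * (2 ^ m)\<^sup>2"
    have xy: "?x \<le> ?y" unfolding cardSn sumLb using sumRel by simp
    have "0 < M * (2 ^ m)\<^sup>2" using M1 by simp
    then have x0: "0 < ?x" unfolding sumLb by linarith
    have "real (cc * (2 * g * M)) / real ?y \<le> real (cc * (2 * g * M)) / real ?x"
      by (rule divide_left_mono) (use xy x0 in \<open>simp_all only: of_nat_le_iff of_nat_0_less_iff of_nat_0_le_iff mult_pos_pos less_le_trans[OF x0 xy]\<close>)
    also have "\<dots> \<le> integrality_gap S.edges (2 * k - 1) r" using gap(2)[OF noshort sound] by blast
    finally show ?thesis .
  qed
  ultimately show ?thesis by blast
qed

text \<open>\<open>B\<close> is a power of two so that \<open>K\<close> can be both the clause width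
  and the order of the field. Numerical constants are absorbed by powers of
  \<open>B\<close>.\<close>

lemma gap_instance_power:
  fixes k d L r n :: nat
  defines "f \<equiv> max 4 (2 * k - 3)" and "\<kappa> \<equiv> 2 * d + 4" and "B \<equiv> 2 ^ L"
  assumes k: "k \<ge> 2" and B: "524800 * \<kappa> * k \<le> B"
    and r: "8 * (f * \<kappa> + 7) * (2 * r + 7) + 1 \<le> B" and n: "2 * k * B ^ ((f + 5) * \<kappa> + 9) \<le> n"
  shows "\<exists>E. is_graph n E \<and> real (B ^ d) / real k \<le> integrality_gap E (2 * k - 1) r"
proof -
  \<comment> \<open>\<open>\<nu> = \<kappa> + D + 2\<close>, so that
    \<open>W\<^sup>2 * K * Z \<le> N\<close> holds with equality for \<open>W = B\<close> and
    \<open>Z = B ^ D\<close>. The same \<open>D\<close> serves as exponent of \<open>Z\<close> and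
    as precision of the expansion.\<close>
  define \<nu> where "\<nu> = (f + 1) * \<kappa> + 9"
  define D where "D = f * \<kappa> + 7"
  define g where "g = B ^ d"
  define K where "K = B ^ \<kappa>"
  define N where "N = B ^ \<nu>"
  define M where "M = K * N"
  \<comment> \<open>This is \<open>M * K / (256 * g)\<close>, an integer because 256 divides
    \<open>B\<close>.\<close>
  define H where "H = (B div 256) * B ^ (\<nu> + 2 * \<kappa> - d - 1)"
  \<comment> \<open>As many copies as there can be inner edges per clause, namely \<open>K\<close>
    times the squared order of the field.\<close>
  define cc where "cc = B ^ (3 * \<kappa>)"
  have \<kappa>4: "\<kappa> \<ge> 4" by (simp add: \<kappa>_def)
  have "524800 * 4 * 2 \<le> 524800 * \<kappa> * k" using \<kappa>4 k by (intro mult_le_mono) auto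
  then have Bbig: "B \<ge> 524800" using B by linarith
  have Bk: "64 * k \<le> B"
  proof -
    have "64 * k \<le> 524800 * \<kappa> * k" using \<kappa>4 by (intro mult_le_mono1) linarith
    then show ?thesis using B by linarith
  qed
  have B\<kappa>: "524800 * \<kappa> \<le> B"
  proof -
    have "524800 * \<kappa> * 1 \<le> 524800 * \<kappa> * k" using k by (intro mult_le_mono2) linarith
    then show ?thesis using B by linarith
  qed
  have B1: "1 \<le> B" using Bbig by linarith
  have f4: "4 \<le> f" and fk: "2 * k \<le> f + 3" using k by (auto simp: f_def)
  have Bpow: "B ^ i \<le> B ^ j" if "i \<le> j" for i j using that B1 by (rule power_increasing)
  have L8: "8 \<le> L"
  proof (rule ccontr)
    assume "\<not> 8 \<le> L"
    then have "B \<le> 2 ^ 8" unfolding B_def by (intro power_increasing) auto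
    then show False using Bbig by simp
  qed
  have B256: "256 * (B div 256) = B"
  proof -
    have "(2 :: nat) ^ 8 dvd 2 ^ L" using L8 by (rule le_imp_power_dvd)
    then have "256 dvd B" by (simp add: B_def)
    then show ?thesis by simp
  qed
  have Meq: "M = B ^ (\<nu> + \<kappa>)" by (simp add: M_def K_def N_def power_add)
  have MK: "M * K = B ^ (\<nu> + 2 * \<kappa>)" by (simp add: Meq K_def power_add[symmetric] mult_2 add.assoc)
  have Km: "K = 2 ^ (\<kappa> * L)" by (simp add: K_def B_def power_mult[symmetric] mult.commute)
  have gg: "g * g * B ^ 4 = K" by (simp only: g_def K_def \<kappa>_def power_add[symmetric] mult_2)
  have g1: "1 \<le> g" using B1 by (simp add: g_def)
  have MK256: "M * K = 256 * g * H"
  proof -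
    have "256 * g * H = (256 * (B div 256)) * (B ^ d * B ^ (\<nu> + 2 * \<kappa> - d - 1))" by (simp add: g_def H_def)
    also have "\<dots> = B ^ (Suc (d + (\<nu> + 2 * \<kappa> - d - 1)))" by (simp add: B256 power_add)
    also have "Suc (d + (\<nu> + 2 * \<kappa> - d - 1)) = \<nu> + 2 * \<kappa>" by (simp add: \<nu>_def \<kappa>_def)
    finally show ?thesis by (simp add: MK)
  qed
  \<comment> \<open>\<open>3145728 = 6 * 2048 * 256\<close> is the constant in the premise on hits;
    the surplus \<open>B ^ 4\<close> of \<open>K\<close> over \<open>g * g\<close> covers
    it.\<close>
  have B4: "3145728 \<le> B ^ 4"
  proof -
    have "(524800 :: nat) ^ 2 \<le> B ^ 2" using Bbig by (intro power_mono) auto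
    also have "\<dots> \<le> B ^ 4" by (rule Bpow) simp
    finally show ?thesis by simp
  qed
  have inst: "\<exists>E. is_graph n E \<and>
     real (cc * (2 * g * M)) / real (cc * (2 * M) * (k - 1) + (M * (2 ^ (\<kappa> * L))\<^sup>2 + M * 2 ^ (\<kappa> * L)) + M * K * (2 ^ (\<kappa> * L))\<^sup>2)
       \<le> integrality_gap E (2 * k - 1) r"
  proof (rule gap_instance[where W = B and D = D and Z = "B ^ D" and H = H and N = N])
    show "k \<ge> 2" "g \<ge> 1" by (rule k, rule g1)
    show "4 * g \<le> K"
    proof -
      have "4 * g = g * 4 * 1" by simp
      also have "\<dots> \<le> g * B ^ 4 * g" using g1 B4 by (intro mult_le_mono) auto
      also have "\<dots> = K" unfolding gg[symmetric] by (simp only: mult_ac)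
      finally show ?thesis .
    qed
    show "1 \<le> \<kappa> * L" using \<kappa>4 L8 by simp
    show "K \<le> 2 ^ (\<kappa> * L)" by (simp add: Km)
    show "M = K * N" by (rule M_def)
    show "1 \<le> N" using B1 by (simp add: N_def)
    show "1 \<le> D" by (simp add: D_def)
    have "B\<^sup>2 * K * B ^ D = B ^ (2 + \<kappa> + D)" by (simp only: K_def power_add)
    also have "2 + \<kappa> + D = \<nu>" by (simp add: \<nu>_def D_def)
    finally show "B\<^sup>2 * K * B ^ D \<le> N" by (simp add: N_def)
    show "(8 * M) ^ (2 * D) \<le> (B ^ D) ^ (3 * D - 1)"
    proof -
      have "8 * M \<le> B * M" using Bbig by (intro mult_le_mono1) linarith
      also have "\<dots> = B ^ (\<nu> + \<kappa> + 1)" by (simp add: Meq)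
      finally have "(8 * M) ^ (2 * D) \<le> (B ^ (\<nu> + \<kappa> + 1)) ^ (2 * D)" by (rule power_mono) simp
      also have "\<dots> = B ^ ((\<nu> + \<kappa> + 1) * (2 * D))" by (simp only: power_mult)
      also have "\<dots> \<le> B ^ (D * (3 * D - 1))"
      proof (rule Bpow)
        \<comment> \<open>Here \<open>f \<ge> 4\<close> enters: the summand 7 in \<open>D\<close>
          makes the constants cancel exactly, leaving
          \<open>4 * \<kappa> \<le> f * \<kappa>\<close>.\<close>
        have "4 * \<kappa> \<le> f * \<kappa>" using f4 by (rule mult_le_mono1)
        then have "2 * (\<nu> + \<kappa> + 1) \<le> 3 * D - 1" unfolding \<nu>_def D_def by (simp add: algebra_simps)
        then have "D * (2 * (\<nu> + \<kappa> + 1)) \<le> D * (3 * D - 1)" by (rule mult_le_mono2)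
        then show "(\<nu> + \<kappa> + 1) * (2 * D) \<le> D * (3 * D - 1)" by (simp add: mult_ac)
      qed
      finally show ?thesis by (simp only: power_mult)
    qed
    show "64 * k * (M * K) ^ k \<le> N ^ k * (M * K)"
    proof -
      have "64 * k * (M * K) ^ k \<le> B * (M * K) ^ k" using Bk by (rule mult_le_mono1)
      also have "\<dots> = B ^ (Suc ((\<nu> + 2 * \<kappa>) * k))" by (simp only: MK power_mult power_Suc)
      also have "\<dots> \<le> B ^ (\<nu> * k + (\<nu> + 2 * \<kappa>))"
      proof (rule Bpow)
        \<comment> \<open>Here \<open>f \<ge> 2 * k - 3\<close> enters: the bound
          \<open>(M * K / N) ^ k = B ^ (2 * \<kappa> * k)\<close> on the mean number of closed
          shapes of length \<open>k\<close> must stay well below \<open>M * K\<close>.\<close>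
        have "2 * k * \<kappa> \<le> (f + 3) * \<kappa>" using fk by (rule mult_le_mono1)
        then show "Suc ((\<nu> + 2 * \<kappa>) * k) \<le> \<nu> * k + (\<nu> + 2 * \<kappa>)" unfolding \<nu>_def by (simp add: algebra_simps)
      qed
      also have "\<dots> = N ^ k * (M * K)" by (simp only: N_def MK power_add power_mult)
      finally show ?thesis .
    qed
    show "6 * (2048 * g) * (256 * g) \<le> 2 ^ (\<kappa> * L)"
    proof -
      have "6 * (2048 * g) * (256 * g) = g * g * 3145728" by simp
      also have "\<dots> \<le> g * g * B ^ 4" using B4 by (rule mult_le_mono2)
      finally show ?thesis using gg Km by simp
    qed
    show "M * K = 256 * g * H" by (rule MK256)
    show "\<kappa> * L * (K * N * (2048 * g) + 2 * M) < H"
    proof -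
      have LB: "L < B" unfolding B_def by (rule less_exp)
      have M0: "0 < M" using B1 by (simp add: Meq)
      \<comment> \<open>\<open>524800\<close> is \<open>256 * 2050\<close>. As \<open>L\<close> is
        only the logarithm of \<open>B\<close>, two factors \<open>B\<close> absorb everything
        besides \<open>M * (g * g)\<close>.\<close>
      have "256 * g * (\<kappa> * L * (K * N * (2048 * g) + 2 * M)) \<le> 256 * g * (\<kappa> * L * (M * (2050 * g)))"
      proof (intro mult_le_mono2)
        have "2 * M \<le> M * 2 * g" using g1 by simp
        then show "K * N * (2048 * g) + 2 * M \<le> M * (2050 * g)" by (simp add: M_def algebra_simps)
      qed
      also have "\<dots> = M * (g * g) * ((524800 * \<kappa>) * L)" by simp
      also have "\<dots> < M * (g * g) * (B * B)"
      proof -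
        have "(524800 * \<kappa>) * L < B * B"
          by (rule le_less_trans[OF mult_le_mono1[OF B\<kappa>]]) (use LB B1 in simp)
        then show ?thesis using M0 g1 by (intro mult_strict_left_mono) auto
      qed
      also have "\<dots> \<le> M * (g * g) * B ^ 4" using Bpow[of 2 4] by (intro mult_le_mono2) (simp add: power2_eq_square)
      also have "\<dots> = 256 * g * H" using gg MK256 by (simp add: mult.assoc)
      finally show ?thesis by (simp only: mult_less_cancel1)
    qed
    show "8 * D * (2 * r + 7) + 1 \<le> B" using r by (simp only: D_def)
    show "1 \<le> cc" using B1 by (simp add: cc_def)
    show "cc * (2 * M) * (k - 1) + (M * (2 ^ (\<kappa> * L))\<^sup>2 + M * 2 ^ (\<kappa> * L)) + 2 * M \<le> n"
    proof -
      have ccK: "cc = K * K * K" by (simp add: cc_def K_def power_add[symmetric] numeral_3_eq_3 add.assoc)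
      have K4: "4 \<le> K"
      proof -
        have "B ^ 1 \<le> K" unfolding K_def using \<kappa>4 by (intro Bpow) simp
        then show ?thesis using Bbig by simp
      qed
      have "K * K + K + 2 \<le> 2 * cc"
      proof -
        have "K * 1 \<le> K * K" using K4 by (intro mult_le_mono2) simp
        moreover have "4 * (K * K) \<le> K * (K * K)" using K4 by (rule mult_le_mono1)
        moreover have "2 \<le> K * K" using K4 \<open>K * 1 \<le> K * K\<close> by linarith
        ultimately have "K * K + K + 2 \<le> 2 * (K * (K * K))" by linarith
        then show ?thesis by (simp only: ccK mult.assoc)
      qed
      then have "M * (K * K + K + 2) \<le> M * (2 * cc)" by (rule mult_le_mono2)
      then have "cc * (2 * M) * (k - 1) + (M * K\<^sup>2 + M * K) + 2 * M \<le> cc * (2 * M) * (k - 1) + cc * (2 * M)"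
        by (simp add: power2_eq_square algebra_simps)
      also have "\<dots> = cc * (2 * M) * k" using k by (metis Suc_diff_1 add.commute less_le_trans mult_Suc_right pos2)
      also have "\<dots> = 2 * k * B ^ (3 * \<kappa> + (\<nu> + \<kappa>))" by (simp only: cc_def Meq power_add mult_ac)
      also have "3 * \<kappa> + (\<nu> + \<kappa>) = (f + 5) * \<kappa> + 9" by (simp add: \<nu>_def algebra_simps)
      finally show ?thesis using n by (simp add: Km)
    qed
  qed
  then obtain E where E: "is_graph n E" and gap: "real (cc * (2 * g * M)) / real (cc * (2 * M) * (k - 1) + (M * (2 ^ (\<kappa> * L))\<^sup>2 + M * 2 ^ (\<kappa> * L)) + M * K * (2 ^ (\<kappa> * L))\<^sup>2)
       \<le> integrality_gap E (2 * k - 1) r" by blast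
  have "real (B ^ d) / real k \<le> real (cc * (2 * g * M)) / real (cc * (2 * M) * (k - 1) + (M * (2 ^ (\<kappa> * L))\<^sup>2 + M * 2 ^ (\<kappa> * L)) + M * K * (2 ^ (\<kappa> * L))\<^sup>2)"
  proof -
    let ?y = "cc * (2 * M) * (k - 1) + (M * (2 ^ (\<kappa> * L))\<^sup>2 + M * 2 ^ (\<kappa> * L)) + M * K * (2 ^ (\<kappa> * L))\<^sup>2"
    have ccK: "cc = K * K * K" by (simp add: cc_def K_def power_add[symmetric] numeral_3_eq_3 add.assoc)
    have K4: "4 \<le> K"
    proof -
      have "B ^ 1 \<le> K" unfolding K_def using \<kappa>4 by (intro Bpow) simp
      then show ?thesis using Bbig by simp
    qed
    have M0: "0 < M" using B1 by (simp add: Meq)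
    have cc0: "0 < cc" using B1 by (simp add: cc_def)
    have "K * K + K + K * K * K \<le> 2 * cc"
    proof -
      have "K * 1 \<le> K * K" using K4 by (intro mult_le_mono2) simp
      moreover have "4 * (K * K) \<le> K * (K * K)" using K4 by (rule mult_le_mono1)
      ultimately have "K * K + K + K * (K * K) \<le> 2 * (K * (K * K))" by linarith
      then show ?thesis by (simp only: ccK mult.assoc)
    qed
    then have "M * (K * K + K + K * K * K) \<le> M * (2 * cc)" by (rule mult_le_mono2)
    then have "?y \<le> cc * (2 * M) * (k - 1) + cc * (2 * M)" unfolding Km[symmetric]
      by (simp add: power2_eq_square algebra_simps)
    also have "\<dots> = cc * (2 * M) * k" using k by (metis Suc_diff_1 add.commute less_le_trans mult_Suc_right pos2)
    finally have y: "real ?y \<le> real (cc * (2 * M) * k)" by (simp only: of_nat_le_iff)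
    have "0 < M * K * (2 ^ (\<kappa> * L))\<^sup>2" using M0 K4 by simp
    then have y0: "0 < ?y" by linarith
    have "real (B ^ d) / real k = real (cc * (2 * g * M)) / real (cc * (2 * M) * k)"
      using cc0 M0 k by (simp add: g_def field_simps)
    also have "\<dots> \<le> real (cc * (2 * g * M)) / real ?y"
    proof (rule divide_left_mono[OF y])
      show "0 < real (cc * (2 * M) * k) * real ?y" using y0 cc0 M0 k by (intro mult_pos_pos) (simp_all only: of_nat_0_less_iff, simp)
    qed simp
    finally show ?thesis .
  qed
  then show ?thesis using E gap by (blast intro: order_trans)
qed

section \<open>Choice of parameters\<close>

text \<open>Serves large \<open>\<epsilon>\<close>, where the claimed exponent is not positive. On a
  single edge the constant solution 1 is feasible and the edge itself must be bought.\<close>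

lemma trivial_instance:
  assumes n: "n \<ge> 2" and t: "t \<ge> 1"
  shows "\<exists>E. is_graph n E \<and> 1 \<le> integrality_gap E t r"
proof -
  define E :: "nat set set" where "E = {{0, 1}}"
  have "0 < n \<and> 1 < n \<and> 0 \<noteq> (1 :: nat) \<and> {0, 1} = {0, 1 :: nat}" using n by simp
  then have G: "is_graph n E" unfolding is_graph_def E_def by blast
  have square: "(\<Sum>i\<in>S. \<Sum>j\<in>S. x i * x j * a) = (\<Sum>i\<in>S. x i)\<^sup>2 * a" for S :: "nat set set set" and x and a :: real
    unfolding power2_eq_square sum_product by (simp add: sum_distrib_right)
  have feas: "sdp_feasible E t r (\<lambda>_. 1)"
    unfolding sdp_feasible_def
  proof (intro conjI allI impI ballI)
    show "psd_on (lasserre_index E (r + 1)) (\<lambda>I J. 1)" unfolding psd_on_def square by simp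
    fix u v z assume uv: "{u, v} \<in> E" and z: "z \<in> Zset E t u v"
    have "u \<noteq> v" using uv by (auto simp: E_def doubleton_eq_iff)
    from edge_in_short_paths[OF this uv t] z have "1 \<le> (\<Sum>e\<in>path_edges [u, v]. z e)" by (auto simp: Zset_def)
    then have "1 \<le> z {0, 1}" using uv by (simp add: path_edges_Cons path_edges_single E_def)
    then show "psd_on (lasserre_index E r) (\<lambda>I J. (\<Sum>f\<in>E. z f * 1) - 1)"
      unfolding psd_on_def square by (auto simp: E_def intro!: mult_nonneg_nonneg)
  qed auto
  have "1 \<le> real (card S)" if S: "is_spanner E t S" for S
  proof -
    have "{0, 1} \<in> E" by (simp add: E_def)
    then have "short_paths S t 0 1 \<noteq> {}" using S unfolding is_spanner_def by blast
    then obtain p where p: "p \<noteq> []" "hd p = 0" "last p = 1" "path_edges p \<subseteq> S"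
      by (auto simp: short_paths_def is_path_def)
    then obtain b q where "p = 0 # b # q" by (cases p; cases "tl p") auto
    then have "S \<noteq> {}" using p(4) by (auto simp: path_edges_Cons)
    moreover have "finite S" using S finite_subset[of S E] by (auto simp: is_spanner_def E_def)
    ultimately show ?thesis by (simp add: Suc_le_eq card_gt_0_iff)
  qed
  then have "1 / 1 \<le> integrality_gap E t r"
    using t by (intro integrality_gap_ge[OF G _ _ _ feas]) (auto simp: E_def)
  then show ?thesis using G by auto
qed

text \<open>For \<open>k \<le> 3\<close> the maximum is 4 and the right side is
  \<open>1 / 18\<close>; for larger \<open>k\<close> it is \<open>1 / (4 * k + 4)\<close>, which
  exceeds the second term of the minimum.\<close>

lemma exponent_le:
  fixes k :: nat
  assumes "k \<ge> 2"
  shows "min (1 / 18) (5 / (32 * real k - 6)) \<le> 1 / (2 * real (max 4 (2 * k - 3) + 5))"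
proof (cases "k \<le> 3")
  case True
  then have "max 4 (2 * k - 3) = 4" by auto
  then show ?thesis by simp
next
  case False
  then have "max 4 (2 * k - 3) + 5 = 2 * k + 2" by auto
  moreover have "5 / (32 * real k - 6) \<le> 1 / (2 * real (2 * k + 2))"
    using False by (simp add: field_simps)
  ultimately show ?thesis by (metis min.coboundedI2)
qed

text \<open>The exponent reached is \<open>d / e\<close> with \<open>e\<close> about
  \<open>\<phi> * (2 * d + 5)\<close>; it falls short of \<open>1 / (2 * \<phi>)\<close> by order
  \<open>1 / (\<phi> * d)\<close>. With \<open>d\<close> about
  \<open>1 / (\<phi> * \<epsilon>)\<close> this loss is of order \<open>\<epsilon>\<close>, while
  \<open>\<epsilon> * e\<close> stays bounded, so that \<open>B\<close> remains a power of
  \<open>n\<close> with exponent of order \<open>\<epsilon>\<close>, enough to pay for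
  \<open>r\<close>.\<close>

lemma nontrivial_instances:
  fixes k :: nat and \<epsilon> :: real
  assumes k: "k \<ge> 2" and \<epsilon>: "0 < \<epsilon>" and nontriv: "3 * \<epsilon> < min (1 / 18) (5 / (32 * real k - 6))"
  shows "\<exists>N::nat. \<forall>n \<ge> N. \<exists>E. is_graph n E \<and>
       (1 / real k) * (real n / real k) powr (min (1 / 18) (5 / (32 * real k - 6)) - 3 * \<epsilon>)
       \<le> integrality_gap E (2 * k - 1) (nat \<lfloor>real n powr (1 / 18 * \<epsilon>)\<rfloor>)"
proof -
  define x where "x = min (1 / 18) (5 / (32 * real k - 6))"
  define f where "f = max 4 (2 * k - 3)"
  define \<phi> where "\<phi> = f + 5"
  define d where "d = nat \<lceil>1 / (real \<phi> * \<epsilon>)\<rceil>"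
  define \<kappa> where "\<kappa> = 2 * d + 4"
  define e where "e = (f + 5) * \<kappa> + 9"
  define D where "D = f * \<kappa> + 7"
  \<comment> \<open>Collects the lower bounds that do not involve \<open>n\<close>. The summand
    \<open>2 ^ (d + 1)\<close> pays for the factors 2 by which \<open>B\<close> and \<open>v\<close>
    are off in the final estimate.\<close>
  define Y0 :: real where "Y0 = 2 * (8 * real D * (4 * real k + 7) + 1) + 2 * (524800 * real \<kappa> * real k) + 2 ^ (d + 1)"
  define N where "N = nat \<lceil>2 * real k * Y0 powr (18 / \<epsilon>)\<rceil>"
  have \<phi>9: "9 \<le> \<phi>" by (simp add: \<phi>_def f_def)
  have x_le: "x \<le> 1 / (2 * real \<phi>)" using exponent_le[OF k] by (simp add: x_def \<phi>_def f_def)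
  have x18: "x \<le> 1 / 18" by (simp add: x_def)
  have x3: "3 * \<epsilon> < x" using nontriv by (simp add: x_def)
  have "3 * \<epsilon> < 1 / (2 * real \<phi>)" using x3 x_le by linarith
  then have "3 * \<epsilon> * (2 * real \<phi>) < 1" using \<phi>9 by (simp add: pos_less_divide_eq)
  then have \<phi>\<epsilon>: "real \<phi> * \<epsilon> \<le> 1 / 6" by (simp add: mult.commute)
  have \<phi>\<epsilon>0: "0 < real \<phi> * \<epsilon>" using \<phi>9 \<epsilon> by simp
  have "1 / (real \<phi> * \<epsilon>) \<le> real d" unfolding d_def by linarith
  then have d_lo: "1 \<le> real \<phi> * \<epsilon> * real d" using \<phi>\<epsilon>0 by (simp add: pos_divide_le_eq mult.commute)
  have "real d < 1 / (real \<phi> * \<epsilon>) + 1" unfolding d_def using \<phi>\<epsilon>0 by (simp add: ceiling_less_iff) linarith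
  then have "real \<phi> * \<epsilon> * real d < real \<phi> * \<epsilon> * (1 / (real \<phi> * \<epsilon>) + 1)" using \<phi>\<epsilon>0 by (rule mult_strict_left_mono)
  also have "\<dots> = 1 + real \<phi> * \<epsilon>" using \<phi>9 \<epsilon> by (simp add: field_simps)
  finally have d_hi: "real \<phi> * \<epsilon> * real d \<le> 2" using \<phi>\<epsilon> by linarith
  have e_le: "real e \<le> real \<phi> * (2 * real d + 5)"
    using \<phi>9 by (simp add: e_def \<kappa>_def \<phi>_def algebra_simps)
  have "0 < e" by (simp add: e_def)
  then have e0: "0 < real e" by simp
  have "\<epsilon> * real e \<le> \<epsilon> * (real \<phi> * (2 * real d + 5))" using e_le \<epsilon> by (intro mult_left_mono) auto
  also have "\<dots> = 2 * (real \<phi> * \<epsilon> * real d) + 5 * (real \<phi> * \<epsilon>)" by (simp add: algebra_simps)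
  also have "\<dots> \<le> 9" using d_hi \<phi>\<epsilon> by linarith
  finally have \<epsilon>_e: "\<epsilon> / 9 \<le> 1 / real e" using e0 by (simp add: field_simps)
  \<comment> \<open>\<open>5 / 4\<close> is chosen so that
    \<open>5 / 4 * \<epsilon> * \<phi> * (2 * d)\<close> is at least the excess
    \<open>5 / 2\<close>, by \<open>d \<ge> 1 / (\<phi> * \<epsilon>)\<close>.\<close>
  have x_e: "x - 5 / 4 * \<epsilon> \<le> real d / real e"
  proof -
    have "(x - 5 / 4 * \<epsilon>) * real e \<le> (1 / (2 * real \<phi>) - 5 / 4 * \<epsilon>) * (real \<phi> * (2 * real d + 5))"
    proof (rule mult_mono[OF _ e_le])
      show "x - 5 / 4 * \<epsilon> \<le> 1 / (2 * real \<phi>) - 5 / 4 * \<epsilon>" using x_le by linarith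
      show "0 \<le> 1 / (2 * real \<phi>) - 5 / 4 * \<epsilon>" using x_le x3 \<epsilon> by linarith
    qed simp
    also have "\<dots> = (1 / (2 * real \<phi>) * real \<phi>) * (2 * real d + 5) - 5 / 4 * (real \<phi> * \<epsilon>) * (2 * real d + 5)"
      by (simp only: left_diff_distrib) (simp only: mult_ac)
    also have "1 / (2 * real \<phi>) * real \<phi> = 1 / 2" using \<phi>9 by simp
    also have "1 / 2 * (2 * real d + 5) - 5 / 4 * (real \<phi> * \<epsilon>) * (2 * real d + 5) =
        real d + 5 / 2 - 5 / 2 * (real \<phi> * \<epsilon> * real d) - 25 / 4 * (real \<phi> * \<epsilon>)"
      by (simp add: algebra_simps)
    also have "\<dots> \<le> real d" using d_lo \<phi>\<epsilon>0 by linarith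
    finally show ?thesis using e0 by (simp add: pos_le_divide_eq)
  qed
  have Y0_1: "2 ^ (d + 1) \<le> Y0" "2 * (8 * real D * (4 * real k + 7) + 1) \<le> Y0" "2 * (524800 * real \<kappa> * real k) \<le> Y0" "1 \<le> Y0"
  proof -
    have aux: "s \<le> 2 * (p + 1) + 2 * q + s \<and> 2 * (p + 1) \<le> 2 * (p + 1) + 2 * q + s \<and>
        2 * q \<le> 2 * (p + 1) + 2 * q + s \<and> 1 \<le> 2 * (p + 1) + 2 * q + s"
      if "0 \<le> p" "0 \<le> q" "0 \<le> s" for p q s :: real using that by auto
    have "0 \<le> 8 * real D * (4 * real k + 7)" "0 \<le> 524800 * real \<kappa> * real k" "(0 :: real) \<le> 2 ^ (d + 1)" by simp_all
    from aux[OF this] show "2 ^ (d + 1) \<le> Y0" "2 * (8 * real D * (4 * real k + 7) + 1) \<le> Y0"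
      "2 * (524800 * real \<kappa> * real k) \<le> Y0" "1 \<le> Y0" unfolding Y0_def by blast+
  qed
  show ?thesis
  proof (rule exI[of _ N], intro allI impI)
    fix n assume nN: "N \<le> n"
    define v where "v = real n / (2 * real k)"
    \<comment> \<open>Origin of the rate \<open>1 / 18\<close>: \<open>2 * B\<close> is at least
      \<open>v powr (\<epsilon> / 9) = Y * Y\<close>. One factor pays for \<open>r\<close>, which is
      at most \<open>2 * k * Y\<close>, the other for the constants in \<open>Y0\<close>.\<close>
    define Y where "Y = v powr (\<epsilon> / 18)"
    have k0: "0 < real k" using k by simp
    have "2 * real k * Y0 powr (18 / \<epsilon>) \<le> real n" using nN unfolding N_def by linarith
    then have vY0: "Y0 powr (18 / \<epsilon>) \<le> v" using k0 by (simp add: v_def pos_le_divide_eq mult.commute)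
    have "1 \<le> Y0 powr (18 / \<epsilon>)" using Y0_1(4) \<epsilon> by (simp add: ge_one_powr_ge_zero)
    then have v1: "1 \<le> v" using vY0 by linarith
    have "(Y0 powr (18 / \<epsilon>)) powr (\<epsilon> / 18) \<le> Y" unfolding Y_def using vY0 \<epsilon> by (intro powr_mono2) auto
    then have Y_Y0: "Y0 \<le> Y" using \<epsilon> Y0_1(4) by (simp add: powr_powr)
    have n2k: "2 * k \<le> n"
    proof -
      have "2 * real k \<le> real n" using v1 k0 by (simp add: v_def pos_le_divide_eq)
      then show ?thesis by linarith
    qed
    \<comment> \<open>The largest power of two whose instance fits on \<open>n\<close> vertices, so
      that rounding costs \<open>B\<close> a factor of at most 2.\<close>
    have "\<exists>L<n. (\<forall>i\<le>L. \<not> n < 2 * k * (2 ^ i) ^ e) \<and> n < 2 * k * (2 ^ Suc L) ^ e"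
    proof (rule ex_least_nat_less[where P = "\<lambda>L. n < 2 * k * (2 ^ L) ^ e"])
      have "n < 2 ^ n" by (rule less_exp)
      also have "(2 :: nat) ^ n \<le> (2 ^ n) ^ e" by (rule self_le_power) (auto simp: e_def)
      also have "\<dots> \<le> 2 * k * (2 ^ n) ^ e" using k by simp
      finally show "n < 2 * k * (2 ^ n) ^ e" .
    qed (use n2k in simp)
    then obtain L where L1: "2 * k * (2 ^ L) ^ e \<le> n" and L2: "n < 2 * k * (2 ^ Suc L) ^ e" by (auto simp: not_less)
    define B :: nat where "B = 2 ^ L"
    have B0: "0 < real B" by (simp add: B_def)
    have vB: "v powr (1 / real e) \<le> 2 * real B"
    proof -
      have "real n < real (2 * k * (2 ^ Suc L) ^ e)" using L2 by (simp only: of_nat_less_iff)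
      also have "\<dots> = 2 * real k * (2 * real B) ^ e" by (simp add: B_def)
      finally have "v \<le> (2 * real B) ^ e" using k0 by (simp add: v_def pos_divide_le_eq mult.commute)
      also have "\<dots> = (2 * real B) powr real e" using B0 by (simp add: powr_realpow)
      finally have "v powr (1 / real e) \<le> ((2 * real B) powr real e) powr (1 / real e)" using v1 e0 by (intro powr_mono2) auto
      also have "\<dots> = 2 * real B" using e0 B0 by (simp add: powr_powr)
      finally show ?thesis .
    qed
    have Y1: "1 \<le> Y" using Y_Y0 Y0_1(4) by linarith
    have YB: "Y * Y \<le> 2 * real B"
    proof -
      have "Y * Y = v powr (\<epsilon> / 9)" unfolding Y_def by (simp add: powr_add[symmetric])
      also have "\<dots> \<le> v powr (1 / real e)" using \<epsilon>_e v1 by (rule powr_mono)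
      finally show ?thesis using vB by linarith
    qed
    have BY: "Y0 * Y \<le> 2 * real B"
    proof -
      have "Y0 * Y \<le> Y * Y" using Y_Y0 Y1 by (intro mult_right_mono) auto
      then show ?thesis using YB by linarith
    qed
    have B_large: "524800 * \<kappa> * k \<le> B"
    proof -
      have "2 * (524800 * real \<kappa> * real k) \<le> Y0 * 1" using Y0_1(3) by simp
      also have "\<dots> \<le> Y0 * Y" using Y1 Y0_1(4) by (intro mult_left_mono) auto
      finally have "real (524800 * \<kappa> * k) \<le> real B" using BY by simp
      then show ?thesis by (simp only: of_nat_le_iff)
    qed
    define r where "r = nat \<lfloor>real n powr (1 / 18 * \<epsilon>)\<rfloor>"
    have r_le: "real r \<le> 2 * real k * Y"
    proof -
      have "real r \<le> real n powr (1 / 18 * \<epsilon>)" unfolding r_def by simp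
      also have "real n = (2 * real k) * v" using k0 by (simp add: v_def)
      also have "((2 * real k) * v) powr (1 / 18 * \<epsilon>) = (2 * real k) powr (1 / 18 * \<epsilon>) * Y"
        using k0 v1 by (simp add: powr_mult Y_def)
      also have "\<dots> \<le> (2 * real k) powr 1 * Y"
        using k x18 x3 Y1 by (intro mult_right_mono powr_mono) auto
      finally show ?thesis using k0 by simp
    qed
    have r_bound: "8 * D * (2 * r + 7) + 1 \<le> B"
    proof -
      have "8 * real D * (2 * real r + 7) + 1 \<le> 8 * real D * (4 * real k * Y + 7 * Y) + 1 * Y"
      proof -
        have "2 * real r \<le> 4 * real k * Y" using r_le by linarith
        then show ?thesis using Y1 by (intro add_mono mult_left_mono) simp_all
      qed
      also have "\<dots> = (8 * real D * (4 * real k + 7) + 1) * Y" by (simp add: algebra_simps)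
      also have "\<dots> \<le> (Y0 / 2) * Y" using Y0_1(2) Y1 by (intro mult_right_mono) auto
      finally have "8 * real D * (2 * real r + 7) + 1 \<le> real B" using BY by simp
      then have "real (8 * D * (2 * r + 7) + 1) \<le> real B" by simp
      then show ?thesis by (simp only: of_nat_le_iff)
    qed
    obtain E where E: "is_graph n E" "real (B ^ d) / real k \<le> integrality_gap E (2 * k - 1) r"
      using gap_instance_power[where k = k and d = d and L = L and r = r and n = n] k B_large r_bound L1
      by (auto simp: B_def \<kappa>_def f_def[symmetric] D_def e_def)
    have "(real n / real k) powr (x - 3 * \<epsilon>) \<le> real (B ^ d)"
    proof -
      have nv: "real n / real k = 2 * v" using k0 by (simp add: v_def)
      have "2 ^ d * (2 * v) powr (x - 3 * \<epsilon>) = 2 ^ d * (2 powr (x - 3 * \<epsilon>) * v powr (x - 3 * \<epsilon>))"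
        using v1 by (simp add: powr_mult)
      also have "\<dots> \<le> 2 ^ d * (2 powr 1 * v powr (x - 3 * \<epsilon>))"
        using x18 \<epsilon> by (intro mult_left_mono mult_right_mono powr_mono) auto
      also have "\<dots> = 2 ^ (d + 1) * v powr (x - 3 * \<epsilon>)" by simp
      also have "\<dots> \<le> Y * v powr (x - 3 * \<epsilon>)" using Y0_1(1) Y_Y0 by (intro mult_right_mono) auto
      also have "\<dots> = v powr (\<epsilon> / 18 + (x - 3 * \<epsilon>))" by (simp only: Y_def powr_add)
      also have "\<dots> \<le> v powr (real d / real e)" using x_e \<epsilon> v1 by (intro powr_mono) auto
      also have "\<dots> = (v powr (1 / real e)) ^ d"
        using v1 by (simp add: powr_realpow[symmetric] powr_powr)
      also have "\<dots> \<le> (2 * real B) ^ d" using vB by (intro power_mono) auto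
      also have "\<dots> = 2 ^ d * real (B ^ d)" by (simp add: power_mult_distrib)
      finally show ?thesis unfolding nv by simp
    qed
    then have "(1 / real k) * (real n / real k) powr (x - 3 * \<epsilon>) \<le> (1 / real k) * real (B ^ d)"
      using k0 by (intro mult_left_mono) auto
    then have "(1 / real k) * (real n / real k) powr (x - 3 * \<epsilon>) \<le> integrality_gap E (2 * k - 1) r"
      using E(2) by simp
    then show "\<exists>E. is_graph n E \<and>
       (1 / real k) * (real n / real k) powr (min (1 / 18) (5 / (32 * real k - 6)) - 3 * \<epsilon>)
       \<le> integrality_gap E (2 * k - 1) (nat \<lfloor>real n powr (1 / 18 * \<epsilon>)\<rfloor>)"
      using E(1) unfolding x_def r_def by blast
  qed
qed

theorem theorem2:
  shows "\<exists>c > 0. \<exists>C > 0. \<forall>\<epsilon>::real. 0 < \<epsilon> \<and> \<epsilon> < 1 \<longrightarrow>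
    (\<forall>k::nat. k \<ge> 2 \<longrightarrow> (\<exists>N::nat. \<forall>n \<ge> N. \<exists>E.
       is_graph n E \<and>
       integrality_gap E (2 * k - 1) (nat \<lfloor>real n powr (c * \<epsilon>)\<rfloor>)
         \<ge> (1 / real k) * (real n / real k) powr
              (min (1 / 18) (5 / (32 * real k - 6)) - C * \<epsilon>)))"
proof (rule exI[of _ "1 / 18"], rule conjI, simp, rule exI[of _ 3], rule conjI, simp, intro allI impI)
  fix \<epsilon> :: real and k :: nat
  assume \<epsilon>: "0 < \<epsilon> \<and> \<epsilon> < 1" and k: "2 \<le> k"
  let ?x = "min (1 / 18) (5 / (32 * real k - 6))"
  show "\<exists>N::nat. \<forall>n \<ge> N. \<exists>E. is_graph n E \<and>
       integrality_gap E (2 * k - 1) (nat \<lfloor>real n powr (1 / 18 * \<epsilon>)\<rfloor>)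
         \<ge> (1 / real k) * (real n / real k) powr (?x - 3 * \<epsilon>)"
  \<comment> \<open>If the exponent is not positive, the claimed bound is at most
    \<open>1 / k\<close> as soon as \<open>n \<ge> k\<close>, and any instance of gap at least 1
    will do.\<close>
  proof (cases "3 * \<epsilon> < ?x")
    case True
    then show ?thesis using nontrivial_instances k \<epsilon> by blast
  next
    case False
    show ?thesis
    proof (rule exI[of _ k], intro allI impI)
      fix n assume n: "k \<le> n"
      obtain E where E: "is_graph n E" "1 \<le> integrality_gap E (2 * k - 1) (nat \<lfloor>real n powr (1 / 18 * \<epsilon>)\<rfloor>)"
      proof -
        have "2 \<le> n" "1 \<le> 2 * k - 1" using n k by auto
        then show ?thesis using trivial_instance that by blast
      qed
      have "(real n / real k) powr (?x - 3 * \<epsilon>) \<le> (real n / real k) powr 0"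
        using n k False by (intro powr_mono) auto
      also have "\<dots> \<le> 1" by (simp add: powr_zero_eq_one)
      finally have "(1 / real k) * (real n / real k) powr (?x - 3 * \<epsilon>) \<le> (1 / real k) * 1"
        by (intro mult_left_mono) auto
      also have "\<dots> \<le> 1" using k by simp
      finally show "\<exists>E. is_graph n E \<and>
       integrality_gap E (2 * k - 1) (nat \<lfloor>real n powr (1 / 18 * \<epsilon>)\<rfloor>)
         \<ge> (1 / real k) * (real n / real k) powr (?x - 3 * \<epsilon>)" using E by (meson order_trans)
    qed
  qed
qed

end
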